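(* In $\mathfrak{sl}_6(\mathbb C)$ there exist a Richardson orbital variety $\mathcal V_{\mathcal I}$ and a geometric descendant $\mathcal W$ of $\mathcal V_{\mathcal I}$ such that (i) $\operatorname{codim}_{\mathfrak m_{\mathcal I}}\overline{\mathcal W}=2$; (ii) $\mathcal O_{\mathcal W}$ is a descendant of $\mathcal O_{\mathcal I}$; (iii) $\mathcal W$ is not a complete intersection. Namely, one can take $\mathcal I=\{\alpha_1,\alpha_2,\alpha_5\}$ and $\mathcal W=\mathcal V_T$, where $T$ is the standard Young tableau with rows $(1,4,5),(2),(3),(6)$.
   Context: Let $\mathfrak g=\mathfrak{sl}_n(\mathbb C)$ (here $n=6$), $\mathfrak n$ the strictly upper triangular matrices, $\mathbf B$ the upper triangular Borel subgroup of $SL_n(\mathbb C)$, $\alpha_{i,j}=\alpha_i+\cdots+\alpha_{j-1}$ ($i<j$) the positive roots with root spaces $X_{\alpha_{i,j}}=\mathbb C e_{i,j}$. Closures are Zariski closures. An orbital variety associated to a nilpotent orbit $\mathcal O$ is an irreducible component of $\mathcal O\cap\mathfrak n$; for an orbital variety $\mathcal V$, $\mathcal O_{\mathcal V}$ denotes the orbit it is associated to. For $w\in S_n$ put $\mathfrak n\cap{}^w\mathfrak n=\bigoplus_{\alpha\in R^+\cap w(R^+)}X_\alpha$; $\overline{\mathbf B(\mathfrak n\cap{}^w\mathfrak n)}$ is the closure of a unique orbital variety $\mathcal V_w$ (Steinberg), and $\mathcal V_w$ depends only on the insertion tableau $T(w)$ of the Robinson–Schensted row insertion of $w(1),\dots,w(n)$.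 For a standard Young tableau $T$, $\mathcal V_T$ is $\mathcal V_w$ for any $w$ with $T(w)=T$. For $\mathcal I\subseteq\Pi$, $\mathfrak m_{\mathcal I}$ is the nilradical of the standard (block upper triangular) parabolic subalgebra generated by the upper triangular traceless matrices and the $\mathbb C e_{i+1,i}$ with $\alpha_i\in\mathcal I$. The Richardson orbital variety $\mathcal V_{\mathcal I}$ is the orbital variety with closure $\mathfrak m_{\mathcal I}$, and $\mathcal O_{\mathcal I}=\mathcal O_{\mathcal V_{\mathcal I}}$. $\mathcal W$ is a geometric descendant of $\mathcal V$ if $\overline{\mathcal W}\subsetneq\overline{\mathcal V}$ and no orbital variety $\mathcal Y$ satisfies $\overline{\mathcal W}\subsetneq\overline{\mathcal Y}\subsetneq\overline{\mathcal V}$. A nilpotent orbit $\mathcal O'$ is a descendant of $\mathcal O$ if $\overline{\mathcal O'}\subsetneq\overline{\mathcal O}$ and no nilpotent orbit has closure strictly between them. "$\mathcal W$ is a complete intersection" means that the ideal of polynomial functions on $\mathfrak m_{\mathcal I}$ vanishing on $\overline{\mathcal W}$ can be generated by $\operatorname{codim}_{\mathfrak m_{\mathcal I}}\overline{\mathcal W}$ elements. *)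

theory Defs
  imports
    "Jordan_Normal_Form.Jordan_Normal_Form"
    "HOL-Analysis.Abstract_Topology"
    "HOL-Algebra.Ideal"
    "HOL-Combinatorics.Permutations"
    "HOL-Library.Extended_Nat"
begin

text \<open>Rows, columns, roots and permutations are numbered from 1 as usual in the subject,
  whereas the entries \<open>X $$ (r, c)\<close> of a matrix are numbered from 0.\<close>

section \<open>The Lie algebra and its standard subalgebras\<close>

definition special_linear_algebra :: "nat \<Rightarrow> complex mat set" (\<open>\<ss>\<ll>\<close>) where
  "\<ss>\<ll> n = {X \<in> carrier_mat n n. (\<Sum>i<n. X $$ (i, i)) = 0}"

definition strictly_upper :: "nat \<Rightarrow> complex mat set" where
  "strictly_upper n = {X \<in> carrier_mat n n. \<forall>i<n. \<forall>j\<le>i. X $$ (i, j) = 0}"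

definition mat_unit :: "nat \<Rightarrow> nat \<Rightarrow> nat \<Rightarrow> complex mat" where
  "mat_unit n i j = mat n n (\<lambda>(r, c). if r + 1 = i \<and> c + 1 = j then 1 else 0)"

definition lie_bracket :: "complex mat \<Rightarrow> complex mat \<Rightarrow> complex mat" where
  "lie_bracket X Y = X * Y - Y * X"

definition mat_subspace :: "nat \<Rightarrow> complex mat set \<Rightarrow> bool" where
  "mat_subspace n V \<longleftrightarrow> V \<subseteq> carrier_mat n n \<and> 0\<^sub>m n n \<in> V \<and>
     (\<forall>X\<in>V. \<forall>Y\<in>V. X + Y \<in> V) \<and> (\<forall>c. \<forall>X\<in>V. c \<cdot>\<^sub>m X \<in> V)"

definition mat_span :: "nat \<Rightarrow> complex mat set \<Rightarrow> complex mat set" where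
  "mat_span n S = \<Inter> {V. mat_subspace n V \<and> S \<subseteq> V}"

definition lie_subalgebra :: "nat \<Rightarrow> complex mat set \<Rightarrow> bool" where
  "lie_subalgebra n L \<longleftrightarrow> mat_subspace n L \<and> (\<forall>X\<in>L. \<forall>Y\<in>L. lie_bracket X Y \<in> L)"

definition lie_generated :: "nat \<Rightarrow> complex mat set \<Rightarrow> complex mat set" where
  "lie_generated n S = \<Inter> {L. lie_subalgebra n L \<and> S \<subseteq> L}"

definition lie_ideal :: "nat \<Rightarrow> complex mat set \<Rightarrow> complex mat set \<Rightarrow> bool" where
  "lie_ideal n J L \<longleftrightarrow> mat_subspace n J \<and> J \<subseteq> L \<and> (\<forall>X\<in>L. \<forall>Y\<in>J. lie_bracket X Y \<in> J)"

primrec lower_central :: "nat \<Rightarrow> complex mat set \<Rightarrow> nat \<Rightarrow> complex mat set" where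
  "lower_central n L 0 = L"
| "lower_central n L (Suc k) =
     mat_span n {lie_bracket X Y | X Y. X \<in> L \<and> Y \<in> lower_central n L k}"

definition lie_nilpotent :: "nat \<Rightarrow> complex mat set \<Rightarrow> bool" where
  "lie_nilpotent n L \<longleftrightarrow> (\<exists>k. lower_central n L k = {0\<^sub>m n n})"

text \<open>The sum of two nilpotent ideals is a nilpotent ideal, so in finite dimension the union of
  all of them is itself the largest nilpotent ideal.\<close>

definition nilradical :: "nat \<Rightarrow> complex mat set \<Rightarrow> complex mat set" where
  "nilradical n L = \<Union> {J. lie_ideal n J L \<and> lie_nilpotent n J}"

text \<open>A set \<open>I \<subseteq> {1..<n}\<close> stands for the set of simple roots \<open>\<alpha>\<^sub>i\<close> with \<open>i \<in> I\<close>.\<close>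

definition std_parabolic :: "nat \<Rightarrow> nat set \<Rightarrow> complex mat set" where
  "std_parabolic n I = lie_generated n
     ({X \<in> \<ss>\<ll> n. upper_triangular X} \<union> {mat_unit n (i + 1) i | i. i \<in> I})"

definition parabolic_nilradical :: "nat \<Rightarrow> nat set \<Rightarrow> complex mat set" (\<open>\<mm>\<close>) where
  "\<mm> n I = nilradical n (std_parabolic n I)"

section \<open>Polynomial functions and the Zariski topology\<close>

inductive_set polyfuns :: "nat \<Rightarrow> (complex mat \<Rightarrow> complex) set" for n where
  const: "(\<lambda>X. c) \<in> polyfuns n"
| entry: "i < n \<Longrightarrow> j < n \<Longrightarrow> (\<lambda>X. X $$ (i, j)) \<in> polyfuns n"
| add: "f \<in> polyfuns n \<Longrightarrow> g \<in> polyfuns n \<Longrightarrow> (\<lambda>X. f X + g X) \<in> polyfuns n"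
| mult: "f \<in> polyfuns n \<Longrightarrow> g \<in> polyfuns n \<Longrightarrow> (\<lambda>X. f X * g X) \<in> polyfuns n"

definition zero_locus :: "nat \<Rightarrow> (complex mat \<Rightarrow> complex) set \<Rightarrow> complex mat set" where
  "zero_locus n F = {X \<in> \<ss>\<ll> n. \<forall>f\<in>F. f X = 0}"

definition zariski :: "nat \<Rightarrow> complex mat topology" where
  "zariski n = topology (\<lambda>U. \<exists>F \<subseteq> polyfuns n. U = \<ss>\<ll> n - zero_locus n F)"

lemma istopology_zariski: "istopology (\<lambda>U. \<exists>F \<subseteq> polyfuns n. U = \<ss>\<ll> n - zero_locus n F)"
  unfolding istopology_def
proof (intro conjI allI impI)
  fix S T
  assume "\<exists>F\<subseteq>polyfuns n. S = \<ss>\<ll> n - zero_locus n F" "\<exists>F\<subseteq>polyfuns n. T = \<ss>\<ll> n - zero_locus n F"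
  then obtain F G where FG: "F \<subseteq> polyfuns n" "S = \<ss>\<ll> n - zero_locus n F"
    "G \<subseteq> polyfuns n" "T = \<ss>\<ll> n - zero_locus n G" by blast
  let ?H = "{\<lambda>X. f X * g X | f g. f \<in> F \<and> g \<in> G}"
  have "?H \<subseteq> polyfuns n" using FG by (auto intro: polyfuns.mult)
  moreover have "S \<inter> T = \<ss>\<ll> n - zero_locus n ?H"
  proof (intro equalityI subsetI)
    fix X assume "X \<in> S \<inter> T"
    then obtain f g where "X \<in> \<ss>\<ll> n" "f \<in> F" "f X \<noteq> 0" "g \<in> G" "g X \<noteq> 0"
      unfolding FG zero_locus_def by blast
    then have "X \<in> \<ss>\<ll> n" "(\<lambda>X. f X * g X) \<in> ?H" "(\<lambda>X. f X * g X) X \<noteq> 0" by auto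
    then show "X \<in> \<ss>\<ll> n - zero_locus n ?H" unfolding zero_locus_def by fast
  next
    fix X assume "X \<in> \<ss>\<ll> n - zero_locus n ?H"
    then obtain h where "X \<in> \<ss>\<ll> n" "h \<in> ?H" "h X \<noteq> 0" unfolding zero_locus_def by blast
    then show "X \<in> S \<inter> T" unfolding FG zero_locus_def by auto
  qed
  ultimately show "\<exists>F\<subseteq>polyfuns n. S \<inter> T = \<ss>\<ll> n - zero_locus n F" by blast
next
  fix K
  assume "\<forall>S\<in>K. \<exists>F\<subseteq>polyfuns n. S = \<ss>\<ll> n - zero_locus n F"
  then obtain \<F> where \<F>: "\<forall>S\<in>K. \<F> S \<subseteq> polyfuns n \<and> S = \<ss>\<ll> n - zero_locus n (\<F> S)" by metis
  have "(\<Union>S\<in>K. \<F> S) \<subseteq> polyfuns n" using \<F> by blast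
  moreover have "\<Union> K = \<ss>\<ll> n - zero_locus n (\<Union>S\<in>K. \<F> S)"
  proof -
    have "\<Union> K = (\<Union>S\<in>K. \<ss>\<ll> n - zero_locus n (\<F> S))" using \<F> by blast
    also have "\<dots> = \<ss>\<ll> n - zero_locus n (\<Union>S\<in>K. \<F> S)" unfolding zero_locus_def by blast
    finally show ?thesis .
  qed
  ultimately show "\<exists>F\<subseteq>polyfuns n. \<Union> K = \<ss>\<ll> n - zero_locus n F" by blast
qed

lemma openin_zariski: "openin (zariski n) U \<longleftrightarrow> (\<exists>F \<subseteq> polyfuns n. U = \<ss>\<ll> n - zero_locus n F)"
  unfolding zariski_def using istopology_zariski by (simp add: topology_inverse')

lemma topspace_zariski: "topspace (zariski n) = \<ss>\<ll> n"
proof -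
  have "\<ss>\<ll> n = \<ss>\<ll> n - zero_locus n {\<lambda>X. 1}" by (auto simp: zero_locus_def)
  moreover have "{\<lambda>X. 1} \<subseteq> polyfuns n" by (simp add: polyfuns.const)
  ultimately have "openin (zariski n) (\<ss>\<ll> n)" unfolding openin_zariski by blast
  moreover have "U \<subseteq> \<ss>\<ll> n" if "openin (zariski n) U" for U
    using that unfolding openin_zariski by blast
  ultimately show ?thesis unfolding topspace_def by blast
qed

lemma closedin_zariski: "closedin (zariski n) C \<longleftrightarrow> (\<exists>F \<subseteq> polyfuns n. C = zero_locus n F)"
proof -
  have *: "zero_locus n F \<subseteq> \<ss>\<ll> n" for F by (auto simp: zero_locus_def)
  show ?thesis
    unfolding closedin_def topspace_zariski openin_zariski using * by blast
qed

text \<open>The qualified name avoids a clash with the syntax of \<open>eq_closure_of\<close>.\<close>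

abbreviation zariski_closure :: "nat \<Rightarrow> complex mat set \<Rightarrow> complex mat set" where
  "zariski_closure n S \<equiv> Abstract_Topology.closure_of (zariski n) S"

definition irreducible_in :: "'a topology \<Rightarrow> 'a set \<Rightarrow> bool" where
  "irreducible_in T S \<longleftrightarrow> S \<subseteq> topspace T \<and> S \<noteq> {} \<and>
     (\<forall>C D. closedin T C \<and> closedin T D \<and> S \<subseteq> C \<union> D \<longrightarrow> S \<subseteq> C \<or> S \<subseteq> D)"

definition irreducible_component :: "'a topology \<Rightarrow> 'a set \<Rightarrow> 'a set \<Rightarrow> bool" where
  "irreducible_component T S V \<longleftrightarrow> V \<subseteq> S \<and> irreducible_in T V \<and>
     (\<forall>V'. V \<subseteq> V' \<and> V' \<subseteq> S \<and> irreducible_in T V' \<longrightarrow> V' = V)"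

text \<open>Codimension in the space \<open>T\<close> of an irreducible closed subset \<open>Y\<close>: the supremum of the
  lengths of the chains of irreducible closed sets that start at \<open>Y\<close>.\<close>

definition codim_in :: "'a topology \<Rightarrow> 'a set \<Rightarrow> enat" where
  "codim_in T Y = Sup {enat k | k. \<exists>Z. Z 0 = Y \<and>
     (\<forall>i\<le>k. closedin T (Z i) \<and> irreducible_in T (Z i)) \<and> (\<forall>i<k. Z i \<subset> Z (Suc i))}"

definition coordinate_ring :: "nat \<Rightarrow> complex mat set \<Rightarrow> (complex mat \<Rightarrow> complex) ring" where
  "coordinate_ring n M =
     \<lparr>carrier = (\<lambda>f. restrict f M) ` polyfuns n,
      mult = (\<lambda>f g. \<lambda>X\<in>M. f X * g X), one = (\<lambda>X\<in>M. 1),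
      zero = (\<lambda>X\<in>M. 0), add = (\<lambda>f g. \<lambda>X\<in>M. f X + g X)\<rparr>"

lemma cring_coordinate_ring: "cring (coordinate_ring n M)"
proof -
  let ?R = "coordinate_ring n M"
  have carr: "(\<lambda>X\<in>M. f X) \<in> carrier ?R" if "f \<in> polyfuns n" for f
    using that by (simp add: coordinate_ring_def)
  have carrE: "\<exists>p\<in>polyfuns n. f = (\<lambda>X\<in>M. p X)" if "f \<in> carrier ?R" for f
    using that by (auto simp: coordinate_ring_def)
  have R_add: "f \<oplus>\<^bsub>?R\<^esub> g = (\<lambda>X\<in>M. f X + g X)" and R_mult: "f \<otimes>\<^bsub>?R\<^esub> g = (\<lambda>X\<in>M. f X * g X)"
    and R_0: "\<zero>\<^bsub>?R\<^esub> = (\<lambda>X\<in>M. 0)" and R_1: "\<one>\<^bsub>?R\<^esub> = (\<lambda>X\<in>M. 1)" for f g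
    by (simp_all add: coordinate_ring_def)
  have ext: "(\<lambda>X\<in>M. f X) = f" if "f \<in> carrier ?R" for f
    using carrE[OF that] by auto
  have add_closed: "f \<oplus>\<^bsub>?R\<^esub> g \<in> carrier ?R" if fg: "f \<in> carrier ?R" "g \<in> carrier ?R" for f g
  proof -
    obtain p q where pq: "p \<in> polyfuns n" "f = restrict p M" "q \<in> polyfuns n" "g = restrict q M"
      using carrE[OF fg(1)] carrE[OF fg(2)] by blast
    have "f \<oplus>\<^bsub>?R\<^esub> g = (\<lambda>X\<in>M. p X + q X)" unfolding R_add pq by (rule restrict_ext) simp
    then show ?thesis using carr[OF polyfuns.add[OF pq(1,3)]] by simp
  qed
  have mult_closed: "f \<otimes>\<^bsub>?R\<^esub> g \<in> carrier ?R" if fg: "f \<in> carrier ?R" "g \<in> carrier ?R" for f g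
  proof -
    obtain p q where pq: "p \<in> polyfuns n" "f = restrict p M" "q \<in> polyfuns n" "g = restrict q M"
      using carrE[OF fg(1)] carrE[OF fg(2)] by blast
    have "f \<otimes>\<^bsub>?R\<^esub> g = (\<lambda>X\<in>M. p X * q X)" unfolding R_mult pq by (rule restrict_ext) simp
    then show ?thesis using carr[OF polyfuns.mult[OF pq(1,3)]] by simp
  qed
  have uminus: "\<exists>g\<in>carrier ?R. g \<oplus>\<^bsub>?R\<^esub> f = \<zero>\<^bsub>?R\<^esub>" if "f \<in> carrier ?R" for f
  proof (rule bexI)
    have "(\<lambda>X\<in>M. - 1) \<in> carrier ?R" by (rule carr[OF polyfuns.const])
    from mult_closed[OF this that] show "(\<lambda>X\<in>M. - 1) \<otimes>\<^bsub>?R\<^esub> f \<in> carrier ?R" .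
    show "((\<lambda>X\<in>M. - 1) \<otimes>\<^bsub>?R\<^esub> f) \<oplus>\<^bsub>?R\<^esub> f = \<zero>\<^bsub>?R\<^esub>"
      unfolding R_add R_mult R_0 by (rule restrict_ext) simp
  qed
  have "abelian_group ?R"
  proof (rule abelian_groupI)
    show "\<zero>\<^bsub>?R\<^esub> \<in> carrier ?R" unfolding R_0 by (rule carr[OF polyfuns.const])
    show "f \<oplus>\<^bsub>?R\<^esub> g \<oplus>\<^bsub>?R\<^esub> h = f \<oplus>\<^bsub>?R\<^esub> (g \<oplus>\<^bsub>?R\<^esub> h)" for f g h
      unfolding R_add by (rule restrict_ext) (simp add: add.assoc)
    show "f \<oplus>\<^bsub>?R\<^esub> g = g \<oplus>\<^bsub>?R\<^esub> f" for f g
      unfolding R_add by (rule restrict_ext) (simp add: add.commute)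
    show "\<zero>\<^bsub>?R\<^esub> \<oplus>\<^bsub>?R\<^esub> f = f" if "f \<in> carrier ?R" for f
    proof -
      have "\<zero>\<^bsub>?R\<^esub> \<oplus>\<^bsub>?R\<^esub> f = (\<lambda>X\<in>M. f X)" unfolding R_add R_0 by (rule restrict_ext) simp
      then show ?thesis using ext[OF that] by simp
    qed
  qed (use add_closed uminus in auto)
  moreover have "comm_monoid ?R"
  proof (rule comm_monoidI)
    show "\<one>\<^bsub>?R\<^esub> \<in> carrier ?R" unfolding R_1 by (rule carr[OF polyfuns.const])
    show "f \<otimes>\<^bsub>?R\<^esub> g \<otimes>\<^bsub>?R\<^esub> h = f \<otimes>\<^bsub>?R\<^esub> (g \<otimes>\<^bsub>?R\<^esub> h)" for f g h
      unfolding R_mult by (rule restrict_ext) (simp add: mult.assoc)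
    show "f \<otimes>\<^bsub>?R\<^esub> g = g \<otimes>\<^bsub>?R\<^esub> f" for f g
      unfolding R_mult by (rule restrict_ext) (simp add: mult.commute)
    show "\<one>\<^bsub>?R\<^esub> \<otimes>\<^bsub>?R\<^esub> f = f" if "f \<in> carrier ?R" for f
    proof -
      have "\<one>\<^bsub>?R\<^esub> \<otimes>\<^bsub>?R\<^esub> f = (\<lambda>X\<in>M. f X)" unfolding R_mult R_1 by (rule restrict_ext) simp
      then show ?thesis using ext[OF that] by simp
    qed
  qed (use mult_closed in auto)
  moreover have "(f \<oplus>\<^bsub>?R\<^esub> g) \<otimes>\<^bsub>?R\<^esub> h = f \<otimes>\<^bsub>?R\<^esub> h \<oplus>\<^bsub>?R\<^esub> g \<otimes>\<^bsub>?R\<^esub> h" for f g h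
    unfolding R_add R_mult by (rule restrict_ext) (simp add: distrib_right)
  ultimately show ?thesis by (rule cringI)
qed

definition vanishing_ideal ::
  "nat \<Rightarrow> complex mat set \<Rightarrow> complex mat set \<Rightarrow> (complex mat \<Rightarrow> complex) set" where
  "vanishing_ideal n M Z = {f \<in> carrier (coordinate_ring n M). \<forall>X\<in>Z. f X = 0}"

section \<open>Nilpotent orbits and orbital varieties\<close>

definition SL_group :: "nat \<Rightarrow> complex mat set" where
  "SL_group n = {g \<in> carrier_mat n n. det g = 1}"

definition Borel :: "nat \<Rightarrow> complex mat set" where
  "Borel n = {g \<in> SL_group n. upper_triangular g}"

text \<open>\<open>conj_set G S\<close> consists of the matrices \<open>g X g\<^sup>-\<^sup>1\<close> with \<open>g \<in> G\<close> and \<open>X \<in> S\<close>.\<close>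

definition conj_set :: "complex mat set \<Rightarrow> complex mat set \<Rightarrow> complex mat set" where
  "conj_set G S = {Y. \<exists>X\<in>S. \<exists>g\<in>G. \<exists>h. similar_mat_wit Y X g h}"

definition nilpotent_orbit :: "nat \<Rightarrow> complex mat set \<Rightarrow> bool" where
  "nilpotent_orbit n O' \<longleftrightarrow>
     (\<exists>X \<in> \<ss>\<ll> n. (\<exists>k. X ^\<^sub>m k = 0\<^sub>m n n) \<and> O' = conj_set (SL_group n) {X})"

definition orbital_variety_of :: "nat \<Rightarrow> complex mat set \<Rightarrow> complex mat set \<Rightarrow> bool" where
  "orbital_variety_of n O' V \<longleftrightarrow>
     nilpotent_orbit n O' \<and> irreducible_component (zariski n) (O' \<inter> strictly_upper n) V"

definition orbital_variety :: "nat \<Rightarrow> complex mat set \<Rightarrow> bool" where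
  "orbital_variety n V \<longleftrightarrow> (\<exists>O'. orbital_variety_of n O' V)"

definition assoc_orbit :: "nat \<Rightarrow> complex mat set \<Rightarrow> complex mat set" where
  "assoc_orbit n V = (THE O'. orbital_variety_of n O' V)"

definition orbit_descendant :: "nat \<Rightarrow> complex mat set \<Rightarrow> complex mat set \<Rightarrow> bool" where
  "orbit_descendant n O' O'' \<longleftrightarrow> nilpotent_orbit n O' \<and> nilpotent_orbit n O'' \<and>
     zariski_closure n O' \<subset> zariski_closure n O'' \<and>
     \<not> (\<exists>P. nilpotent_orbit n P \<and> zariski_closure n O' \<subset> zariski_closure n P \<and>
          zariski_closure n P \<subset> zariski_closure n O'')"

definition geometric_descendant :: "nat \<Rightarrow> complex mat set \<Rightarrow> complex mat set \<Rightarrow> bool" where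
  "geometric_descendant n W V \<longleftrightarrow> orbital_variety n W \<and> orbital_variety n V \<and>
     zariski_closure n W \<subset> zariski_closure n V \<and>
     \<not> (\<exists>Y. orbital_variety n Y \<and> zariski_closure n W \<subset> zariski_closure n Y \<and>
          zariski_closure n Y \<subset> zariski_closure n V)"

definition richardson_variety :: "nat \<Rightarrow> nat set \<Rightarrow> complex mat set \<Rightarrow> bool" where
  "richardson_variety n I V \<longleftrightarrow> orbital_variety n V \<and> zariski_closure n V = \<mm> n I"

definition complete_intersection :: "nat \<Rightarrow> nat set \<Rightarrow> complex mat set \<Rightarrow> bool" where
  "complete_intersection n I W \<longleftrightarrow>
     (\<exists>k g. codim_in (subtopology (zariski n) (\<mm> n I)) (zariski_closure n W) = enat k \<and>
        g ` {..<k} \<subseteq> carrier (coordinate_ring n (\<mm> n I)) \<and>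
        vanishing_ideal n (\<mm> n I) (zariski_closure n W) =
          Idl\<^bsub>coordinate_ring n (\<mm> n I)\<^esub> (g ` {..<k}))"

section \<open>Orbital varieties attached to permutations and tableaux\<close>

text \<open>The pair \<open>(i, j)\<close> encodes the root \<open>\<alpha>\<^sub>i\<^sub>,\<^sub>j = \<epsilon>\<^sub>i - \<epsilon>\<^sub>j\<close>, so \<open>w\<close> sends it to \<open>(w i, w j)\<close>.\<close>

definition pos_roots :: "nat \<Rightarrow> (nat \<times> nat) set" where
  "pos_roots n = {(i, j). 1 \<le> i \<and> i < j \<and> j \<le> n}"

definition steinberg_space :: "nat \<Rightarrow> (nat \<Rightarrow> nat) \<Rightarrow> complex mat set" where
  "steinberg_space n w =
     mat_span n ((\<lambda>(i, j). mat_unit n i j) ` (pos_roots n \<inter> map_prod w w ` pos_roots n))"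

definition perm_variety :: "nat \<Rightarrow> (nat \<Rightarrow> nat) \<Rightarrow> complex mat set \<Rightarrow> bool" where
  "perm_variety n w V \<longleftrightarrow> orbital_variety n V \<and>
     zariski_closure n V = zariski_closure n (conj_set (Borel n) (steinberg_space n w))"

text \<open>Row insertion; \<open>row_insert x r\<close> also returns the entry bumped from the row \<open>r\<close>, if any.\<close>

fun row_insert :: "nat \<Rightarrow> nat list \<Rightarrow> nat list \<times> nat option" where
  "row_insert x [] = ([x], None)"
| "row_insert x (y # ys) =
     (if x < y then (x # ys, Some y)
      else (case row_insert x ys of (zs, b) \<Rightarrow> (y # zs, b)))"

fun tableau_insert :: "nat \<Rightarrow> nat list list \<Rightarrow> nat list list" where
  "tableau_insert x [] = [[x]]"
| "tableau_insert x (r # rs) =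
     (case row_insert x r of
        (r', None) \<Rightarrow> r' # rs
      | (r', Some y) \<Rightarrow> r' # tableau_insert y rs)"

definition insertion_tableau :: "nat \<Rightarrow> (nat \<Rightarrow> nat) \<Rightarrow> nat list list" where
  "insertion_tableau n w = fold tableau_insert (map w [1..<n + 1]) []"

text \<open>The orbital variety of a permutation depends only on its insertion tableau, so it does
  not matter which \<open>w\<close> is taken.\<close>

definition tableau_variety :: "nat \<Rightarrow> nat list list \<Rightarrow> complex mat set \<Rightarrow> bool" where
  "tableau_variety n T V \<longleftrightarrow>
     (\<exists>w. w permutes {1..n} \<and> insertion_tableau n w = T \<and> perm_variety n w V)"

end

theory Submission
  imports Defs
    "Jordan_Normal_Form.Jordan_Normal_Form_Existence"
begin

text \<open>
  Write an element of the nilradical as blocks \<open>a\<close> (3x1), \<open>b\<close> (3x2), \<open>c\<close> (1x2), and let \<open>\<kappa>\<close> span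
  the kernel of \<open>c\<close>. Its square is the rank one matrix \<open>a c\<close>. If \<open>a\<close> and \<open>c\<close> do not vanish, the
  Jordan type is (3,1,1,1) when \<open>a\<close> and \<open>b \<kappa>\<close> are parallel, that is, \<open>b = u c + a v\<close>, and (3,2,1)
  otherwise. These two loci are irreducible because any two of their points are joined by a
  polynomial curve that leaves the locus only finitely often. They are components: close to one
  point of each, the minors vanishing on the orbit force a strictly upper triangular matrix into
  the nilradical.

  The smaller locus carries 9 algebraically independent functions, every step of a chain of
  irreducible closed sets adds another one, and affine 11-space carries at most 11; so the
  codimension is at most 2.

  All matrices of the nilradical with at most two nonzero entries lie in the closure of the
  smaller locus. Hence every function vanishing on it is divisible by \<open>x y z\<close> on each of three
  suitable coordinate 3-spaces, and taking the quotients at 0 sends a combination of generators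
  with function coefficients to the combination with the values of the coefficients at 0. The
  three coordinates of \<open>a \<times> b \<kappa>\<close> are sent to a basis, so two generators do not suffice.
\<close>


section \<open>Zariski closures and polynomial curves\<close>

text \<open>The smaller locus is a determinantal example: it is described by the 2x2 minors of the
  3x2 matrix with columns \<open>a\<close> and \<open>b \<kappa>\<close>, three cubics for a
  condition of codimension two. Its ideal is never computed. It suffices that the minors vanish on
  the locus and that every function vanishing there has no terms of low degree on the test spaces.
  The test space of a pair of rows is spanned by one entry of \<open>a\<close>, one of
  \<open>b\<close> and one of \<open>c\<close>, placed so that the minor of this pair restricts to
  the monomial \<open>x y z\<close> and the other two minors to zero.

  The obstacle is dimension theory: codimension is given by chains of closed sets, and an upper
  bound for their length has to come from elementary counting. Arguments in several variables are
  reduced to polynomials in one variable, either along a curve or one coordinate at a time.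

  The two orbits are recognized by a vanishing cube and a nonzero square of rank one; the rank of
  the matrix then tells them apart. All of this except the nonvanishing of the square passes to
  closures, which is why no orbit fits between them.\<close>

definition polynomial_fun :: "(complex \<Rightarrow> complex) \<Rightarrow> bool" where
  "polynomial_fun f \<longleftrightarrow> (\<exists>p. f = poly p)"

lemma polynomial_fun_const [intro, simp]: "polynomial_fun (\<lambda>t. c)"
  unfolding polynomial_fun_def by (rule exI[of _ "[:c:]"]) auto

lemma polynomial_fun_id [intro, simp]: "polynomial_fun (\<lambda>t. t)"
  unfolding polynomial_fun_def by (rule exI[of _ "[:0, 1:]"]) auto

lemma polynomial_fun_add [intro, simp]:
  "polynomial_fun f \<Longrightarrow> polynomial_fun g \<Longrightarrow> polynomial_fun (\<lambda>t. f t + g t)"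
  unfolding polynomial_fun_def
proof (elim exE)
  fix p q assume "f = poly p" "g = poly q"
  then show "\<exists>r. (\<lambda>t. f t + g t) = poly r" by (intro exI[of _ "p + q"]) auto
qed

lemma polynomial_fun_mult [intro, simp]:
  "polynomial_fun f \<Longrightarrow> polynomial_fun g \<Longrightarrow> polynomial_fun (\<lambda>t. f t * g t)"
  unfolding polynomial_fun_def
proof (elim exE)
  fix p q assume "f = poly p" "g = poly q"
  then show "\<exists>r. (\<lambda>t. f t * g t) = poly r" by (intro exI[of _ "p * q"]) auto
qed

lemma polynomial_fun_diff [intro, simp]:
  "polynomial_fun f \<Longrightarrow> polynomial_fun g \<Longrightarrow> polynomial_fun (\<lambda>t. f t - g t)"
  unfolding polynomial_fun_def
proof (elim exE)
  fix p q assume "f = poly p" "g = poly q"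
  then show "\<exists>r. (\<lambda>t. f t - g t) = poly r" by (intro exI[of _ "p - q"]) auto
qed

lemma polynomial_fun_if [intro, simp]:
  "polynomial_fun f \<Longrightarrow> polynomial_fun g \<Longrightarrow> polynomial_fun (\<lambda>t. if P then f t else g t)"
  by (cases P) simp_all

lemma polynomial_fun_sum [intro, simp]:
  "(\<And>i. i \<in> A \<Longrightarrow> polynomial_fun (f i)) \<Longrightarrow> polynomial_fun (\<lambda>t. \<Sum>i\<in>A. f i t)"
  by (induction A rule: infinite_finite_induct) auto

lemma polynomial_fun_finite_zeros:
  assumes "polynomial_fun f" "f s \<noteq> 0"
  shows "finite {t. f t = 0}"
proof -
  obtain p where p: "f = poly p" using assms(1) unfolding polynomial_fun_def by blast
  then have "p \<noteq> 0" using assms(2) by auto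
  then show ?thesis unfolding p by (rule poly_roots_finite)
qed

text \<open>Over an infinite field the zeros and the non-zeros of a polynomial cannot both be finite
  in number. An equation along a curve with finitely many exceptions therefore has none.\<close>

lemma polynomial_fun_eq_0:
  assumes "polynomial_fun f" "finite {t. f t \<noteq> 0}"
  shows "f s = 0"
proof (rule ccontr)
  assume "f s \<noteq> 0"
  then have "finite {t. f t = 0}" using polynomial_fun_finite_zeros assms(1) by blast
  with assms(2) have "finite ({t. f t = 0} \<union> {t. f t \<noteq> 0})" by blast
  moreover have "{t. f t = 0} \<union> {t. f t \<noteq> 0} = UNIV" by blast
  ultimately show False using infinite_UNIV_char_0[where 'a = complex] by simp
qed

definition poly_curve :: "nat \<Rightarrow> (complex \<Rightarrow> complex mat) \<Rightarrow> bool" where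
  "poly_curve n \<gamma> \<longleftrightarrow> (\<forall>i<n. \<forall>j<n. polynomial_fun (\<lambda>t. \<gamma> t $$ (i, j)))"

lemma polyfuns_poly_curve:
  assumes "f \<in> polyfuns n" "poly_curve n \<gamma>"
  shows "polynomial_fun (\<lambda>t. f (\<gamma> t))"
  using assms by (induction rule: polyfuns.induct) (auto simp: poly_curve_def)

lemma polyfuns_uminus: "f \<in> polyfuns n \<Longrightarrow> (\<lambda>X. - f X) \<in> polyfuns n"
  using polyfuns.mult[OF polyfuns.const[of "-1"], of f n] by simp

lemma polyfuns_diff: "f \<in> polyfuns n \<Longrightarrow> g \<in> polyfuns n \<Longrightarrow> (\<lambda>X. f X - g X) \<in> polyfuns n"
  using polyfuns.add[OF _ polyfuns_uminus, of f n g] by simp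

lemma polyfuns_sum:
  "(\<And>i. i \<in> A \<Longrightarrow> f i \<in> polyfuns n) \<Longrightarrow> (\<lambda>X. \<Sum>i\<in>A. f i X) \<in> polyfuns n"
  by (induction A rule: infinite_finite_induct) (auto intro: polyfuns.intros)

lemma polyfuns_power: "f \<in> polyfuns n \<Longrightarrow> (\<lambda>X. f X ^ k) \<in> polyfuns n"
  by (induction k) (auto intro: polyfuns.intros)

lemmas polyfuns_intros =
  polyfuns.intros polyfuns_uminus polyfuns_diff polyfuns_sum polyfuns_power

section \<open>Closures and irreducibility tested by single polynomials and by curves\<close>

lemma zariski_closure_iff:
  assumes "S \<subseteq> \<ss>\<ll> n"
  shows "X \<in> zariski_closure n S \<longleftrightarrow>
    X \<in> \<ss>\<ll> n \<and> (\<forall>f\<in>polyfuns n. (\<forall>Y\<in>S. f Y = 0) \<longrightarrow> f X = 0)"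
proof
  assume X: "X \<in> zariski_closure n S"
  have "f X = 0" if f: "f \<in> polyfuns n" "\<forall>Y\<in>S. f Y = 0" for f
  proof -
    have "closedin (zariski n) (zero_locus n {f})"
      unfolding closedin_zariski using f by blast
    moreover have "S \<subseteq> zero_locus n {f}" using assms f by (auto simp: zero_locus_def)
    ultimately have "zariski_closure n S \<subseteq> zero_locus n {f}" by (simp add: closure_of_minimal)
    then show ?thesis using X by (auto simp: zero_locus_def)
  qed
  moreover have "X \<in> \<ss>\<ll> n"
    using X closure_of_subset_topspace[of "zariski n" S] by (auto simp: topspace_zariski)
  ultimately show "X \<in> \<ss>\<ll> n \<and> (\<forall>f\<in>polyfuns n. (\<forall>Y\<in>S. f Y = 0) \<longrightarrow> f X = 0)" by blast
next
  assume X: "X \<in> \<ss>\<ll> n \<and> (\<forall>f\<in>polyfuns n. (\<forall>Y\<in>S. f Y = 0) \<longrightarrow> f X = 0)"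
  have "closedin (zariski n) (zariski_closure n S)" by (rule closedin_closure_of)
  then obtain F where F: "F \<subseteq> polyfuns n" "zariski_closure n S = zero_locus n F"
    unfolding closedin_zariski by blast
  have "S \<subseteq> zariski_closure n S" using assms by (simp add: closure_of_subset topspace_zariski)
  then have "f X = 0" if "f \<in> F" for f
  proof -
    have "\<forall>Y\<in>S. f Y = 0" using \<open>S \<subseteq> zariski_closure n S\<close> that unfolding F(2) by (auto simp: zero_locus_def)
    then show ?thesis using X that F(1) by blast
  qed
  then show "X \<in> zariski_closure n S" using X unfolding F(2) by (simp add: zero_locus_def)
qed

lemma closedin_zariski_separate:
  assumes "closedin (zariski n) C" "X \<in> \<ss>\<ll> n" "X \<notin> C"
  obtains f where "f \<in> polyfuns n" "\<forall>Y\<in>C. f Y = 0" "f X \<noteq> 0"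
  using assms unfolding closedin_zariski zero_locus_def by blast

lemma closedin_subset_sl: "closedin (zariski n) C \<Longrightarrow> C \<subseteq> \<ss>\<ll> n"
  using closedin_subset topspace_zariski by metis

text \<open>A polynomial vanishing on \<open>S\<close> pulls back along the curve to a polynomial in
  one variable with only finitely many non-zeros, hence to zero. This is the device by which limit
  points are exhibited.\<close>

lemma zariski_closure_curve:
  assumes "S \<subseteq> \<ss>\<ll> n" "poly_curve n \<gamma>" "finite {t. \<gamma> t \<notin> S}" "\<gamma> s \<in> \<ss>\<ll> n"
  shows "\<gamma> s \<in> zariski_closure n S"
  unfolding zariski_closure_iff[OF assms(1)]
proof (intro conjI ballI impI assms(4))
  fix f assume f: "f \<in> polyfuns n" "\<forall>Y\<in>S. f Y = 0"
  have "{t. f (\<gamma> t) \<noteq> 0} \<subseteq> {t. \<gamma> t \<notin> S}" using f by auto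
  then have "finite {t. f (\<gamma> t) \<noteq> 0}" using assms(3) by (rule finite_subset)
  then show "f (\<gamma> s) = 0"
    by (rule polynomial_fun_eq_0[OF polyfuns_poly_curve[OF f(1) assms(2)]])
qed

text \<open>If \<open>C\<close> misses \<open>X\<close> and \<open>D\<close> misses
  \<open>Y\<close>, then a curve through both points lies in \<open>C\<close>, in \<open>D\<close>
  or outside \<open>S\<close> for finitely many parameters only. A cover of \<open>S\<close> by
  \<open>C\<close> and \<open>D\<close> would make the field finite.\<close>

lemma irreducible_in_curves:
  assumes S: "S \<subseteq> \<ss>\<ll> n" "S \<noteq> {}"
    and curve: "\<And>X Y. X \<in> S \<Longrightarrow> Y \<in> S \<Longrightarrow>
      \<exists>\<gamma>. poly_curve n \<gamma> \<and> \<gamma> 0 = X \<and> \<gamma> 1 = Y \<and> finite {t. \<gamma> t \<notin> S}"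
  shows "irreducible_in (zariski n) S"
  unfolding irreducible_in_def
proof (intro conjI allI impI)
  show "S \<subseteq> topspace (zariski n)" "S \<noteq> {}" using S by (auto simp: topspace_zariski)
  fix C D assume CD: "closedin (zariski n) C \<and> closedin (zariski n) D \<and> S \<subseteq> C \<union> D"
  show "S \<subseteq> C \<or> S \<subseteq> D"
  proof (rule ccontr)
    assume "\<not> ?thesis"
    then obtain X Y where XY: "X \<in> S" "X \<notin> C" "Y \<in> S" "Y \<notin> D" by blast
    obtain f where f: "f \<in> polyfuns n" "\<forall>Y\<in>C. f Y = 0" "f X \<noteq> 0"
      using closedin_zariski_separate[of n C X] CD XY S by blast
    obtain g where g: "g \<in> polyfuns n" "\<forall>Y\<in>D. g Y = 0" "g Y \<noteq> 0"
      using closedin_zariski_separate[of n D Y] CD XY S by blast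
    obtain \<gamma> where \<gamma>: "poly_curve n \<gamma>" "\<gamma> 0 = X" "\<gamma> 1 = Y" "finite {t. \<gamma> t \<notin> S}"
      using curve XY by blast
    have "finite {t. f (\<gamma> t) = 0}"
      using polynomial_fun_finite_zeros[OF polyfuns_poly_curve[OF f(1) \<gamma>(1)], of 0] f \<gamma> by simp
    moreover have "finite {t. g (\<gamma> t) = 0}"
      using polynomial_fun_finite_zeros[OF polyfuns_poly_curve[OF g(1) \<gamma>(1)], of 1] g \<gamma> by simp
    moreover have "UNIV = {t. f (\<gamma> t) = 0} \<union> {t. g (\<gamma> t) = 0} \<union> {t. \<gamma> t \<notin> S}"
      using CD f(2) g(2) by blast
    ultimately have "finite (UNIV :: complex set)" using \<gamma>(4) by (metis finite_UnI)
    then show False by (simp add: infinite_UNIV_char_0)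
  qed
qed

lemma irreducible_in_closure:
  assumes "irreducible_in T S"
  shows "irreducible_in T (Abstract_Topology.closure_of T S)"
  unfolding irreducible_in_def
proof (intro conjI allI impI)
  have S: "S \<subseteq> topspace T" "S \<noteq> {}" using assms by (auto simp: irreducible_in_def)
  then have sub: "S \<subseteq> Abstract_Topology.closure_of T S" by (simp add: closure_of_subset)
  then show "Abstract_Topology.closure_of T S \<noteq> {}" using S by blast
  show "Abstract_Topology.closure_of T S \<subseteq> topspace T" by (rule closure_of_subset_topspace)
  fix C D assume CD: "closedin T C \<and> closedin T D \<and> Abstract_Topology.closure_of T S \<subseteq> C \<union> D"
  then have "S \<subseteq> C \<or> S \<subseteq> D" using assms sub unfolding irreducible_in_def by blast
  then show "Abstract_Topology.closure_of T S \<subseteq> C \<or> Abstract_Topology.closure_of T S \<subseteq> D"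
    using CD closure_of_minimal[of S C T] closure_of_minimal[of S D T] by argo
qed

lemma irreducible_in_mult_eq_0:
  assumes Z: "irreducible_in (zariski n) Z" and f: "f \<in> polyfuns n" and g: "g \<in> polyfuns n"
    and fg: "\<And>X. X \<in> Z \<Longrightarrow> f X * g X = 0" and X: "X \<in> Z" "f X \<noteq> 0" and Y: "Y \<in> Z"
  shows "g Y = 0"
proof -
  have sl: "Z \<subseteq> \<ss>\<ll> n" using Z by (auto simp: irreducible_in_def topspace_zariski)
  have "Z \<subseteq> zero_locus n {f} \<union> zero_locus n {g}" using fg sl by (auto simp: zero_locus_def)
  moreover have "closedin (zariski n) (zero_locus n {f})" "closedin (zariski n) (zero_locus n {g})"
    unfolding closedin_zariski using f g by blast+
  ultimately have "Z \<subseteq> zero_locus n {f} \<or> Z \<subseteq> zero_locus n {g}"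
    using Z unfolding irreducible_in_def by blast
  then show ?thesis using X Y by (auto simp: zero_locus_def)
qed

text \<open>The points of \<open>Z\<close> where \<open>f\<close> does not vanish are dense in
  \<open>Z\<close>, so a closed condition need only be checked there. This serves both the
  maximality of the components and the density of the Borel conjugates.\<close>

lemma irreducible_in_subset_closed:
  assumes Z: "irreducible_in (zariski n) Z" and f: "f \<in> polyfuns n" and C: "closedin (zariski n) C"
    and sub: "\<And>X. X \<in> Z \<Longrightarrow> f X \<noteq> 0 \<Longrightarrow> X \<in> C" and X: "X \<in> Z" "f X \<noteq> 0"
  shows "Z \<subseteq> C"
proof -
  have sl: "Z \<subseteq> \<ss>\<ll> n" using Z by (auto simp: irreducible_in_def topspace_zariski)
  have "Z \<subseteq> zero_locus n {f} \<union> C" using sub sl by (auto simp: zero_locus_def)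
  moreover have "closedin (zariski n) (zero_locus n {f})" unfolding closedin_zariski using f by blast
  ultimately have "Z \<subseteq> zero_locus n {f} \<or> Z \<subseteq> C"
    using Z C unfolding irreducible_in_def by blast
  then show ?thesis using X by (auto simp: zero_locus_def)
qed


section \<open>Algebraic independence and codimension\<close>

text \<open>The value at \<open>xs\<close> of the polynomial of degree at most \<open>D\<close> in each variable whose coefficient
  at the monomial with exponents \<open>e\<close> is \<open>c e\<close>.\<close>

fun mpoly_eval :: "nat \<Rightarrow> (nat list \<Rightarrow> complex) \<Rightarrow> complex list \<Rightarrow> complex" where
  "mpoly_eval D c [] = c []"
| "mpoly_eval D c (x # xs) = (\<Sum>j\<le>D. x ^ j * mpoly_eval D (\<lambda>e. c (j # e)) xs)"

definition exponents :: "nat \<Rightarrow> nat \<Rightarrow> nat list set" where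
  "exponents D m = {e. set e \<subseteq> {..D} \<and> length e = m}"

lemma exponents_0 [simp]: "exponents D 0 = {[]}"
  by (auto simp: exponents_def)

lemma Cons_exponents [simp]: "j # e \<in> exponents D (Suc m) \<longleftrightarrow> j \<le> D \<and> e \<in> exponents D m"
  by (auto simp: exponents_def)

lemma exponents_SucE:
  assumes "e \<in> exponents D (Suc m)"
  obtains j e' where "e = j # e'" "j \<le> D" "e' \<in> exponents D m"
  using assms by (cases e) (auto simp: exponents_def)

lemma finite_exponents: "finite (exponents D m)"
  unfolding exponents_def by (intro finite_lists_length_eq) simp

lemma card_exponents: "card (exponents D m) = Suc D ^ m"
  unfolding exponents_def by (subst card_lists_length_eq) auto

lemma mpoly_eval_eq_0:
  "(\<And>e. e \<in> exponents D (length xs) \<Longrightarrow> c e = 0) \<Longrightarrow> mpoly_eval D c xs = 0"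
  by (induction xs arbitrary: c) simp_all

lemma mpoly_eval_sum:
  "mpoly_eval D (\<lambda>e. \<Sum>a\<in>A. k a * c a e) xs = (\<Sum>a\<in>A. k a * mpoly_eval D (c a) xs)"
proof (induction xs arbitrary: c)
  case (Cons x xs)
  have "mpoly_eval D (\<lambda>e. \<Sum>a\<in>A. k a * c a e) (x # xs)
      = (\<Sum>j\<le>D. \<Sum>a\<in>A. k a * (x ^ j * mpoly_eval D (\<lambda>e. c a (j # e)) xs))"
    by (simp add: Cons sum_distrib_left mult.left_commute)
  also have "\<dots> = (\<Sum>a\<in>A. k a * mpoly_eval D (c a) (x # xs))"
    by (subst sum.swap) (simp add: sum_distrib_left)
  finally show ?case .
qed simp

lemma mpoly_eval_cong:
  "(\<And>e. e \<in> exponents D (length xs) \<Longrightarrow> c e = c' e) \<Longrightarrow> mpoly_eval D c xs = mpoly_eval D c' xs"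
proof (induction xs arbitrary: c c')
  case (Cons x xs)
  have "mpoly_eval D (\<lambda>e. c (j # e)) xs = mpoly_eval D (\<lambda>e. c' (j # e)) xs" if "j \<le> D" for j
    using that by (intro Cons.IH Cons.prems) simp
  then show ?case by simp
qed simp

text \<open>With the other variables fixed, the value is a polynomial in the first variable with
  infinitely many roots. Points with a zero coordinate are left out of the hypothesis so that
  \<open>alg_indep_variety_3111\<close> may divide by coordinates.\<close>

lemma mpoly_eval_unique:
  assumes "\<And>xs. length xs = m \<Longrightarrow> 0 \<notin> set xs \<Longrightarrow> mpoly_eval D c xs = 0"
    and "e \<in> exponents D m"
  shows "c e = 0"
  using assms
proof (induction m arbitrary: c e)
  case (Suc m)
  obtain j e' where e: "e = j # e'" "j \<le> D" "e' \<in> exponents D m"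
    using Suc.prems(2) by (rule exponents_SucE)
  have "mpoly_eval D (\<lambda>e. c (j # e)) xs = 0" if xs: "length xs = m" "0 \<notin> set xs" for xs
  proof -
    define p where "p = (\<Sum>i\<le>D. monom (mpoly_eval D (\<lambda>e. c (i # e)) xs) i)"
    have p: "poly p x = mpoly_eval D c (x # xs)" for x
      by (simp add: p_def poly_sum poly_monom mult.commute)
    have "UNIV - {0} \<subseteq> {x. poly p x = 0}" using Suc.prems(1)[of "_ # xs"] xs by (auto simp: p)
    then have "\<not> finite {x. poly p x = 0}"
      using infinite_UNIV_char_0[where 'a = complex] by (meson finite_Diff2 finite_subset finite.intros)
    then have "p = 0" using poly_roots_finite by blast
    moreover have "coeff p j = mpoly_eval D (\<lambda>e. c (j # e)) xs"
      using e(2) by (simp add: p_def coeff_sum if_distrib cong: if_cong)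
    ultimately show ?thesis by simp
  qed
  then have "c (j # e') = 0" using e(3) by (rule Suc.IH)
  then show ?case using e by simp
qed (use assms in auto)

definition alg_indep_on ::
  "complex mat set \<Rightarrow> (complex mat \<Rightarrow> complex) list \<Rightarrow> bool" where
  "alg_indep_on Z Fs \<longleftrightarrow> (\<forall>D c. (\<forall>X\<in>Z. mpoly_eval D c (map (\<lambda>F. F X) Fs) = 0) \<longrightarrow>
     (\<forall>e\<in>exponents D (length Fs). c e = 0))"

lemma alg_indep_on_mono: "alg_indep_on Z Fs \<Longrightarrow> Z \<subseteq> Z' \<Longrightarrow> alg_indep_on Z' Fs"
  unfolding alg_indep_on_def by blast

lemma polyfuns_mpoly_eval:
  "set Fs \<subseteq> polyfuns n \<Longrightarrow> (\<lambda>X. mpoly_eval D c (map (\<lambda>F. F X) Fs)) \<in> polyfuns n"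
  by (induction Fs arbitrary: c) (auto intro!: polyfuns_intros)

text \<open>A relation between \<open>F\<close> and \<open>Fs\<close> on \<open>Z\<close> may be divided by powers of \<open>F\<close>; its part free of
  \<open>F\<close> is then a relation between \<open>Fs\<close> on \<open>Z'\<close>.\<close>

lemma alg_indep_on_Cons:
  assumes indep: "alg_indep_on Z' Fs" and sub: "Z' \<subseteq> Z" and irr: "irreducible_in (zariski n) Z"
    and F: "F \<in> polyfuns n" "\<And>X. X \<in> Z' \<Longrightarrow> F X = 0" "X0 \<in> Z" "F X0 \<noteq> 0"
    and Fs: "set Fs \<subseteq> polyfuns n"
  shows "alg_indep_on Z (F # Fs)"
  unfolding alg_indep_on_def
proof (intro allI impI ballI)
  fix D c e
  assume rel: "\<forall>X\<in>Z. mpoly_eval D c (map (\<lambda>F. F X) (F # Fs)) = 0"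
    and e: "e \<in> exponents D (length (F # Fs))"
  define E where "E = (\<lambda>j X. mpoly_eval D (\<lambda>e. c (j # e)) (map (\<lambda>F. F X) Fs))"
  have E: "E j \<in> polyfuns n" for j unfolding E_def by (rule polyfuns_mpoly_eval[OF Fs])
  have "\<forall>e\<in>exponents D (length Fs). c (j # e) = 0" if "j \<le> D" for j
    using that
  proof (induction j rule: less_induct)
    case (less j)
    have E0: "E i X = 0" if "i < j" for i X
      unfolding E_def using less.IH[OF that] less.prems that by (intro mpoly_eval_eq_0) auto
    define Q where "Q = (\<lambda>X. \<Sum>i\<in>{j..D}. F X ^ (i - j) * E i X)"
    have Q: "Q \<in> polyfuns n" unfolding Q_def by (intro polyfuns_intros F E)
    have "F X ^ j * Q X = 0" if "X \<in> Z" for X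
    proof -
      have "0 = (\<Sum>i\<le>D. F X ^ i * E i X)" using rel that by (simp add: E_def)
      also have "\<dots> = (\<Sum>i\<in>{j..D}. F X ^ i * E i X)"
        by (rule sum.mono_neutral_right) (auto simp: E0)
      also have "\<dots> = F X ^ j * Q X"
        unfolding Q_def sum_distrib_left
        by (intro sum.cong refl) (auto simp: mult.assoc[symmetric] power_add[symmetric])
      finally show ?thesis by simp
    qed
    moreover have "F X0 ^ j \<noteq> 0" using F(4) by simp
    ultimately have Q0: "Q X = 0" if "X \<in> Z" for X
      using irreducible_in_mult_eq_0[OF irr polyfuns_power[OF F(1)] Q _ F(3) _ that] by blast
    have "E j X = 0" if X: "X \<in> Z'" for X
    proof -
      have "Q X = (\<Sum>i\<in>{j..D}. if i = j then E j X else 0)"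
        unfolding Q_def by (intro sum.cong refl) (use F(2)[OF X] in auto)
      also have "\<dots> = E j X" using less.prems by simp
      finally show ?thesis using Q0 X sub by auto
    qed
    then show ?case using indep unfolding alg_indep_on_def E_def by blast
  qed
  then show "c e = 0" using e by (auto elim: exponents_SucE)
qed

text \<open>At each proper inclusion some polynomial vanishes on the smaller set but not on the
  larger one, and \<open>alg_indep_on_Cons\<close> puts it in front of the family.\<close>

lemma alg_indep_on_chain:
  assumes indep: "alg_indep_on (Z 0) Fs" and Fs: "set Fs \<subseteq> polyfuns n"
    and Z: "\<And>i. i \<le> k \<Longrightarrow> closedin (zariski n) (Z i) \<and> irreducible_in (zariski n) (Z i)"
    and chain: "\<And>i. i < k \<Longrightarrow> Z i \<subset> Z (Suc i)"
  shows "\<exists>Gs. set Gs \<subseteq> polyfuns n \<and> length Gs = k + length Fs \<and> alg_indep_on (Z k) Gs"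
  using Z chain
proof (induction k)
  case 0
  show ?case using indep Fs by auto
next
  case (Suc k)
  obtain Gs where Gs: "set Gs \<subseteq> polyfuns n" "length Gs = k + length Fs" "alg_indep_on (Z k) Gs"
    using Suc by (meson less_Suc_eq le_SucI)
  have sub: "Z k \<subset> Z (Suc k)" using Suc.prems(2) by blast
  then obtain X where X: "X \<in> Z (Suc k)" "X \<notin> Z k" by blast
  have "closedin (zariski n) (Z k)" "Z (Suc k) \<subseteq> \<ss>\<ll> n"
    using Suc.prems(1)[of k] Suc.prems(1)[of "Suc k"] closedin_subset_sl by auto
  then obtain F where F: "F \<in> polyfuns n" "\<forall>Y\<in>Z k. F Y = 0" "F X \<noteq> 0"
    using closedin_zariski_separate[of n "Z k" X] X by blast
  have "alg_indep_on (Z (Suc k)) (F # Gs)"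
    using alg_indep_on_Cons[OF Gs(3) _ _ F(1) _ X(1) F(3) Gs(1)] F(2) sub Suc.prems(1)[of "Suc k"]
    by blast
  then show ?case using Gs F by (intro exI[of _ "F # Gs"]) auto
qed

text \<open>Gaussian elimination, one equation at a time: a nonzero coefficient
  \<open>M a0 b\<close> removes the unknown \<open>a0\<close>, and \<open>N\<close> is the system
  that remains for the other unknowns.\<close>

lemma linear_system_nontrivial_solution:
  fixes M :: "'a \<Rightarrow> 'b \<Rightarrow> 'c :: field"
  assumes "finite B" "finite A" "card B < card A"
  shows "\<exists>c. (\<exists>a\<in>A. c a \<noteq> 0) \<and> (\<forall>b\<in>B. (\<Sum>a\<in>A. c a * M a b) = 0)"
  using assms
proof (induction B arbitrary: A M rule: finite_induct)
  case empty
  then obtain a where "a \<in> A" by fastforce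
  then show ?case by (intro exI[of _ "\<lambda>_. 1"]) auto
next
  case (insert b B)
  show ?case
  proof (cases "\<forall>a\<in>A. M a b = 0")
    case True
    obtain c where "\<exists>a\<in>A. c a \<noteq> 0" "\<forall>b\<in>B. (\<Sum>a\<in>A. c a * M a b) = 0"
      using insert.IH[of A M] insert.prems insert.hyps by auto
    then show ?thesis using True by (intro exI[of _ c]) auto
  next
    case False
    then obtain a0 where a0: "a0 \<in> A" "M a0 b \<noteq> 0" by blast
    define N where "N = (\<lambda>a b'. M a b' - M a b / M a0 b * M a0 b')"
    have "card B < card (A - {a0})" using insert.prems insert.hyps a0 by simp
    then obtain c where c: "\<exists>a\<in>A - {a0}. c a \<noteq> 0"
      "\<forall>b'\<in>B. (\<Sum>a\<in>A - {a0}. c a * N a b') = 0"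
      using insert.IH[of "A - {a0}" N] insert.prems by auto
    \<comment> \<open>Back substitution: the value \<open>- s\<close> of the eliminated unknown is
      forced by equation \<open>b\<close>.\<close>
    define s where "s = (\<Sum>a\<in>A - {a0}. c a * M a b) / M a0 b"
    define d where "d = c(a0 := - s)"
    have d: "(\<Sum>a\<in>A. d a * M a b') = (\<Sum>a\<in>A - {a0}. c a * M a b') - s * M a0 b'" for b'
    proof -
      have "(\<Sum>a\<in>A. d a * M a b') = d a0 * M a0 b' + (\<Sum>a\<in>A - {a0}. d a * M a b')"
        using a0 insert.prems by (simp add: sum.remove)
      also have "(\<Sum>a\<in>A - {a0}. d a * M a b') = (\<Sum>a\<in>A - {a0}. c a * M a b')"
        by (intro sum.cong) (auto simp: d_def)
      finally show ?thesis by (simp add: d_def)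
    qed
    have "(\<Sum>a\<in>A. d a * M a b') = (\<Sum>a\<in>A - {a0}. c a * N a b')" for b'
    proof -
      have "(\<Sum>a\<in>A - {a0}. c a * N a b') = (\<Sum>a\<in>A - {a0}. c a * M a b' - c a * M a b / M a0 b * M a0 b')"
        by (intro sum.cong) (auto simp: N_def algebra_simps)
      also have "\<dots> = (\<Sum>a\<in>A - {a0}. c a * M a b') - s * M a0 b'"
        by (simp add: sum_subtractf s_def sum_divide_distrib sum_distrib_right)
      finally show ?thesis using d by simp
    qed
    then have "\<forall>b'\<in>B. (\<Sum>a\<in>A. d a * M a b') = 0" using c(2) by simp
    moreover have "(\<Sum>a\<in>A. d a * M a b) = 0" using a0 d by (simp add: s_def)
    moreover have "\<exists>a\<in>A. d a \<noteq> 0" using c(1) by (auto simp: d_def)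
    ultimately show ?thesis by blast
  qed
qed

subsection \<open>Functions on affine space of bounded degree in each coordinate\<close>

text \<open>Polynomial in each of the first \<open>n\<close> coordinates separately, with no
  condition on how the coefficients depend on the others. This suffices for a grid argument and
  makes the closure properties immediate.\<close>

definition multidegree_le :: "nat \<Rightarrow> nat \<Rightarrow> ((nat \<Rightarrow> complex) \<Rightarrow> complex) \<Rightarrow> bool" where
  "multidegree_le n N f \<longleftrightarrow> (\<forall>i<n. \<forall>x. \<exists>p. degree p \<le> N \<and> (\<forall>t. f (x(i := t)) = poly p t))"

lemma multidegree_le_mono: "multidegree_le n N f \<Longrightarrow> N \<le> N' \<Longrightarrow> multidegree_le n N' f"
  unfolding multidegree_le_def by (meson le_trans)

lemma multidegree_le_const: "multidegree_le n N (\<lambda>x. c)"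
  unfolding multidegree_le_def by (intro allI impI exI[of _ "[:c:]"]) simp

lemma multidegree_le_coord: "multidegree_le n 1 (\<lambda>x. x k)"
  unfolding multidegree_le_def
proof (intro allI impI)
  fix i and x :: "nat \<Rightarrow> complex"
  show "\<exists>p. degree p \<le> 1 \<and> (\<forall>t. (x(i := t)) k = poly p t)"
    by (rule exI[of _ "if i = k then [:0, 1:] else [:x k:]"]) auto
qed

lemma multidegree_le_add:
  assumes "multidegree_le n N f" "multidegree_le n N g"
  shows "multidegree_le n N (\<lambda>x. f x + g x)"
  unfolding multidegree_le_def
proof (intro allI impI)
  fix i x assume "i < n"
  then obtain p q where "degree p \<le> N" "\<And>t. f (x(i := t)) = poly p t"
    "degree q \<le> N" "\<And>t. g (x(i := t)) = poly q t"
    using assms unfolding multidegree_le_def by meson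
  then show "\<exists>p. degree p \<le> N \<and> (\<forall>t. f (x(i := t)) + g (x(i := t)) = poly p t)"
    by (intro exI[of _ "p + q"]) (simp add: degree_add_le)
qed

lemma multidegree_le_mult:
  assumes "multidegree_le n N f" "multidegree_le n N' g"
  shows "multidegree_le n (N + N') (\<lambda>x. f x * g x)"
  unfolding multidegree_le_def
proof (intro allI impI)
  fix i x assume "i < n"
  then obtain p q where *: "degree p \<le> N" "\<And>t. f (x(i := t)) = poly p t"
    "degree q \<le> N'" "\<And>t. g (x(i := t)) = poly q t"
    using assms unfolding multidegree_le_def by meson
  have "degree (p * q) \<le> N + N'" using degree_mult_le[of p q] * by linarith
  then show "\<exists>p. degree p \<le> N + N' \<and> (\<forall>t. f (x(i := t)) * g (x(i := t)) = poly p t)"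
    using * by (intro exI[of _ "p * q"]) simp
qed

lemma multidegree_le_power:
  "multidegree_le n N f \<Longrightarrow> multidegree_le n (k * N) (\<lambda>x. f x ^ k)"
  by (induction k) (auto intro: multidegree_le_const dest: multidegree_le_mult)

lemma multidegree_le_if:
  "multidegree_le n N f \<Longrightarrow> multidegree_le n N g \<Longrightarrow> multidegree_le n N (\<lambda>x. if P then f x else g x)"
  by (cases P) simp_all

lemma multidegree_le_sum:
  "(\<And>i. i \<in> A \<Longrightarrow> multidegree_le n N (f i)) \<Longrightarrow> multidegree_le n N (\<lambda>x. \<Sum>i\<in>A. f i x)"
  by (induction A rule: infinite_finite_induct)
     (auto intro: multidegree_le_const multidegree_le_add)

text \<open>The coordinates are released from the grid one after another: with all others fixed, a
  polynomial of degree at most \<open>N\<close> has the \<open>N + 1\<close> grid values as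
  roots.\<close>

lemma multidegree_le_eq_0:
  assumes f: "multidegree_le n N f"
    and zero: "\<And>x. (\<forall>i<n. x i \<in> of_nat ` {..N}) \<Longrightarrow> f x = 0"
  shows "f x = 0"
proof -
  have "\<forall>x. (\<forall>i<n. k \<le> i \<longrightarrow> x i \<in> of_nat ` {..N}) \<longrightarrow> f x = 0" if "k \<le> n" for k
    using that
  proof (induction k)
    case 0
    then show ?case using zero by simp
  next
    case (Suc k)
    show ?case
    proof (intro allI impI)
      fix x :: "nat \<Rightarrow> complex" assume x: "\<forall>i<n. Suc k \<le> i \<longrightarrow> x i \<in> of_nat ` {..N}"
      obtain p where p: "degree p \<le> N" "\<And>t. f (x(k := t)) = poly p t"
        using f Suc.prems unfolding multidegree_le_def by (meson Suc_le_lessD)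
      have "poly p t = 0" if "t \<in> of_nat ` {..N}" for t
      proof -
        have "\<forall>i<n. k \<le> i \<longrightarrow> (x(k := t)) i \<in> of_nat ` {..N}" using x that by auto
        then show ?thesis using Suc p(2)[of t] by auto
      qed
      then have sub: "of_nat ` {..N} \<subseteq> {t. poly p t = 0}" by blast
      have "p = 0"
      proof (rule ccontr)
        assume "p \<noteq> 0"
        then have "card (of_nat ` {..N} :: complex set) \<le> degree p"
          using card_mono[OF poly_roots_finite sub] poly_roots_degree[of p] by simp
        moreover have "card (of_nat ` {..N} :: complex set) = Suc N"
          by (subst card_image) (auto simp: inj_on_def)
        ultimately show False using p(1) by simp
      qed
      then show "f x = 0" using p(2)[of "x k"] by simp
    qed
  qed
  from this[of n] show ?thesis by simp
qed

text \<open>A crude bound suffices; what matters for the counting is that it is linear in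
  \<open>D\<close>.\<close>

lemma multidegree_le_mpoly_eval:
  assumes "\<And>F. F \<in> set Fs \<Longrightarrow> multidegree_le n N F"
  shows "multidegree_le n (length Fs * (D * N)) (\<lambda>x. mpoly_eval D c (map (\<lambda>F. F x) Fs))"
  using assms
proof (induction Fs arbitrary: c)
  case (Cons F Fs)
  have "multidegree_le n (j * N + length Fs * (D * N))
      (\<lambda>x. F x ^ j * mpoly_eval D (\<lambda>e. c (j # e)) (map (\<lambda>F. F x) Fs))" for j
    by (intro multidegree_le_mult multidegree_le_power Cons) (use Cons.prems in auto)
  then have "multidegree_le n (length (F # Fs) * (D * N))
      (\<lambda>x. F x ^ j * mpoly_eval D (\<lambda>e. c (j # e)) (map (\<lambda>F. F x) Fs))" if "j \<le> D" for j
    by (rule multidegree_le_mono) (use that in \<open>simp add: mult_right_mono\<close>)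
  then show ?case by (auto intro!: multidegree_le_sum)
qed (simp add: multidegree_le_const)

lemma polyfuns_multidegree:
  assumes "f \<in> polyfuns n"
    and \<phi>: "\<And>i j. i < n \<Longrightarrow> j < n \<Longrightarrow> multidegree_le m 1 (\<lambda>x. \<phi> x $$ (i, j))"
  shows "\<exists>N. multidegree_le m N (\<lambda>x. f (\<phi> x))"
  using assms(1)
proof (induction rule: polyfuns.induct)
  case (add f g)
  then obtain N N' where "multidegree_le m N (\<lambda>x. f (\<phi> x))" "multidegree_le m N' (\<lambda>x. g (\<phi> x))"
    by blast
  then have "multidegree_le m (max N N') (\<lambda>x. f (\<phi> x))" "multidegree_le m (max N N') (\<lambda>x. g (\<phi> x))"
    by (auto elim: multidegree_le_mono)
  then show ?case using multidegree_le_add by blast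
qed (use multidegree_le_const multidegree_le_mult \<phi> in blast)+

text \<open>Counting: polynomials of degree at most \<open>D\<close> in each of \<open>r > m\<close> functions outnumber the
  points of a grid on which a function of the resulting degree in \<open>m\<close> variables is determined.\<close>

lemma alg_indep_on_length_le:
  fixes \<phi> :: "(nat \<Rightarrow> complex) \<Rightarrow> complex mat"
  assumes \<phi>: "\<And>i j. i < n \<Longrightarrow> j < n \<Longrightarrow> multidegree_le m 1 (\<lambda>x. \<phi> x $$ (i, j))"
    and local: "\<And>x y. (\<forall>i<m. x i = y i) \<Longrightarrow> \<phi> x = \<phi> y"
    and Fs: "set Fs \<subseteq> polyfuns n" and indep: "alg_indep_on (range \<phi>) Fs"
  shows "length Fs \<le> m"
proof (rule ccontr)
  assume "\<not> length Fs \<le> m"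
  define r where "r = length Fs"
  have r: "Suc m \<le> r" using \<open>\<not> length Fs \<le> m\<close> by (simp add: r_def)
  have "\<exists>d. \<forall>F\<in>set Fs. multidegree_le m d (\<lambda>x. F (\<phi> x))"
    using Fs
  proof (induction Fs)
    case (Cons F Fs)
    obtain d where d: "\<forall>F\<in>set Fs. multidegree_le m d (\<lambda>x. F (\<phi> x))" using Cons by auto
    obtain d' where d': "multidegree_le m d' (\<lambda>x. F (\<phi> x))"
      using polyfuns_multidegree[of F n m \<phi>] Cons.prems \<phi> by auto
    show ?case
      by (rule exI[of _ "max d d'"]) (use d d' multidegree_le_mono in \<open>fastforce intro: max.cobounded1 max.cobounded2\<close>)
  qed simp
  then obtain d where d: "\<And>F. F \<in> set Fs \<Longrightarrow> multidegree_le m d (\<lambda>x. F (\<phi> x))" by blast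
  \<comment> \<open>The grid has \<open>(N + 1) ^ m\<close> points, at most
    \<open>(r d + 1) ^ m\<close> times \<open>(D + 1) ^ m\<close>. Taking \<open>D\<close> equal to
    the first factor keeps this below \<open>(D + 1) ^ (m + 1)\<close>, hence below the number of
    exponents.\<close>
  define D where "D = (r * d + 1) ^ m"
  define N where "N = r * (D * d)"
  define grid where "grid = PiE {..<m} (\<lambda>_. of_nat ` {..N} :: complex set)"
  have "card (of_nat ` {..N} :: complex set) = Suc N"
    by (subst card_image) (auto simp: inj_on_def)
  then have card_grid: "card grid = Suc N ^ m" unfolding grid_def by (simp add: card_PiE)
  have "Suc N \<le> (r * d + 1) * Suc D" unfolding N_def by (simp add: algebra_simps)
  then have "Suc N ^ m \<le> ((r * d + 1) * Suc D) ^ m" by (rule power_mono) simp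
  also have "\<dots> = D * Suc D ^ m" by (simp only: power_mult_distrib D_def)
  also have "\<dots> < Suc D ^ Suc m" by simp
  also have "\<dots> \<le> Suc D ^ r" using r by (intro power_increasing) auto
  finally have "card grid < card (exponents D r)" by (simp add: card_grid card_exponents)
  \<comment> \<open>The unknowns are the coefficients and the equations are the grid points. The
    value of one monomial is expressed as \<open>mpoly_eval\<close> at an indicator family of
    coefficients.\<close>
  then obtain c where c: "\<exists>e\<in>exponents D r. c e \<noteq> 0"
    "\<forall>x\<in>grid. (\<Sum>e\<in>exponents D r. c e *
       mpoly_eval D (\<lambda>e'. if e' = e then 1 else 0) (map (\<lambda>F. F (\<phi> x)) Fs)) = 0"
    using linear_system_nontrivial_solution[of grid "exponents D r"
        "\<lambda>e x. mpoly_eval D (\<lambda>e'. if e' = e then 1 else 0) (map (\<lambda>F. F (\<phi> x)) Fs)"]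
      finite_exponents by (auto simp: grid_def finite_PiE)
  have eval: "mpoly_eval D c (map (\<lambda>F. F (\<phi> x)) Fs) = 0" if "x \<in> grid" for x
  proof -
    have "mpoly_eval D c (map (\<lambda>F. F (\<phi> x)) Fs) =
        mpoly_eval D (\<lambda>e'. \<Sum>e\<in>exponents D r. c e * (if e' = e then 1 else 0)) (map (\<lambda>F. F (\<phi> x)) Fs)"
      by (rule mpoly_eval_cong) (simp add: finite_exponents r_def if_distrib cong: if_cong)
    then show ?thesis using c(2) that by (simp only: mpoly_eval_sum)
  qed
  define f where "f = (\<lambda>x. mpoly_eval D c (map (\<lambda>F. F (\<phi> x)) Fs))"
  have "multidegree_le m N f"
  proof -
    have "multidegree_le m d F" if "F \<in> set (map (\<lambda>F x. F (\<phi> x)) Fs)" for F using d that by auto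
    from multidegree_le_mpoly_eval[OF this, of "map (\<lambda>F x. F (\<phi> x)) Fs" D c]
    show ?thesis by (simp add: f_def N_def r_def comp_def)
  qed
  moreover have "f x = 0" if x: "\<forall>i<m. x i \<in> of_nat ` {..N}" for x
  proof -
    \<comment> \<open>Members of \<open>grid\<close> are \<open>undefined\<close> from index
      \<open>m\<close> on, and \<open>\<phi>\<close> does not depend on those coordinates.\<close>
    have "restrict x {..<m} \<in> grid" using x by (auto simp: grid_def)
    moreover have "\<phi> x = \<phi> (restrict x {..<m})" by (rule local) simp
    ultimately show ?thesis using eval unfolding f_def by metis
  qed
  ultimately have "f x = 0" for x using multidegree_le_eq_0 by blast
  then have "\<forall>e\<in>exponents D r. c e = 0"
    using indep unfolding alg_indep_on_def r_def f_def by blast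
  then show False using c(1) by blast
qed

subsection \<open>Codimension in a coordinate subspace\<close>

lemma closedin_subtopology_closed:
  "closedin T M \<Longrightarrow> closedin (subtopology T M) S \<longleftrightarrow> closedin T S \<and> S \<subseteq> M"
  by (auto simp: closedin_closed_subtopology)

lemma irreducible_in_subtopology_closed:
  assumes "closedin T M" "S \<subseteq> M"
  shows "irreducible_in (subtopology T M) S \<longleftrightarrow> irreducible_in T S"
proof -
  have top: "topspace (subtopology T M) = M" using assms closedin_subset by fastforce
  have "S \<subseteq> C \<longleftrightarrow> S \<subseteq> M \<inter> C" "closedin T C \<Longrightarrow> closedin T (M \<inter> C)" for C
    using assms by auto
  note * = this
  show ?thesis
    unfolding irreducible_in_def closedin_subtopology_closed[OF assms(1)] top
  proof (intro conj_cong iffI allI impI)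
    show "S \<subseteq> M \<Longrightarrow> S \<subseteq> topspace T" "S \<subseteq> topspace T \<Longrightarrow> S \<subseteq> M"
      using assms closedin_subset by auto
  next
    fix C D
    assume irr: "\<forall>C D. (closedin T C \<and> C \<subseteq> M) \<and> (closedin T D \<and> D \<subseteq> M) \<and> S \<subseteq> C \<union> D \<longrightarrow>
        S \<subseteq> C \<or> S \<subseteq> D"
      and CD: "closedin T C \<and> closedin T D \<and> S \<subseteq> C \<union> D"
    have "S \<subseteq> M \<inter> C \<or> S \<subseteq> M \<inter> D"
      using irr[rule_format, of "M \<inter> C" "M \<inter> D"] CD assms *(2) by blast
    then show "S \<subseteq> C \<or> S \<subseteq> D" by blast
  qed auto
qed

text \<open>The chain \<open>Z\<close> gives the lower bound. Conversely, a chain of length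
  \<open>k'\<close> above \<open>Y\<close> enlarges the \<open>m - k\<close> independent functions
  on \<open>Y\<close> to \<open>m - k + k'\<close> independent functions on
  \<open>range \<phi>\<close>, where at most \<open>m\<close> can exist.\<close>

lemma codim_in_eq:
  fixes \<phi> :: "(nat \<Rightarrow> complex) \<Rightarrow> complex mat"
  assumes \<phi>: "\<And>i j. i < n \<Longrightarrow> j < n \<Longrightarrow> multidegree_le m 1 (\<lambda>x. \<phi> x $$ (i, j))"
    and local: "\<And>x y. (\<forall>i<m. x i = y i) \<Longrightarrow> \<phi> x = \<phi> y"
    and closed: "closedin (zariski n) (range \<phi>)"
    and Fs: "set Fs \<subseteq> polyfuns n" "alg_indep_on Y Fs" "length Fs + k = m"
    and Z: "Z 0 = Y" "\<And>i. i \<le> k \<Longrightarrow> closedin (zariski n) (Z i) \<and> irreducible_in (zariski n) (Z i)"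
      "\<And>i. i < k \<Longrightarrow> Z i \<subset> Z (Suc i)" "\<And>i. i \<le> k \<Longrightarrow> Z i \<subseteq> range \<phi>"
  shows "codim_in (subtopology (zariski n) (range \<phi>)) Y = enat k"
proof -
  let ?T = "subtopology (zariski n) (range \<phi>)"
  let ?K = "{enat k | k. \<exists>Z. Z 0 = Y \<and> (\<forall>i\<le>k. closedin ?T (Z i) \<and> irreducible_in ?T (Z i)) \<and>
    (\<forall>i<k. Z i \<subset> Z (Suc i))}"
  have "(\<forall>i\<le>k. closedin ?T (Z i) \<and> irreducible_in ?T (Z i)) \<and> (\<forall>i<k. Z i \<subset> Z (Suc i))"
    using Z(2-4) closed
    by (simp add: closedin_subtopology_closed irreducible_in_subtopology_closed)
  then have "enat k \<in> ?K" using Z(1) by blast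
  moreover have "l \<le> enat k" if l: "l \<in> ?K" for l
  proof -
    obtain k' Z' where Z': "l = enat k'" "Z' 0 = Y"
      "\<And>i. i \<le> k' \<Longrightarrow> closedin ?T (Z' i) \<and> irreducible_in ?T (Z' i)"
      "\<And>i. i < k' \<Longrightarrow> Z' i \<subset> Z' (Suc i)"
      using l by auto
    have *: "closedin (zariski n) (Z' i) \<and> irreducible_in (zariski n) (Z' i) \<and> Z' i \<subseteq> range \<phi>"
      if "i \<le> k'" for i
      using Z'(3)[OF that] closed
      by (auto simp: closedin_subtopology_closed irreducible_in_subtopology_closed)
    obtain Gs where Gs: "set Gs \<subseteq> polyfuns n" "length Gs = k' + length Fs" "alg_indep_on (Z' k') Gs"
      using alg_indep_on_chain[of Z' Fs n k'] Z' * Fs by auto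
    have "alg_indep_on (range \<phi>) Gs" using Gs(3) *[of k'] by (auto intro: alg_indep_on_mono)
    then have "length Gs \<le> m" using alg_indep_on_length_le[OF \<phi> local Gs(1)] by blast
    then show ?thesis using Gs(2) Fs(3) Z'(1) by simp
  qed
  ultimately show ?thesis unfolding codim_in_def by (intro antisym Sup_least Sup_upper) auto
qed


section \<open>Lie ideals and the nilradical\<close>

lemma mult_mat_entry:
  "A \<in> carrier_mat n n \<Longrightarrow> B \<in> carrier_mat n n \<Longrightarrow> i < n \<Longrightarrow> j < n \<Longrightarrow>
    (A * B) $$ (i, j) = (\<Sum>k<n. A $$ (i, k) * B $$ (k, j))"
  by (auto simp: scalar_prod_def lessThan_atLeast0)

lemma lie_bracket_carrier [simp]:
  "X \<in> carrier_mat n n \<Longrightarrow> Y \<in> carrier_mat n n \<Longrightarrow> lie_bracket X Y \<in> carrier_mat n n"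
  unfolding lie_bracket_def by (metis minus_carrier_mat mult_carrier_mat)

lemma lie_bracket_dim [simp]:
  "dim_row (lie_bracket X Y) = dim_row Y" "dim_col (lie_bracket X Y) = dim_col X"
  by (simp_all add: lie_bracket_def)

lemma lie_bracket_entry:
  "X \<in> carrier_mat n n \<Longrightarrow> Y \<in> carrier_mat n n \<Longrightarrow> i < n \<Longrightarrow> j < n \<Longrightarrow>
    lie_bracket X Y $$ (i, j) = (\<Sum>k<n. X $$ (i, k) * Y $$ (k, j)) - (\<Sum>k<n. Y $$ (i, k) * X $$ (k, j))"
  unfolding lie_bracket_def using mult_mat_entry[of X n Y i j] mult_mat_entry[of Y n X i j] by simp

lemma lie_bracket_entry_eq_0:
  assumes "X \<in> carrier_mat n n" "Y \<in> carrier_mat n n" "i < n" "j < n"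
    and "\<And>k. k < n \<Longrightarrow> X $$ (i, k) * Y $$ (k, j) = 0" "\<And>k. k < n \<Longrightarrow> Y $$ (i, k) * X $$ (k, j) = 0"
  shows "lie_bracket X Y $$ (i, j) = 0"
proof -
  have "(\<Sum>k<n. X $$ (i, k) * Y $$ (k, j)) = 0" by (rule sum.neutral) (use assms in blast)
  moreover have "(\<Sum>k<n. Y $$ (i, k) * X $$ (k, j)) = 0" by (rule sum.neutral) (use assms in blast)
  ultimately show ?thesis using assms by (simp only: lie_bracket_entry diff_0_right)
qed

lemma lie_bracket_antisym:
  assumes "X \<in> carrier_mat n n" "Y \<in> carrier_mat n n"
  shows "lie_bracket X Y = (-1) \<cdot>\<^sub>m lie_bracket Y X"
  by (rule eq_matI) (use assms in \<open>auto simp: lie_bracket_def\<close>)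

lemma lie_bracket_sl:
  assumes X: "X \<in> carrier_mat n n" and Y: "Y \<in> carrier_mat n n"
  shows "lie_bracket X Y \<in> \<ss>\<ll> n"
proof -
  have "(\<Sum>i<n. \<Sum>k<n. X $$ (i, k) * Y $$ (k, i)) = (\<Sum>i<n. \<Sum>k<n. Y $$ (i, k) * X $$ (k, i))"
    by (subst sum.swap) (simp add: mult.commute)
  then show ?thesis
    using assms by (simp add: special_linear_algebra_def lie_bracket_entry sum_subtractf)
qed

lemma mat_unit_carrier [simp]: "mat_unit n i j \<in> carrier_mat n n"
  by (simp add: mat_unit_def)

lemma mat_unit_dim [simp]: "dim_row (mat_unit n i j) = n" "dim_col (mat_unit n i j) = n"
  by (simp_all add: mat_unit_def)

lemma mat_unit_entry [simp]:
  "r < n \<Longrightarrow> c < n \<Longrightarrow> mat_unit n i j $$ (r, c) = (if Suc r = i \<and> Suc c = j then 1 else 0)"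
  by (simp add: mat_unit_def)

lemma mat_unit_sl: "i \<noteq> j \<Longrightarrow> mat_unit n i j \<in> \<ss>\<ll> n"
  by (auto simp: special_linear_algebra_def intro!: sum.neutral)

text \<open>Left multiplication by this unit moves row \<open>j\<close> to row \<open>i\<close>,
  right multiplication moves column \<open>i\<close> to column \<open>j\<close>. Units are numbered
  from 1 and entries from 0, whence the successors.\<close>

lemma lie_bracket_mat_unit_left:
  assumes "Y \<in> carrier_mat n n" "i < n" "j < n" "r < n" "c < n"
  shows "lie_bracket (mat_unit n (Suc i) (Suc j)) Y $$ (r, c) =
    (if r = i then Y $$ (j, c) else 0) - (if c = j then Y $$ (r, i) else 0)"
proof -
  have "(\<Sum>k<n. mat_unit n (Suc i) (Suc j) $$ (r, k) * Y $$ (k, c)) =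
      (\<Sum>k<n. if k = j then (if r = i then Y $$ (j, c) else 0) else 0)"
    by (intro sum.cong) (use assms in auto)
  moreover have "(\<Sum>k<n. Y $$ (r, k) * mat_unit n (Suc i) (Suc j) $$ (k, c)) =
      (\<Sum>k<n. if k = i then (if c = j then Y $$ (r, i) else 0) else 0)"
    by (intro sum.cong) (use assms in auto)
  ultimately show ?thesis using assms by (subst lie_bracket_entry[of _ n]) (simp_all split del: if_split)
qed

lemma lie_bracket_mat_units:
  assumes "i < n" "j < n" "k < n" "i \<noteq> k"
  shows "lie_bracket (mat_unit n (Suc i) (Suc j)) (mat_unit n (Suc j) (Suc k)) = mat_unit n (Suc i) (Suc k)"
  by (rule eq_matI) (use assms in \<open>auto simp: lie_bracket_mat_unit_left\<close>)

section \<open>Ideals and the adjoint action\<close>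

lemma mat_span_superset: "S \<subseteq> mat_span n S"
  unfolding mat_span_def by blast

lemma mat_span_minimal: "mat_subspace n V \<Longrightarrow> S \<subseteq> V \<Longrightarrow> mat_span n S \<subseteq> V"
  unfolding mat_span_def by blast

lemma mat_subspace_eigen:
  assumes "mat_subspace n V" "c \<cdot>\<^sub>m X \<in> V" "c \<noteq> 0" "X \<in> carrier_mat n n"
  shows "X \<in> V"
proof -
  have "inverse c \<cdot>\<^sub>m (c \<cdot>\<^sub>m X) \<in> V" using assms unfolding mat_subspace_def by blast
  moreover have "inverse c \<cdot>\<^sub>m (c \<cdot>\<^sub>m X) = X" by (rule eq_matI) (use assms in auto)
  ultimately show ?thesis by simp
qed

lemma lie_ideal_bracket_left:
  "lie_ideal n J L \<Longrightarrow> L \<subseteq> carrier_mat n n \<Longrightarrow> X \<in> L \<Longrightarrow> Y \<in> J \<Longrightarrow> lie_bracket X Y \<in> J"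
  unfolding lie_ideal_def by blast

lemma lie_ideal_bracket_right:
  assumes "lie_ideal n J L" "L \<subseteq> carrier_mat n n" "X \<in> L" "Y \<in> J"
  shows "lie_bracket Y X \<in> J"
proof -
  have "lie_bracket Y X = (-1) \<cdot>\<^sub>m lie_bracket X Y"
    using assms by (intro lie_bracket_antisym[of _ n]) (auto simp: lie_ideal_def)
  then show ?thesis using assms unfolding lie_ideal_def mat_subspace_def by metis
qed

text \<open>The \<open>k\<close>-th iterated bracket lies in \<open>lower_central n J k\<close>.
  Nilpotency of an ideal is exploited only in this form.\<close>

lemma lie_nilpotent_ad:
  assumes "lie_nilpotent n J" "Y \<in> J" "Z \<in> J"
  shows "\<exists>k. (lie_bracket Y ^^ k) Z = 0\<^sub>m n n"
proof -
  have "(lie_bracket Y ^^ k) Z \<in> lower_central n J k" for k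
  proof (induction k)
    case (Suc k)
    then have "(lie_bracket Y ^^ Suc k) Z \<in> {lie_bracket X Y |X Y. X \<in> J \<and> Y \<in> lower_central n J k}"
      using assms by auto
    then show ?case unfolding lower_central.simps by (rule mat_span_superset[THEN subsetD])
  qed (use assms in simp)
  then show ?thesis using assms(1) unfolding lie_nilpotent_def by (metis singletonD)
qed

text \<open>A nonzero entry at \<open>(i, j)\<close> would bring first \<open>?F\<close>, then
  \<open>[?E, ?F]\<close>, then \<open>?E\<close> into \<open>J\<close>. But \<open>[?E, ?F]\<close>
  acts on \<open>?E\<close> with eigenvalue 2, so \<open>J\<close> would contain a copy of
  sl2.\<close>

lemma nilpotent_ideal_off_diagonal:
  assumes J: "lie_ideal n J L" "lie_nilpotent n J" and L: "L \<subseteq> carrier_mat n n"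
    and Y: "Y \<in> J" and ij: "i < n" "j < n" "i \<noteq> j"
    and E: "mat_unit n (Suc i) (Suc j) \<in> L" "mat_unit n (Suc j) (Suc i) \<in> L"
  shows "Y $$ (i, j) = 0"
proof (rule ccontr)
  let ?E = "mat_unit n (Suc i) (Suc j)" and ?F = "mat_unit n (Suc j) (Suc i)"
  assume y: "Y $$ (i, j) \<noteq> 0"
  have Yc: "Y \<in> carrier_mat n n" using Y J L unfolding lie_ideal_def by blast
  have sub: "mat_subspace n J" using J unfolding lie_ideal_def by blast
  \<comment> \<open>Since \<open>?F\<close> squares to zero, the double bracket is
    \<open>-2 ?F Y ?F\<close>, which isolates the entry \<open>(i, j)\<close> of
    \<open>Y\<close>.\<close>
  have "lie_bracket ?F (lie_bracket ?F Y) = (-2 * Y $$ (i, j)) \<cdot>\<^sub>m ?F"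
  proof (rule eq_matI)
    fix r c assume "r < dim_row ((-2 * Y $$ (i, j)) \<cdot>\<^sub>m ?F)" "c < dim_col ((-2 * Y $$ (i, j)) \<cdot>\<^sub>m ?F)"
    then have rc: "r < n" "c < n" by auto
    show "lie_bracket ?F (lie_bracket ?F Y) $$ (r, c) = ((-2 * Y $$ (i, j)) \<cdot>\<^sub>m ?F) $$ (r, c)"
      using rc ij Yc by (auto simp: lie_bracket_mat_unit_left)
  qed (use Yc in \<open>auto simp: lie_bracket_def\<close>)
  moreover have "lie_bracket ?F (lie_bracket ?F Y) \<in> J"
    using lie_ideal_bracket_left[OF J(1) L] E Y by blast
  ultimately have F: "?F \<in> J" using mat_subspace_eigen[OF sub] y by simp
  have H: "lie_bracket ?E ?F \<in> J" by (rule lie_ideal_bracket_left[OF J(1) L E(1) F])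
  have HE: "lie_bracket (lie_bracket ?E ?F) ?E = 2 \<cdot>\<^sub>m ?E"
  proof (rule eq_matI)
    fix r c assume "r < dim_row (2 \<cdot>\<^sub>m ?E)" "c < dim_col (2 \<cdot>\<^sub>m ?E)"
    then have rc: "r < n" "c < n" by auto
    have "lie_bracket (lie_bracket ?E ?F) ?E = (-1) \<cdot>\<^sub>m lie_bracket ?E (lie_bracket ?E ?F)"
      by (rule lie_bracket_antisym[of _ n]) auto
    then show "lie_bracket (lie_bracket ?E ?F) ?E $$ (r, c) = (2 \<cdot>\<^sub>m ?E) $$ (r, c)"
      using rc ij by (auto simp: lie_bracket_mat_unit_left)
  qed (auto simp: lie_bracket_def)
  have EJ: "?E \<in> J"
  proof -
    have "lie_bracket (lie_bracket ?E ?F) ?E \<in> J"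
      by (rule lie_ideal_bracket_right[OF J(1) L E(1) H])
    then show ?thesis unfolding HE using mat_subspace_eigen[OF sub, of 2 ?E] by simp
  qed
  have scale: "lie_bracket (lie_bracket ?E ?F) (c \<cdot>\<^sub>m ?E) = (2 * c) \<cdot>\<^sub>m ?E" for c
  proof -
    have "lie_bracket (lie_bracket ?E ?F) (c \<cdot>\<^sub>m ?E) = c \<cdot>\<^sub>m lie_bracket (lie_bracket ?E ?F) ?E"
      by (rule eq_matI) (auto simp: lie_bracket_def algebra_simps
          mult_smult_assoc_mat[of _ n n] mult_smult_distrib[of _ n n])
    also have "\<dots> = (2 * c) \<cdot>\<^sub>m ?E" unfolding HE by (rule eq_matI) auto
    finally show ?thesis .
  qed
  have "(lie_bracket (lie_bracket ?E ?F) ^^ k) ?E = (2 ^ k) \<cdot>\<^sub>m ?E" for k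
  proof (induction k)
    case 0
    show ?case by (rule eq_matI) auto
  qed (simp add: scale)
  then obtain k :: nat where "(2 ^ k) \<cdot>\<^sub>m ?E = 0\<^sub>m n n"
    using lie_nilpotent_ad[OF J(2) H EJ] by metis
  then have "((2 ^ k) \<cdot>\<^sub>m ?E) $$ (i, j) = 0\<^sub>m n n $$ (i, j)" by simp
  then show False using ij by simp
qed


subsection \<open>The parabolic subalgebra with blocks of sizes 3, 1, 2\<close>

text \<open>The simple roots \<alpha>1, \<alpha>2 and \<alpha>5 join the indices 1, 2, 3 and the
  indices 5, 6, and leave 4 alone; here indices start at 0.\<close>

definition block :: "nat \<Rightarrow> nat" where
  "block i = (if i < 3 then 0 else if i = 3 then 1 else 2)"

definition block_parabolic :: "complex mat set" where
  "block_parabolic = {X \<in> \<ss>\<ll> 6. \<forall>i<6. \<forall>j<6. block j < block i \<longrightarrow> X $$ (i, j) = 0}"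

definition block_nilradical :: "complex mat set" where
  "block_nilradical = {X \<in> carrier_mat 6 6. \<forall>i<6. \<forall>j<6. block j \<le> block i \<longrightarrow> X $$ (i, j) = 0}"

lemma sl_carrier: "X \<in> \<ss>\<ll> n \<Longrightarrow> X \<in> carrier_mat n n"
  by (simp add: special_linear_algebra_def)

lemma block_parabolic_carrier: "block_parabolic \<subseteq> carrier_mat 6 6"
  by (auto simp: block_parabolic_def special_linear_algebra_def)

lemma block_nilradical_carrier: "block_nilradical \<subseteq> carrier_mat 6 6"
  by (auto simp: block_nilradical_def)

lemma block_nilradical_parabolic: "block_nilradical \<subseteq> block_parabolic"
  by (auto simp: block_parabolic_def block_nilradical_def special_linear_algebra_def intro!: sum.neutral)

lemma block_nilradical_sl: "block_nilradical \<subseteq> \<ss>\<ll> 6"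
  using block_nilradical_parabolic by (auto simp: block_parabolic_def)

lemma mat_subspace_sl: "mat_subspace n (\<ss>\<ll> n)"
  by (auto simp: mat_subspace_def special_linear_algebra_def sum.distrib sum_distrib_left[symmetric])

lemma mat_subspace_block_parabolic: "mat_subspace 6 block_parabolic"
  using mat_subspace_sl[of 6] unfolding mat_subspace_def block_parabolic_def
  by (auto dest!: sl_carrier)

lemma mat_subspace_block_nilradical: "mat_subspace 6 block_nilradical"
  by (auto simp: mat_subspace_def block_nilradical_def)

lemma lie_subalgebra_block_parabolic: "lie_subalgebra 6 block_parabolic"
  unfolding lie_subalgebra_def
proof (intro conjI ballI mat_subspace_block_parabolic)
  fix X Y assume XY: "X \<in> block_parabolic" "Y \<in> block_parabolic"
  then have c: "X \<in> carrier_mat 6 6" "Y \<in> carrier_mat 6 6" using block_parabolic_carrier by auto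
  have prod: "X' $$ (i, k) * Y' $$ (k, j) = 0"
    if "X' \<in> block_parabolic" "Y' \<in> block_parabolic" "i < 6" "j < 6" "k < 6" "block j < block i"
    for X' Y' :: "complex mat" and i j k
    using that unfolding block_parabolic_def by (cases "block k < block i") auto
  then have "lie_bracket X Y $$ (i, j) = 0" if "i < 6" "j < 6" "block j < block i" for i j
    using prod[OF XY] prod[OF XY(2,1)] that by (intro lie_bracket_entry_eq_0[OF c]) blast+
  then show "lie_bracket X Y \<in> block_parabolic"
    using lie_bracket_sl[OF c] by (simp add: block_parabolic_def)
qed

lemma lie_ideal_block_nilradical: "lie_ideal 6 block_nilradical block_parabolic"
  unfolding lie_ideal_def
proof (intro conjI ballI mat_subspace_block_nilradical block_nilradical_parabolic)
  fix X Y assume XY: "X \<in> block_parabolic" "Y \<in> block_nilradical"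
  then have c: "X \<in> carrier_mat 6 6" "Y \<in> carrier_mat 6 6"
    using block_parabolic_carrier block_nilradical_carrier by auto
  have prod: "X $$ (i, k) * Y $$ (k, j) = 0" "Y $$ (i, k) * X $$ (k, j) = 0"
    if "i < 6" "j < 6" "k < 6" "block j \<le> block i" for i j k
  proof -
    show "X $$ (i, k) * Y $$ (k, j) = 0"
      using that XY unfolding block_parabolic_def block_nilradical_def
      by (cases "block k < block i") auto
    show "Y $$ (i, k) * X $$ (k, j) = 0"
      using that XY unfolding block_parabolic_def block_nilradical_def
      by (cases "block k \<le> block i") auto
  qed
  then have "lie_bracket X Y $$ (i, j) = 0" if "i < 6" "j < 6" "block j \<le> block i" for i j
    using that prod by (intro lie_bracket_entry_eq_0[OF c]) blast+
  then show "lie_bracket X Y \<in> block_nilradical"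
    using lie_bracket_carrier[OF c] by (simp add: block_nilradical_def)
qed

lemma less_6_cases:
  assumes "i < (6 :: nat)"
  obtains "i = 0" | "i = 1" | "i = 2" | "i = 3" | "i = 4" | "i = 5"
  using assms by linarith

lemma all_less_6: "(\<forall>i<6::nat. P i) \<longleftrightarrow> P 0 \<and> P 1 \<and> P 2 \<and> P 3 \<and> P 4 \<and> P 5"
  by (auto elim!: less_6_cases)

lemma sum_less_6: "(\<Sum>i<6. f i) = f 0 + f 1 + f 2 + f 3 + f 4 + f (5 :: nat)"
  by (simp add: eval_nat_numeral)

lemma lie_nilpotent_block_nilradical: "lie_nilpotent 6 block_nilradical"
proof -
  \<comment> \<open>With three blocks, \<open>N\<close> consists of the matrices supported in the
    corner of block row 0 and block column 2; a further bracket has nowhere to go.\<close>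
  define N where "N = {X \<in> carrier_mat 6 6. \<forall>i<6. \<forall>j<6. block j < 2 + block i \<longrightarrow> X $$ (i, j) = (0 :: complex)}"
  have N: "X \<in> carrier_mat 6 6" if "X \<in> N" for X using that by (simp add: N_def)
  have prod: "X $$ (i, k) * Y $$ (k, j) = 0"
    if "X \<in> block_nilradical" "Y \<in> block_nilradical" "i < 6" "j < 6" "k < 6"
      "block j < 2 + block i" for X Y i j k
    using that unfolding block_nilradical_def by (cases "block k \<le> block i") auto
  have sub: "mat_subspace 6 N" by (auto simp: mat_subspace_def N_def)
  have "lower_central 6 block_nilradical 1 \<subseteq> N"
    unfolding One_nat_def lower_central.simps
  proof (rule mat_span_minimal[OF sub], safe)
    fix X Y assume XY: "X \<in> block_nilradical" "Y \<in> block_nilradical"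
    then have c: "X \<in> carrier_mat 6 6" "Y \<in> carrier_mat 6 6" using block_nilradical_carrier by auto
    show "lie_bracket X Y \<in> N"
      using prod[OF XY] prod[OF XY(2,1)] c
      by (auto simp: N_def intro!: lie_bracket_entry_eq_0[OF c])
  qed
  moreover have "lie_bracket X Y = 0\<^sub>m 6 6" if XY: "X \<in> block_nilradical" "Y \<in> N" for X Y
  proof -
    have c: "X \<in> carrier_mat 6 6" "Y \<in> carrier_mat 6 6"
      using XY block_nilradical_carrier by (auto simp: N_def)
    have prod0: "X $$ (i, k) * Y $$ (k, j) = 0" "Y $$ (i, k) * X $$ (k, j) = 0"
      if "i < 6" "j < 6" "k < 6" for i j k
    proof -
      have *: "block i \<le> 2" "block j \<le> 2" "block k \<le> 2" by (auto simp: block_def)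
      show "X $$ (i, k) * Y $$ (k, j) = 0"
      proof (cases "block k \<le> block i")
        case True then show ?thesis using that XY by (simp add: block_nilradical_def)
      next
        case False then have "Y $$ (k, j) = 0" using that XY(2) * unfolding N_def by auto
        then show ?thesis by simp
      qed
      show "Y $$ (i, k) * X $$ (k, j) = 0"
      proof (cases "block j \<le> block k")
        case True then show ?thesis using that XY by (simp add: block_nilradical_def)
      next
        case False then have "Y $$ (i, k) = 0" using that XY(2) * unfolding N_def by auto
        then show ?thesis by simp
      qed
    qed
    then show ?thesis
      by (intro eq_matI) (use c prod0 in \<open>auto intro!: lie_bracket_entry_eq_0[OF c]\<close>)
  qed
  ultimately have "{lie_bracket X Y |X Y. X \<in> block_nilradical \<and>
      Y \<in> lower_central 6 block_nilradical 1} \<subseteq> {0\<^sub>m 6 6}" by blast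
  moreover have sub0: "mat_subspace 6 {0\<^sub>m 6 6}" by (auto simp: mat_subspace_def)
  ultimately have "lower_central 6 block_nilradical 2 \<subseteq> {0\<^sub>m 6 6}"
    using mat_span_minimal[OF sub0] by (simp add: numeral_2_eq_2)
  moreover have "0\<^sub>m 6 6 \<in> lower_central 6 block_nilradical 2"
    by (simp add: numeral_2_eq_2 mat_span_def mat_subspace_def)
  ultimately show ?thesis unfolding lie_nilpotent_def by blast
qed


text \<open>Within a block the off-diagonal entries vanish by the sl2 argument, and diagonal entries
  agree because bracketing with a unit turns their difference into an off-diagonal entry.
  Neighbouring blocks carry the same scalar, as otherwise the bracket with \<open>Y\<close> would
  have a nonzero eigenvalue. The trace then makes this scalar zero.\<close>

lemma block_nilpotent_ideal_subset:
  assumes J: "lie_ideal 6 J block_parabolic" "lie_nilpotent 6 J"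
  shows "J \<subseteq> block_nilradical"
proof
  fix Y assume Y: "Y \<in> J"
  have J_sub: "J \<subseteq> block_parabolic" using J unfolding lie_ideal_def by blast
  have E: "mat_unit 6 (Suc i) (Suc j) \<in> block_parabolic" if "block i \<le> block j" "i \<noteq> j" for i j
    using that by (auto simp: block_parabolic_def mat_unit_sl)
  have off: "X $$ (i, j) = 0" if "X \<in> J" "i < 6" "j < 6" "i \<noteq> j" "block i = block j" for X i j
    using that E by (intro nilpotent_ideal_off_diagonal[OF J block_parabolic_carrier]) auto
  have Yc: "Y \<in> carrier_mat 6 6" using Y J_sub block_parabolic_carrier by blast
  have bracket: "lie_bracket (mat_unit 6 (Suc i) (Suc j)) Y \<in> J" if "block i \<le> block j" "i \<noteq> j" for i j
    by (rule lie_ideal_bracket_left[OF J(1) block_parabolic_carrier E[OF that] Y])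
  have diag: "Y $$ (i, i) = Y $$ (j, j)" if "i < 6" "j < 6" "i \<noteq> j" "block i = block j" for i j
    using off[OF bracket[of i j], of i j] that Yc by (simp add: lie_bracket_mat_unit_left)
  \<comment> \<open>The block boundaries come after the rows 2 and 3, counted from 0.\<close>
  have step: "Y $$ (i, i) = Y $$ (Suc i, Suc i)" if i: "i = 2 \<or> i = 3" for i
  proof -
    let ?E = "mat_unit 6 (Suc i) (Suc (Suc i))"
    \<comment> \<open>The unit \<open>?E\<close> is not known to lie in \<open>J\<close>, but its
      bracket with \<open>Y\<close> does, at the cost of one more iteration.\<close>
    have adE: "lie_bracket Y ?E \<in> J"
      using lie_ideal_bracket_right[OF J(1) block_parabolic_carrier E Y, of i "Suc i"] i
      by (auto simp: block_def)
    define c where "c = Y $$ (i, i) - Y $$ (Suc i, Suc i)"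
    have ad: "lie_bracket Y Z \<in> block_nilradical \<and> lie_bracket Y Z $$ (i, Suc i) = c * Z $$ (i, Suc i)"
      if Z: "Z \<in> block_nilradical" for Z
    proof
      show "lie_bracket Y Z \<in> block_nilradical"
        using lie_ideal_bracket_left[OF lie_ideal_block_nilradical block_parabolic_carrier] Z Y J_sub
        by blast
      have c': "Z \<in> carrier_mat 6 6" using Z block_nilradical_carrier by blast
      have Y0: "Y $$ (r, s) = 0" if "r < 6" "s < 6" "r \<noteq> s" "block s \<le> block r" for r s
        using off[OF Y] Y J_sub that unfolding block_parabolic_def by (auto simp: le_less)
      have Z0: "Z $$ (r, s) = 0" if "r < 6" "s < 6" "block s \<le> block r" for r s
        using Z that by (simp add: block_nilradical_def)
      have i6: "i < 6" "Suc i < 6" "block (Suc i) = Suc (block i)" using i by (auto simp: block_def)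
      \<comment> \<open>For \<open>k\<close> different from \<open>i\<close>, either the block of
        \<open>k\<close> is at most that of \<open>i\<close> and the factor from \<open>Y\<close>
        vanishes, or it is at least that of \<open>Suc i\<close> and the factor from
        \<open>Z\<close> does.\<close>
      have "(\<Sum>k<6. Y $$ (i, k) * Z $$ (k, Suc i)) = (\<Sum>k\<in>{i}. Y $$ (i, k) * Z $$ (k, Suc i))"
      proof (rule sum.mono_neutral_right)
        show "\<forall>k\<in>{..<6} - {i}. Y $$ (i, k) * Z $$ (k, Suc i) = 0"
          using Y0[of i] Z0[of _ "Suc i"] i6 by (metis DiffE lessThan_iff mult_eq_0_iff not_less_eq_eq singletonI)
      qed (use i6 in auto)
      moreover have "(\<Sum>k<6. Z $$ (i, k) * Y $$ (k, Suc i)) = (\<Sum>k\<in>{Suc i}. Z $$ (i, k) * Y $$ (k, Suc i))"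
      proof (rule sum.mono_neutral_right)
        show "\<forall>k\<in>{..<6} - {Suc i}. Z $$ (i, k) * Y $$ (k, Suc i) = 0"
          using Y0[of _ "Suc i"] Z0[of i] i6 by (metis DiffE lessThan_iff mult_eq_0_iff not_less_eq_eq singletonI)
      qed (use i6 in auto)
      ultimately show "lie_bracket Y Z $$ (i, Suc i) = c * Z $$ (i, Suc i)"
        using i6 by (simp add: lie_bracket_entry[OF Yc c'] c_def algebra_simps)
    qed
    have EN: "?E \<in> block_nilradical" using i by (auto simp: block_nilradical_def block_def)
    have "(lie_bracket Y ^^ k) ?E \<in> block_nilradical \<and> (lie_bracket Y ^^ k) ?E $$ (i, Suc i) = c ^ k" for k
    proof (induction k)
      case 0 show ?case using EN i by auto
    next
      case (Suc k) then show ?case using ad by simp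
    qed
    note * = this
    obtain k where "(lie_bracket Y ^^ k) (lie_bracket Y ?E) = 0\<^sub>m 6 6"
      using lie_nilpotent_ad[OF J(2) Y adE] by blast
    then have "(lie_bracket Y ^^ Suc k) ?E = 0\<^sub>m 6 6" by (simp only: funpow_Suc_right comp_apply)
    then have "c ^ Suc k = 0" using *[of "Suc k"] i by auto
    then have "c = 0" by (rule power_eq_0_iff[THEN iffD1, THEN conjunct1])
    then show ?thesis by (simp add: c_def)
  qed
  have "Y $$ (0, 0) = Y $$ (2, 2)" "Y $$ (1, 1) = Y $$ (2, 2)" "Y $$ (5, 5) = Y $$ (4, 4)"
    by (rule diag; simp add: block_def)+
  moreover have "Y $$ (2, 2) = Y $$ (3, 3)" "Y $$ (3, 3) = Y $$ (4, 4)"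
    using step[of 2] step[of 3] by simp_all
  moreover have "(\<Sum>i<6. Y $$ (i, i)) = 0"
    using Y J_sub by (auto simp: block_parabolic_def special_linear_algebra_def)
  ultimately have "\<forall>i<6. Y $$ (i, i) = 0" by (simp add: sum_less_6 all_less_6)
  moreover have "Y $$ (i, j) = 0" if "i < 6" "j < 6" "block j < block i" for i j
    using Y J_sub that by (auto simp: block_parabolic_def)
  ultimately show "Y \<in> block_nilradical"
    using off[OF Y] Yc unfolding block_nilradical_def le_less mem_Collect_eq by metis
qed

lemma nilradical_block_parabolic: "nilradical 6 block_parabolic = block_nilradical"
  unfolding nilradical_def
  using block_nilpotent_ideal_subset lie_ideal_block_nilradical lie_nilpotent_block_nilradical
  by blast

text \<open>Below the diagonal the Levi part occupies the positions (2,1), (3,2) and (6,5), whose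
  units are generators, and (3,1), whose unit is the bracket of two of them.\<close>

lemma std_parabolic_eq: "std_parabolic 6 {1, 2, 5} = block_parabolic"
proof
  let ?G = "{X \<in> \<ss>\<ll> 6. upper_triangular X} \<union> {mat_unit 6 (i + 1) i |i. i \<in> {1, 2, 5}}"
  have up: "X \<in> block_parabolic" if "X \<in> \<ss>\<ll> 6" "upper_triangular X" for X
  proof -
    have "j < i" if "block j < block i" for i j using that by (auto simp: block_def split: if_splits)
    then show ?thesis using that sl_carrier[OF that(1)] by (auto simp: block_parabolic_def)
  qed
  have "mat_unit 6 (i + 1) i \<in> block_parabolic" if "i \<in> {1, 2, 5}" for i
    using that by (auto simp: block_parabolic_def mat_unit_sl block_def)
  with up have G: "?G \<subseteq> block_parabolic" by auto
  then show "std_parabolic 6 {1, 2, 5} \<subseteq> block_parabolic"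
    unfolding std_parabolic_def lie_generated_def using lie_subalgebra_block_parabolic by blast
  show "block_parabolic \<subseteq> std_parabolic 6 {1, 2, 5}"
    unfolding std_parabolic_def lie_generated_def
  proof (intro Inter_greatest subsetI)
    fix L X assume L: "L \<in> {L. lie_subalgebra 6 L \<and> ?G \<subseteq> L}" and X: "X \<in> block_parabolic"
    have sub: "mat_subspace 6 L" using L by (simp add: lie_subalgebra_def)
    have unit: "mat_unit 6 (i + 1) i \<in> L" if "i \<in> {1, 2, 5}" for i using L that by blast
    have E: "mat_unit 6 2 1 \<in> L" "mat_unit 6 3 2 \<in> L" "mat_unit 6 6 5 \<in> L"
      using unit[of 1] unit[of 2] unit[of 5] by (simp_all add: numeral_2_eq_2 numeral_3_eq_3)
    have "lie_bracket (mat_unit 6 3 2) (mat_unit 6 2 1) = mat_unit 6 3 1"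
      using lie_bracket_mat_units[of 2 6 1 0] by (simp add: numeral_2_eq_2 numeral_3_eq_3)
    moreover have "\<forall>X\<in>L. \<forall>Y\<in>L. lie_bracket X Y \<in> L" using L by (simp add: lie_subalgebra_def)
    ultimately have E': "mat_unit 6 3 1 \<in> L" using E(1,2) by force
    have Xc: "X \<in> carrier_mat 6 6" using X block_parabolic_carrier by blast
    define U where "U = mat 6 6 (\<lambda>(i, j). if j < i then 0 else X $$ (i, j))"
    have "U \<in> \<ss>\<ll> 6" using X by (simp add: U_def block_parabolic_def special_linear_algebra_def)
    moreover have "upper_triangular U" by (auto simp: U_def)
    ultimately have U: "U \<in> L" using L by blast
    have X0: "\<forall>i<6. \<forall>j<6. block j < block i \<longrightarrow> X $$ (i, j) = 0" using X by (simp add: block_parabolic_def)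
    have "X = U + X $$ (1, 0) \<cdot>\<^sub>m mat_unit 6 2 1 + X $$ (2, 1) \<cdot>\<^sub>m mat_unit 6 3 2
        + X $$ (2, 0) \<cdot>\<^sub>m mat_unit 6 3 1 + X $$ (5, 4) \<cdot>\<^sub>m mat_unit 6 6 5" (is "X = ?S")
    proof (rule eq_matI)
      fix i j assume "i < dim_row ?S" "j < dim_col ?S"
      then have "i < 6" "j < 6" by auto
      then show "X $$ (i, j) = ?S $$ (i, j)"
        using X0 by (elim less_6_cases; simp add: U_def all_less_6 block_def)
    qed (use Xc in auto)
    have add: "A + B \<in> L" if "A \<in> L" "B \<in> L" for A B
      using sub that by (simp add: mat_subspace_def)
    have smult: "c \<cdot>\<^sub>m A \<in> L" if "A \<in> L" for c A
      using sub that by (simp add: mat_subspace_def)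
    have "?S \<in> L" by (intro add smult U E E')
    with \<open>X = ?S\<close> show "X \<in> L" by simp
  qed
qed

lemma parabolic_nilradical_eq: "\<mm> 6 {1, 2, 5} = block_nilradical"
  unfolding parabolic_nilradical_def std_parabolic_eq by (rule nilradical_block_parabolic)


section \<open>Similarity classes of nilpotent matrices\<close>

lemma complex_nth_root:
  assumes "n > 0"
  obtains s :: complex where "s ^ n = c"
proof
  show "rcis (root n (cmod c)) (Arg c / real n) ^ n = c"
    using assms by (simp add: DeMoivre2 rcis_cmod_Arg)
qed

text \<open>Scalars act trivially by conjugation, so the conjugating matrix may be multiplied by an
  \<open>n\<close>-th root of its inverse determinant. Orbits under the special linear group are
  therefore full similarity classes.\<close>

lemma similar_mat_witness_det_1:
  fixes X :: "complex mat"
  assumes "similar_mat Y X" "X \<in> carrier_mat n n" "n > 0"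
  obtains g h where "similar_mat_wit Y X g h" "det g = 1"
proof -
  obtain P Q where wit: "similar_mat_wit Y X P Q" using assms unfolding similar_mat_def by blast
  have Y: "Y \<in> carrier_mat n n"
    using similar_mat_witD2[OF assms(2) similar_mat_wit_sym[OF wit]] by simp
  note w = similar_mat_witD2[OF Y wit]
  have d: "det P * det Q = 1" using det_mult[OF w(6,7)] w(1) by simp
  then have P0: "det P \<noteq> 0" by auto
  obtain s where s: "s ^ n = inverse (det P)" using complex_nth_root[OF assms(3)] by blast
  have s0: "s \<noteq> 0" using s P0 assms(3) by (auto simp: power_0_left)
  have "similar_mat_wit Y X (s \<cdot>\<^sub>m P) (inverse s \<cdot>\<^sub>m Q)"
  proof (rule similar_mat_witI[of _ _ n])
    show "(s \<cdot>\<^sub>m P) * (inverse s \<cdot>\<^sub>m Q) = 1\<^sub>m n" "(inverse s \<cdot>\<^sub>m Q) * (s \<cdot>\<^sub>m P) = 1\<^sub>m n"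
      using w s0 by (auto simp: mult_smult_assoc_mat[of _ n n] mult_smult_distrib[of _ n n])
    show "Y = s \<cdot>\<^sub>m P * X * (inverse s \<cdot>\<^sub>m Q)"
      using w s0 by (auto simp: mult_smult_assoc_mat[of _ n n] mult_smult_distrib[of _ n n])
  qed (use w in auto)
  moreover have "det (s \<cdot>\<^sub>m P) = 1" using w(6) s P0 by simp
  ultimately show ?thesis using that by blast
qed

lemma conj_set_SL_singleton:
  assumes "X \<in> carrier_mat n n" "n > 0"
  shows "conj_set (SL_group n) {X} = {Y. similar_mat Y X}"
proof (intro equalityI subsetI)
  fix Y assume "Y \<in> {Y. similar_mat Y X}"
  then obtain g h where gh: "similar_mat_wit Y X g h" "det g = 1"
    using similar_mat_witness_det_1[OF _ assms] by blast
  have "g \<in> carrier_mat n n"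
    using similar_mat_witD2(7)[OF assms(1) similar_mat_wit_sym[OF gh(1)]] .
  then show "Y \<in> conj_set (SL_group n) {X}"
    using gh assms by (auto simp: conj_set_def SL_group_def)
qed (auto simp: conj_set_def similar_mat_def)

lemma nilpotent_orbit_iff:
  assumes "n > 0"
  shows "nilpotent_orbit n O' \<longleftrightarrow> (\<exists>X\<in>\<ss>\<ll> n. (\<exists>k. X ^\<^sub>m k = 0\<^sub>m n n) \<and> O' = {Y. similar_mat Y X})"
  unfolding nilpotent_orbit_def using conj_set_SL_singleton[OF sl_carrier assms] by auto

lemma nilpotent_orbit_eq:
  assumes "n > 0" "nilpotent_orbit n O'" "Y \<in> O'"
  shows "O' = {Z. similar_mat Z Y}"
proof -
  obtain X where "O' = {Y. similar_mat Y X}" using assms by (auto simp: nilpotent_orbit_iff)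
  then show ?thesis using assms(3) similar_mat_trans similar_mat_sym by blast
qed

subsection \<open>Factorizations through a smaller dimension\<close>

text \<open>A factorization through dimension \<open>k\<close> is visibly stable under similarity
  and gives the vanishing of minors by expansion.\<close>

definition rank_le :: "nat \<Rightarrow> nat \<Rightarrow> complex mat \<Rightarrow> bool" where
  "rank_le n k X \<longleftrightarrow> (\<exists>P Q. P \<in> carrier_mat n k \<and> Q \<in> carrier_mat k n \<and> X = P * Q)"

lemma rank_le_similar:
  assumes "rank_le n k X" "similar_mat Y X"
  shows "rank_le n k Y"
proof -
  obtain P Q where PQ: "P \<in> carrier_mat n k" "Q \<in> carrier_mat k n" "X = P * Q"
    using assms unfolding rank_le_def by blast
  then have X: "X \<in> carrier_mat n n" by simp
  obtain g h where wit: "similar_mat_wit Y X g h" using assms unfolding similar_mat_def by blast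
  note w = similar_mat_witD2[OF X similar_mat_wit_sym[OF wit]]
  have Y: "Y = g * X * h" using similar_mat_witD2[OF w(5) wit] by simp
  have "Y = (g * P) * (Q * h)"
    unfolding Y PQ(3) using PQ w(6,7)
    by (simp add: assoc_mult_mat[of _ n n _ k _ n] assoc_mult_mat[of _ n k _ n _ n] assoc_mult_mat[of _ n n _ n _ n])
  moreover have "g * P \<in> carrier_mat n k" "Q * h \<in> carrier_mat k n" using PQ w(6,7) by auto
  ultimately show ?thesis unfolding rank_le_def by blast
qed

lemma rank_le_entries:
  assumes "X \<in> carrier_mat n n"
  shows "rank_le n k X \<longleftrightarrow> (\<exists>p q. \<forall>i<n. \<forall>j<n. X $$ (i, j) = (\<Sum>l<k. p i l * q l j))"
proof
  assume "rank_le n k X"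
  then obtain P Q where PQ: "P \<in> carrier_mat n k" "Q \<in> carrier_mat k n" "X = P * Q"
    unfolding rank_le_def by blast
  show "\<exists>p q. \<forall>i<n. \<forall>j<n. X $$ (i, j) = (\<Sum>l<k. p i l * q l j)"
    by (rule exI[of _ "\<lambda>i l. P $$ (i, l)"], rule exI[of _ "\<lambda>l j. Q $$ (l, j)"])
       (use PQ in \<open>auto simp: scalar_prod_def lessThan_atLeast0\<close>)
next
  assume "\<exists>p q. \<forall>i<n. \<forall>j<n. X $$ (i, j) = (\<Sum>l<k. p i l * q l j)"
  then obtain p q where pq: "\<And>i j. i < n \<Longrightarrow> j < n \<Longrightarrow> X $$ (i, j) = (\<Sum>l<k. p i l * q l j)" by blast
  have "X = mat n k (\<lambda>(i, l). p i l) * mat k n (\<lambda>(l, j). q l j)"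
    by (rule eq_matI) (use assms pq in \<open>auto simp: scalar_prod_def lessThan_atLeast0\<close>)
  moreover have "mat n k (\<lambda>(i, l). p i l) \<in> carrier_mat n k" "mat k n (\<lambda>(l, j). q l j) \<in> carrier_mat k n"
    by simp_all
  ultimately show "rank_le n k X" unfolding rank_le_def by blast
qed

lemma rank_le_1_minor:
  assumes "rank_le n 1 X" "X \<in> carrier_mat n n" "i < n" "j < n" "k < n" "l < n"
  shows "X $$ (i, j) * X $$ (k, l) = X $$ (i, l) * X $$ (k, j)"
proof -
  obtain p q where "\<forall>i<n. \<forall>j<n. X $$ (i, j) = (\<Sum>l<1::nat. p i l * q l j)"
    using assms(1) rank_le_entries[OF assms(2)] by blast
  then show ?thesis using assms by (simp add: algebra_simps)
qed

text \<open>The determinant of the submatrix with rows \<open>i\<close>, \<open>j\<close>,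
  \<open>k\<close> and columns \<open>r\<close>, \<open>s\<close>, \<open>t\<close>, expanded along
  row \<open>i\<close>.\<close>

definition minor3 :: "complex mat \<Rightarrow> nat \<Rightarrow> nat \<Rightarrow> nat \<Rightarrow> nat \<Rightarrow> nat \<Rightarrow> nat \<Rightarrow> complex" where
  "minor3 X i j k r s t =
     X $$ (i, r) * (X $$ (j, s) * X $$ (k, t) - X $$ (j, t) * X $$ (k, s))
   - X $$ (i, s) * (X $$ (j, r) * X $$ (k, t) - X $$ (j, t) * X $$ (k, r))
   + X $$ (i, t) * (X $$ (j, r) * X $$ (k, s) - X $$ (j, s) * X $$ (k, r))"

lemma rank_le_2_minor3:
  assumes "rank_le n 2 X" "X \<in> carrier_mat n n" "i < n" "j < n" "k < n" "r < n" "s < n" "t < n"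
  shows "minor3 X i j k r s t = 0"
proof -
  obtain p q where "\<forall>i<n. \<forall>j<n. X $$ (i, j) = (\<Sum>l<2::nat. p i l * q l j)"
    using assms(1) rank_le_entries[OF assms(2)] by blast
  then have "X $$ (a, b) = p a 0 * q 0 b + p a 1 * q 1 b" if "a < n" "b < n" for a b
    using that by (simp add: numeral_2_eq_2)
  then show ?thesis unfolding minor3_def using assms(3-) by (simp add: algebra_simps)
qed

text \<open>Through a nonzero entry at \<open>(k, l)\<close> every row is a multiple of row
  \<open>k\<close>, with coefficients read off column \<open>l\<close>.\<close>

lemma rank_le_1_if_minors:
  assumes X: "X \<in> carrier_mat n n"
    and minors: "\<And>i j k l. i < n \<Longrightarrow> j < n \<Longrightarrow> k < n \<Longrightarrow> l < n \<Longrightarrow>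
      X $$ (i, j) * X $$ (k, l) = X $$ (i, l) * X $$ (k, j)"
  shows "rank_le n 1 X"
proof (cases "\<exists>i<n. \<exists>j<n. X $$ (i, j) \<noteq> 0")
  case True
  then obtain k l where kl: "k < n" "l < n" "X $$ (k, l) \<noteq> 0" by blast
  show ?thesis unfolding rank_le_entries[OF X]
    by (rule exI[of _ "\<lambda>i _. X $$ (i, l) / X $$ (k, l)"], rule exI[of _ "\<lambda>_ j. X $$ (k, j)"])
       (use kl minors[of _ _ k l] in \<open>auto simp: field_simps\<close>)
next
  case False
  then show ?thesis unfolding rank_le_entries[OF X] by (intro exI[of _ "\<lambda>_ _. 0"]) auto
qed

lemma mat_pow_2: "X \<in> carrier_mat n n \<Longrightarrow> X ^\<^sub>m 2 = X * X"
  by (simp add: numeral_2_eq_2)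

lemma mat_pow_3: "X \<in> carrier_mat n n \<Longrightarrow> X ^\<^sub>m 3 = X * X * X"
  by (simp add: numeral_3_eq_3)

lemma similar_mat_pow: "similar_mat A B \<Longrightarrow> similar_mat (A ^\<^sub>m k) (B ^\<^sub>m k)"
  unfolding similar_mat_def using similar_mat_wit_pow by blast

lemma similar_mat_0:
  fixes Y :: "'a :: semiring_1 mat"
  assumes "similar_mat Y (0\<^sub>m n n)"
  shows "Y = 0\<^sub>m n n"
proof -
  obtain g h where wit: "similar_mat_wit Y (0\<^sub>m n n) g h" using assms unfolding similar_mat_def by blast
  note w = similar_mat_witD2[OF zero_carrier_mat similar_mat_wit_sym[OF wit]]
  show ?thesis using similar_mat_witD2(3)[OF w(5) wit] w(6,7) by simp
qed

lemma similar_mat_eq_0_iff: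
  fixes Y :: "'a :: semiring_1 mat"
  assumes "similar_mat Y X" "Y \<in> carrier_mat n n"
  shows "Y = 0\<^sub>m n n \<longleftrightarrow> X = 0\<^sub>m n n"
  using assms similar_mat_0 similar_mat_sym by blast

subsection \<open>Jordan matrices\<close>

lemma similar_mat_swap_diag_blocks:
  fixes A B :: "'a :: comm_ring_1 mat"
  assumes A: "A \<in> carrier_mat n n" and B: "B \<in> carrier_mat m m"
  shows "similar_mat (diag_block_mat [A, B]) (diag_block_mat [B, A])"
proof -
  let ?P = "four_block_mat (0\<^sub>m n m) (1\<^sub>m n) (1\<^sub>m m) (0\<^sub>m m n) :: 'a mat"
  let ?Q = "four_block_mat (0\<^sub>m m n) (1\<^sub>m m) (1\<^sub>m n) (0\<^sub>m n m) :: 'a mat"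
  let ?AB = "four_block_mat A (0\<^sub>m n m) (0\<^sub>m m n) B"
  let ?BA = "four_block_mat B (0\<^sub>m m n) (0\<^sub>m n m) A"
  have P: "?P \<in> carrier_mat (n + m) (n + m)"
    using four_block_carrier_mat[of "0\<^sub>m n m :: 'a mat" n m "0\<^sub>m m n" m n] by (simp add: add.commute)
  have Q: "?Q \<in> carrier_mat (n + m) (n + m)"
    using four_block_carrier_mat[of "0\<^sub>m m n :: 'a mat" m n "0\<^sub>m n m" n m] by (simp add: add.commute)
  have AB: "?AB \<in> carrier_mat (n + m) (n + m)" using A B by auto
  have BA: "?BA \<in> carrier_mat (n + m) (n + m)"
    using four_block_carrier_mat[OF B A] by (simp add: add.commute)
  have "?P * ?Q = four_block_mat (1\<^sub>m n) (0\<^sub>m n m) (0\<^sub>m m n) (1\<^sub>m m)"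
    by (subst mult_four_block_mat[of _ n m _ n _ m _ _ n _ m]) auto
  then have PQ: "?P * ?Q = 1\<^sub>m (n + m)" by simp
  have "?Q * ?P = four_block_mat (1\<^sub>m m) (0\<^sub>m m n) (0\<^sub>m n m) (1\<^sub>m n)"
    by (subst mult_four_block_mat[of _ m n _ m _ n _ _ m _ n]) auto
  then have QP: "?Q * ?P = 1\<^sub>m (n + m)" by (simp add: add.commute)
  have "?P * ?BA = four_block_mat (0\<^sub>m n m) A B (0\<^sub>m m n)"
    using A B by (subst mult_four_block_mat[of _ n m _ n _ m _ _ m _ n]) auto
  then have "?P * ?BA * ?Q = ?AB"
    using A B by (simp only:) (subst mult_four_block_mat[of _ n m _ n _ m _ _ n _ m]; auto)
  then have "similar_mat_wit ?AB ?BA ?P ?Q"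
    using P Q AB BA PQ QP by (intro similar_mat_witI[of _ _ "n + m"]) auto
  moreover have "diag_block_mat [A, B] = ?AB" "diag_block_mat [B, A] = ?BA"
    using A B by (simp_all add: Let_def)
      (rule eq_matI; auto)+
  ultimately show ?thesis unfolding similar_mat_def by auto
qed

lemma similar_mat_jordan_matrix_append:
  fixes xs :: "(nat \<times> 'a :: comm_ring_1) list"
  assumes "similar_mat (jordan_matrix xs) (jordan_matrix xs')" "similar_mat (jordan_matrix ys) (jordan_matrix ys')"
  shows "similar_mat (jordan_matrix (xs @ ys)) (jordan_matrix (xs' @ ys'))"
  using similar_diag_mat_block_mat[of "[(jordan_matrix xs, jordan_matrix xs'), (jordan_matrix ys, jordan_matrix ys')]"]
    assms jordan_matrix_concat_diag_block_mat[of "[xs, ys]"] jordan_matrix_concat_diag_block_mat[of "[xs', ys']"]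
  by auto

text \<open>A block can be brought to the front by swapping it past all blocks before it at once, so
  the order of Jordan blocks is irrelevant.\<close>

lemma similar_mat_jordan_matrix_mset:
  fixes xs :: "(nat \<times> 'a :: comm_ring_1) list"
  assumes "mset xs = mset ys"
  shows "similar_mat (jordan_matrix xs) (jordan_matrix ys)"
  using assms
proof (induction xs arbitrary: ys)
  case Nil
  then show ?case by (auto intro: similar_mat_refl[OF jordan_matrix_carrier])
next
  case (Cons x xs)
  then obtain us vs where ys: "ys = us @ x # vs"
    by (metis list.set_intros(1) set_mset_mset split_list)
  have "similar_mat (jordan_matrix xs) (jordan_matrix (us @ vs))"
    by (rule Cons.IH) (use Cons.prems ys in simp)
  then have 1: "similar_mat (jordan_matrix ([x] @ xs)) (jordan_matrix ([x] @ us @ vs))"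
    by (intro similar_mat_jordan_matrix_append similar_mat_refl[OF jordan_matrix_carrier])
  have "similar_mat (jordan_matrix ([x] @ us)) (jordan_matrix (us @ [x]))"
    using similar_mat_swap_diag_blocks[OF jordan_matrix_carrier jordan_matrix_carrier, of "[x]" us]
      jordan_matrix_concat_diag_block_mat[of "[[x], us]"] jordan_matrix_concat_diag_block_mat[of "[us, [x]]"]
    by (simp only: concat.simps append_Nil2 list.map)
  then have "similar_mat (jordan_matrix (([x] @ us) @ vs)) (jordan_matrix ((us @ [x]) @ vs))"
    by (rule similar_mat_jordan_matrix_append[OF _ similar_mat_refl[OF jordan_matrix_carrier]])
  then show ?case using 1 similar_mat_trans unfolding ys by fastforce
qed

lemma diag_block_mat_eq_0_iff:
  assumes "\<forall>A\<in>set As. dim_row A = dim_col A"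
  shows "diag_block_mat As = 0\<^sub>m (sum_list (map dim_row As)) (sum_list (map dim_col As)) \<longleftrightarrow>
    (\<forall>A\<in>set As. A = 0\<^sub>m (dim_row A) (dim_col A))"
  using assms
proof (induction As)
  case (Cons A As)
  let ?B = "diag_block_mat As"
  define n where "n = dim_row A"
  define m where "m = sum_list (map dim_row As)"
  have A: "A \<in> carrier_mat n n" using Cons.prems by (auto simp: n_def)
  have m: "sum_list (map dim_col As) = m" unfolding m_def
    using Cons.prems by (metis (mono_tags, lifting) list.set_intros(2) map_eq_conv)
  have B: "?B \<in> carrier_mat m m" 
    by (rule carrier_matI) (simp_all add: dim_diag_block_mat m m_def[symmetric])
  have "diag_block_mat (A # As) = four_block_mat A (0\<^sub>m n m) (0\<^sub>m m n) ?B"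
    using A B by (simp add: Let_def)
  moreover have "four_block_mat A (0\<^sub>m n m) (0\<^sub>m m n) ?B = 0\<^sub>m (n + m) (n + m) \<longleftrightarrow> A = 0\<^sub>m n n \<and> ?B = 0\<^sub>m m m"
  proof
    assume *: "four_block_mat A (0\<^sub>m n m) (0\<^sub>m m n) ?B = 0\<^sub>m (n + m) (n + m)"
    have "A $$ (i, j) = 0" if "i < n" "j < n" for i j
      using arg_cong[OF *, of "\<lambda>M. M $$ (i, j)"] that A B by simp
    moreover have "?B $$ (i, j) = 0" if "i < m" "j < m" for i j
      using arg_cong[OF *, of "\<lambda>M. M $$ (n + i, n + j)"] that A B by simp
    ultimately show "A = 0\<^sub>m n n \<and> ?B = 0\<^sub>m m m" using A B by (auto intro!: eq_matI)
  next
    assume "A = 0\<^sub>m n n \<and> ?B = 0\<^sub>m m m"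
    then show "four_block_mat A (0\<^sub>m n m) (0\<^sub>m m n) ?B = 0\<^sub>m (n + m) (n + m)"
      by (auto intro!: eq_matI)
  qed
  moreover have "?B = 0\<^sub>m m m \<longleftrightarrow> (\<forall>A\<in>set As. A = 0\<^sub>m (dim_row A) (dim_col A))"
    using Cons m by (simp add: m_def)
  moreover have "sum_list (map dim_row (A # As)) = n + m" "sum_list (map dim_col (A # As)) = n + m"
    using A m by (auto simp: m_def)
  ultimately show ?case using A by auto
qed simp

text \<open>Entry \<open>(0, 0)\<close> of the power is \<open>a ^ k\<close>; once
  \<open>a = 0\<close>, entry \<open>(0, k)\<close> is 1 as long as \<open>k < n\<close>.\<close>

lemma jordan_block_pow_eq_0_iff:
  fixes a :: complex
  assumes "n > 0" "k > 0"
  shows "jordan_block n a ^\<^sub>m k = 0\<^sub>m n n \<longleftrightarrow> a = 0 \<and> n \<le> k"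
proof
  assume *: "jordan_block n a ^\<^sub>m k = 0\<^sub>m n n"
  have "a ^ k = 0" using arg_cong[OF *, of "\<lambda>M. M $$ (0, 0)"] assms by (simp add: jordan_block_pow)
  then have a: "a = 0" using assms by simp
  moreover have "n \<le> k"
  proof (rule ccontr)
    assume "\<not> n \<le> k"
    then show False using arg_cong[OF *, of "\<lambda>M. M $$ (0, k)"] by (simp add: jordan_block_pow)
  qed
  ultimately show "a = 0 \<and> n \<le> k" by blast
next
  assume "a = 0 \<and> n \<le> k"
  then show "jordan_block n a ^\<^sub>m k = 0\<^sub>m n n"
    by (auto simp: jordan_block_pow intro!: eq_matI)
qed

lemma jordan_matrix_pow_eq_0_iff:
  fixes xs :: "(nat \<times> complex) list"
  assumes "k > 0" "0 \<notin> fst ` set xs"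
  shows "jordan_matrix xs ^\<^sub>m k = 0\<^sub>m (sum_list (map fst xs)) (sum_list (map fst xs)) \<longleftrightarrow>
    (\<forall>(n, a)\<in>set xs. a = 0 \<and> n \<le> k)"
proof -
  let ?As = "map (\<lambda>(n, a). jordan_block n a ^\<^sub>m k) xs"
  have dims: "sum_list (map dim_row ?As) = sum_list (map fst xs)" "sum_list (map dim_col ?As) = sum_list (map fst xs)"
    by (auto intro!: arg_cong[of _ _ sum_list])
  have "jordan_matrix xs ^\<^sub>m k = 0\<^sub>m (sum_list (map fst xs)) (sum_list (map fst xs)) \<longleftrightarrow>
      (\<forall>A\<in>set ?As. A = 0\<^sub>m (dim_row A) (dim_col A))"
  proof -
    have "\<forall>A\<in>set ?As. dim_row A = dim_col A" by (auto simp: jordan_block_pow_dim)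
    from diag_block_mat_eq_0_iff[OF this] show ?thesis unfolding jordan_matrix_pow dims .
  qed
  also have "\<dots> \<longleftrightarrow> (\<forall>(n, a)\<in>set xs. a = 0 \<and> n \<le> k)"
  proof -
    have "n > 0" if "(n, a) \<in> set xs" for n a
      using assms(2) that by (metis fst_conv gr0I image_eqI)
    then have "jordan_block n a ^\<^sub>m k = 0\<^sub>m n n \<longleftrightarrow> a = 0 \<and> n \<le> k" if "(n, a) \<in> set xs" for n a
      using that jordan_block_pow_eq_0_iff[OF _ assms(1)] by blast
    then show ?thesis using assms(1) by (simp add: split_beta jordan_block_pow_dim del: pow_mat.simps)
  qed
  finally show ?thesis .
qed

lemma mset_replicate3:
  "set xs \<subseteq> {a, b, c} \<Longrightarrow> \<exists>k l m. mset xs = mset (replicate k a @ replicate l b @ replicate m c)"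
proof (induction xs)
  case Nil
  show ?case by (rule exI[of _ 0])+ simp
next
  case (Cons x xs)
  then obtain k l m where *: "mset xs = mset (replicate k a @ replicate l b @ replicate m c)" by auto
  consider "x = a" | "x = b" | "x = c" using Cons by auto
  then show ?case
  proof cases
    case 1 then show ?thesis using * by (intro exI[of _ "Suc k"] exI[of _ l] exI[of _ m]) simp
  next
    case 2 then show ?thesis using * by (intro exI[of _ k] exI[of _ "Suc l"] exI[of _ m]) simp
  next
    case 3 then show ?thesis using * by (intro exI[of _ k] exI[of _ l] exI[of _ "Suc m"]) simp
  qed
qed

text \<open>Exactly one Jordan block of size 3 and none larger. In size 6 this leaves the types
  (3,2,1) and (3,1,1,1).\<close>

definition cube_zero :: "complex mat \<Rightarrow> bool" where
  "cube_zero X \<longleftrightarrow> X \<in> carrier_mat 6 6 \<and> X ^\<^sub>m 3 = 0\<^sub>m 6 6 \<and> X ^\<^sub>m 2 \<noteq> 0\<^sub>m 6 6 \<and> rank_le 6 1 (X ^\<^sub>m 2)"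

text \<open>Blocks have size at most 3, so the multiplicities satisfy
  \<open>3 k + 2 l + m = 6\<close>. A nonzero square excludes \<open>k = 0\<close> and a square of
  rank one excludes \<open>k = 2\<close>; for \<open>k = 1\<close> two solutions remain.\<close>

lemma cube_zero_jordan_matrix:
  assumes "cube_zero X"
  shows "similar_mat X (jordan_matrix [(3, 0), (2, 0), (1, 0)]) \<or>
    similar_mat X (jordan_matrix [(3, 0), (1, 0), (1, 0), (1, 0)])"
proof -
  have X: "X \<in> carrier_mat 6 6" "X ^\<^sub>m 3 = 0\<^sub>m 6 6" "X ^\<^sub>m 2 \<noteq> 0\<^sub>m 6 6" "rank_le 6 1 (X ^\<^sub>m 2)"
    using assms by (auto simp: cube_zero_def)
  obtain xs where "jordan_nf X xs"
    using jordan_nf_exists[OF X(1)] char_poly_factorized[OF X(1)] by blast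
  then have xs: "0 \<notin> fst ` set xs" "similar_mat X (jordan_matrix xs)" by (auto simp: jordan_nf_def)
  obtain P Q where "similar_mat_wit X (jordan_matrix xs) P Q" using xs(2) unfolding similar_mat_def by blast
  from similar_mat_witD2(5)[OF X(1) this] have dim: "sum_list (map fst xs) = 6"
    by (metis carrier_matD(1) jordan_matrix_dim(1))
  have "jordan_matrix xs ^\<^sub>m 3 = 0\<^sub>m 6 6"
    using similar_mat_eq_0_iff[OF similar_mat_pow[OF xs(2)], of 3 6] X by simp
  then have "\<forall>(n, a)\<in>set xs. a = 0 \<and> n \<le> 3"
    using jordan_matrix_pow_eq_0_iff[of 3 xs] xs(1) dim by simp
  moreover have "n > 0" if "(n, a) \<in> set xs" for n a using xs(1) that by (metis fst_conv gr0I image_eqI)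
  moreover have "n = 1 \<or> n = 2 \<or> n = 3" if "n > 0" "n \<le> 3" for n :: nat using that by linarith
  ultimately have "set xs \<subseteq> {(3, 0), (2, 0), (1, 0)}" by fastforce
  from mset_replicate3[OF this] obtain k l m
    where mset: "mset xs = mset (replicate k (3, 0) @ replicate l (2, 0) @ replicate m (1, 0))"
    by (elim exE)
  define ys :: "(nat \<times> complex) list" where "ys = replicate k (3, 0) @ replicate l (2, 0) @ replicate m (1, 0)"
  have sim: "similar_mat X (jordan_matrix ys)"
    using similar_mat_trans[OF xs(2) similar_mat_jordan_matrix_mset] mset by (simp add: ys_def)
  have "sum_list (map fst xs) = sum_list (map fst ys)"
    using mset unfolding ys_def[symmetric] by (metis mset_map sum_mset_sum_list)
  then have klm: "3 * k + 2 * l + m = 6" using dim by (simp add: ys_def sum_list_replicate map_replicate)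
  then have dim_ys: "sum_list (map fst ys) = 6" using \<open>sum_list (map fst xs) = sum_list (map fst ys)\<close> dim by simp
  have sim2: "similar_mat (X ^\<^sub>m 2) (jordan_matrix ys ^\<^sub>m 2)" by (rule similar_mat_pow[OF sim])
  have "k \<noteq> 0"
  proof
    assume "k = 0"
    then have "set ys \<subseteq> {(2, 0), (1, 0)}" by (auto simp: ys_def)
    then have "0 \<notin> fst ` set ys" "\<forall>(n, a)\<in>set ys. a = 0 \<and> n \<le> 2" by auto
    then have "jordan_matrix ys ^\<^sub>m 2 = 0\<^sub>m 6 6"
      using jordan_matrix_pow_eq_0_iff[of 2 ys] dim_ys by simp
    then show False using similar_mat_eq_0_iff[OF sim2, of 6] X by simp
  qed
  \<comment> \<open>For two blocks of size 3 the square has ones at \<open>(0, 2)\<close> and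
    \<open>(3, 5)\<close>, hence a nonzero 2x2 minor.\<close>
  moreover have "k \<noteq> 2"
  proof
    assume "k = 2"
    then have "l = 0" "m = 0" using klm by simp_all
    then have ys: "ys = [(3, 0), (3, 0)]" using \<open>k = 2\<close> by (simp add: ys_def eval_nat_numeral)
    let ?J = "jordan_matrix ys ^\<^sub>m 2"
    have J: "?J \<in> carrier_mat 6 6" using jordan_matrix_carrier[of ys] dim_ys by simp
    have "rank_le 6 1 ?J" using rank_le_similar[OF X(4) similar_mat_sym[OF sim2]] .
    from rank_le_1_minor[OF this J, of 0 2 3 5] show False
      by (simp add: jordan_matrix_pow ys Let_def jordan_block_pow)
  qed
  ultimately have "k = 1 \<and> l = 1 \<and> m = 1 \<or> k = 1 \<and> l = 0 \<and> m = 3" using klm by presburger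
  then have "ys = [(3, 0), (2, 0), (1, 0)] \<or> ys = [(3, 0), (1, 0), (1, 0), (1, 0)]"
    by (auto simp: ys_def numeral_3_eq_3)
  then show ?thesis using sim by auto
qed


section \<open>The orbits of types (3,2,1) and (3,1,1,1)\<close>

text \<open>A representative inside the nilradical: the entries \<open>(2, 3)\<close> and
  \<open>(3, 4)\<close> form a Jordan chain of length 3, the entry \<open>(1, 5)\<close> one of
  length 2. It is also the point near which the component is isolated.\<close>

definition nilp_321 :: "complex mat" where
  "nilp_321 = mat 6 6 (\<lambda>ij. if ij \<in> {(2, 3), (3, 4), (1, 5)} then 1 else 0)"

definition nilp_3111 :: "complex mat" where
  "nilp_3111 = mat 6 6 (\<lambda>ij. if ij \<in> {(2, 3), (3, 4)} then 1 else 0)"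

definition orbit_321 :: "complex mat set" where
  "orbit_321 = {Y. similar_mat Y nilp_321}"

definition orbit_3111 :: "complex mat set" where
  "orbit_3111 = {Y. similar_mat Y nilp_3111}"

lemma nilp_carrier [simp]: "nilp_321 \<in> carrier_mat 6 6" "nilp_3111 \<in> carrier_mat 6 6"
  by (simp_all add: nilp_321_def nilp_3111_def)

lemma nilp_block_nilradical: "nilp_321 \<in> block_nilradical" "nilp_3111 \<in> block_nilradical"
  by (auto simp: nilp_321_def nilp_3111_def block_nilradical_def block_def)

lemma sq_entry_6:
  "X \<in> carrier_mat 6 6 \<Longrightarrow> i < 6 \<Longrightarrow> j < 6 \<Longrightarrow> (X ^\<^sub>m 2) $$ (i, j) = (\<Sum>k<6. X $$ (i, k) * X $$ (k, j))"
  by (simp only: mat_pow_2 mult_mat_entry)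

lemma cube_entry_6:
  assumes "X \<in> carrier_mat 6 6" "i < 6" "j < 6"
  shows "(X ^\<^sub>m 3) $$ (i, j) = (\<Sum>l<6. (\<Sum>k<6. X $$ (i, k) * X $$ (k, l)) * X $$ (l, j))"
proof -
  have "(X * X * X) $$ (i, j) = (\<Sum>l<6. (X * X) $$ (i, l) * X $$ (l, j))"
    using assms mult_mat_entry[of "X * X" 6 X i j] by simp
  also have "\<dots> = (\<Sum>l<6. (\<Sum>k<6. X $$ (i, k) * X $$ (k, l)) * X $$ (l, j))"
    by (intro sum.cong refl arg_cong2[of _ _ _ _ "(*)"] mult_mat_entry) (use assms in auto)
  finally show ?thesis using mat_pow_3[OF assms(1)] by simp
qed

lemma block_nilradical_entry_0:
  "X \<in> block_nilradical \<Longrightarrow> i < 6 \<Longrightarrow> j < 6 \<Longrightarrow> block j \<le> block i \<Longrightarrow> X $$ (i, j) = 0"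
  by (simp add: block_nilradical_def)

lemma block_nilradical_sq:
  assumes X: "X \<in> block_nilradical" and ij: "i < 6" "j < 6"
  shows "(X ^\<^sub>m 2) $$ (i, j) = X $$ (i, 3) * X $$ (3, j)"
proof -
  have Xc: "X \<in> carrier_mat 6 6" using X block_nilradical_carrier by blast
  have "X $$ (i, k) * X $$ (k, j) = 0" if "k < 6" "k \<noteq> 3" for k
  proof (cases "k < 3")
    case True
    then show ?thesis using block_nilradical_entry_0[OF X ij(1) that(1)] by (simp add: block_def)
  next
    case False
    then show ?thesis using block_nilradical_entry_0[OF X that(1) ij(2)] that by (simp add: block_def)
  qed
  then have "(\<Sum>k<6. X $$ (i, k) * X $$ (k, j)) = (\<Sum>k\<in>{3}. X $$ (i, k) * X $$ (k, j))"
    by (intro sum.mono_neutral_right) auto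
  then show ?thesis using sq_entry_6[OF Xc ij] by simp
qed

lemma block_nilradical_cube:
  assumes X: "X \<in> block_nilradical"
  shows "X ^\<^sub>m 3 = 0\<^sub>m 6 6"
proof (rule eq_matI)
  have Xc: "X \<in> carrier_mat 6 6" using X block_nilradical_carrier by blast
  show "dim_row (X ^\<^sub>m 3) = dim_row (0\<^sub>m 6 6)" "dim_col (X ^\<^sub>m 3) = dim_col (0\<^sub>m 6 6)"
    using Xc by auto
  fix i j assume "i < dim_row (0\<^sub>m 6 6 :: complex mat)" "j < dim_col (0\<^sub>m 6 6 :: complex mat)"
  then have ij: "i < 6" "j < 6" by auto
  have "(X ^\<^sub>m 2) $$ (i, l) * X $$ (l, j) = 0" if l: "l < 6" for l
  proof (cases "block l \<le> 1")
    case True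
    then have "X $$ (3, l) = 0" using block_nilradical_entry_0[OF X _ l, of 3] by (simp add: block_def)
    then show ?thesis using block_nilradical_sq[OF X ij(1) l] by simp
  next
    case False
    moreover have "block j \<le> 2" by (simp add: block_def)
    ultimately show ?thesis using block_nilradical_entry_0[OF X l ij(2)] by simp
  qed
  then have "(\<Sum>l<6. (X ^\<^sub>m 2) $$ (i, l) * X $$ (l, j)) = 0" by (intro sum.neutral) simp
  then show "(X ^\<^sub>m 3) $$ (i, j) = 0\<^sub>m 6 6 $$ (i, j)"
    using cube_entry_6[OF Xc ij] sq_entry_6[OF Xc ij(1)] ij by simp
qed

lemma block_nilradical_cube_zero_iff:
  assumes X: "X \<in> block_nilradical"
  shows "cube_zero X \<longleftrightarrow> (\<exists>i<3. X $$ (i, 3) \<noteq> 0) \<and> (\<exists>j\<in>{4, 5}. X $$ (3, j) \<noteq> 0)"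
proof -
  have Xc: "X \<in> carrier_mat 6 6" using X block_nilradical_carrier by blast
  have "rank_le 6 1 (X ^\<^sub>m 2)"
    using Xc by (intro rank_le_1_if_minors) (auto simp: block_nilradical_sq[OF X])
  then have "cube_zero X \<longleftrightarrow> X ^\<^sub>m 2 \<noteq> 0\<^sub>m 6 6"
    using Xc block_nilradical_cube[OF X] by (simp add: cube_zero_def)
  also have "\<dots> \<longleftrightarrow> (\<exists>i<6. \<exists>j<6. X $$ (i, 3) * X $$ (3, j) \<noteq> 0)"
  proof -
    have "X ^\<^sub>m 2 = 0\<^sub>m 6 6 \<longleftrightarrow> (\<forall>i<6. \<forall>j<6. (X ^\<^sub>m 2) $$ (i, j) = 0)"
      using Xc by (auto intro!: eq_matI)
    then show ?thesis by (simp add: block_nilradical_sq[OF X])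
  qed
  also have "\<dots> \<longleftrightarrow> (\<exists>i<3. X $$ (i, 3) \<noteq> 0) \<and> (\<exists>j\<in>{4, 5}. X $$ (3, j) \<noteq> 0)"
  proof -
    have "X $$ (i, 3) = 0" if "\<not> i < 3" "i < 6" for i
      using block_nilradical_entry_0[OF X, of i 3] that by (auto simp: block_def)
    moreover have "X $$ (3, j) = 0" if "j < 6" "j \<notin> {4, 5}" for j
      using block_nilradical_entry_0[OF X, of 3 j] that by (auto simp: block_def)
    ultimately have *: "i < 3" "j \<in> {4, 5}" if "i < 6" "j < 6" "X $$ (i, 3) * X $$ (3, j) \<noteq> 0" for i j
      using that by (metis mult_eq_0_iff)+
    show ?thesis
    proof
      assume "\<exists>i<6. \<exists>j<6. X $$ (i, 3) * X $$ (3, j) \<noteq> 0"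
      then obtain i j where ij: "i < 6" "j < 6" "X $$ (i, 3) * X $$ (3, j) \<noteq> 0" by blast
      from *[OF ij] ij(3) show "(\<exists>i<3. X $$ (i, 3) \<noteq> 0) \<and> (\<exists>j\<in>{4, 5}. X $$ (3, j) \<noteq> 0)" by auto
    next
      assume "(\<exists>i<3. X $$ (i, 3) \<noteq> 0) \<and> (\<exists>j\<in>{4, 5}. X $$ (3, j) \<noteq> 0)"
      then obtain i j where ij: "i < 3" "X $$ (i, 3) \<noteq> 0" "j \<in> {4, 5}" "X $$ (3, j) \<noteq> 0" by blast
      then have "i < 6" "j < 6" "X $$ (i, 3) * X $$ (3, j) \<noteq> 0" by auto
      then show "\<exists>i<6. \<exists>j<6. X $$ (i, 3) * X $$ (3, j) \<noteq> 0" by blast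
    qed
  qed
  finally show ?thesis .
qed

lemma cube_zero_similar:
  assumes "similar_mat Y X" "cube_zero X"
  shows "cube_zero Y"
proof -
  obtain g h where wit: "similar_mat_wit Y X g h" using assms unfolding similar_mat_def by blast
  have X: "X \<in> carrier_mat 6 6" using assms by (simp add: cube_zero_def)
  have Y: "Y \<in> carrier_mat 6 6" using similar_mat_witD2(5)[OF X similar_mat_wit_sym[OF wit]] .
  have "Y ^\<^sub>m k = 0\<^sub>m 6 6 \<longleftrightarrow> X ^\<^sub>m k = 0\<^sub>m 6 6" for k
    by (rule similar_mat_eq_0_iff[OF similar_mat_pow[OF assms(1)]]) (use Y in simp)
  then show ?thesis
    using assms(2) Y rank_le_similar[OF _ similar_mat_pow[OF assms(1)]] unfolding cube_zero_def by blast
qed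

lemma cube_zero_nilp: "cube_zero nilp_321" "cube_zero nilp_3111"
  using nilp_block_nilradical
  by (auto simp: block_nilradical_cube_zero_iff nilp_321_def nilp_3111_def intro!: exI[of _ 2])

lemma not_rank_le_2_nilp_321: "\<not> rank_le 6 2 nilp_321"
  using rank_le_2_minor3[of 6 nilp_321 1 2 3 3 4 5]
  by (auto simp: minor3_def nilp_321_def)

lemma rank_le_2_nilp_3111: "rank_le 6 2 nilp_3111"
  unfolding rank_le_entries[OF nilp_carrier(2)]
  by (rule exI[of _ "\<lambda>i l. if i = l + 2 then 1 else 0"], rule exI[of _ "\<lambda>l j. if j = l + 3 then 1 else 0"])
     (auto simp: nilp_3111_def numeral_2_eq_2 numeral_3_eq_3)

lemma rank_le_2_jordan_3111: "rank_le 6 2 (jordan_matrix [(3, 0), (1, 0), (1, 0), (1, 0)])"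
proof -
  have c: "jordan_matrix [(3, 0), (1, 0), (1, 0), (1, 0)] \<in> carrier_mat 6 6"
    using jordan_matrix_carrier[of "[(3, 0), (1, 0), (1, 0), (1, 0)]"] by simp
  show ?thesis
    unfolding rank_le_entries[OF c]
    by (rule exI[of _ "\<lambda>i l. if i = l then 1 else 0"], rule exI[of _ "\<lambda>l j. if j = l + 1 then 1 else 0"])
       (auto simp: jordan_matrix_def Let_def numeral_2_eq_2 elim!: less_6_cases)
qed

text \<open>The Jordan forms of the two representatives are not computed:
  \<open>cube_zero_jordan_matrix\<close> offers two candidates, and the rank decides between
  them.\<close>

lemma cube_zero_similar_iff:
  assumes "cube_zero X"
  shows "similar_mat X nilp_321 \<longleftrightarrow> \<not> rank_le 6 2 X" "similar_mat X nilp_3111 \<longleftrightarrow> rank_le 6 2 X"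
proof -
  let ?J = "jordan_matrix [(3, 0), (2, 0), (1, 0)] :: complex mat"
  let ?J' = "jordan_matrix [(3, 0), (1, 0), (1, 0), (1, 0)] :: complex mat"
  have 1: "similar_mat nilp_321 ?J"
    using cube_zero_jordan_matrix[OF cube_zero_nilp(1)] rank_le_similar[OF rank_le_2_jordan_3111]
      not_rank_le_2_nilp_321 by blast
  have J: "\<not> rank_le 6 2 ?J" using rank_le_similar[OF _ 1] not_rank_le_2_nilp_321 by blast
  have "\<not> similar_mat nilp_3111 ?J"
    using rank_le_similar[OF rank_le_2_nilp_3111 similar_mat_sym] J by blast
  then have 2: "similar_mat nilp_3111 ?J'"
    using cube_zero_jordan_matrix[OF cube_zero_nilp(2)] by blast
  have "similar_mat X nilp_321 \<or> similar_mat X nilp_3111"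
    using cube_zero_jordan_matrix[OF assms] similar_mat_trans[OF _ similar_mat_sym[OF 1], of X]
      similar_mat_trans[OF _ similar_mat_sym[OF 2], of X] by argo
  moreover have "\<not> rank_le 6 2 X" if "similar_mat X nilp_321"
    using rank_le_similar[OF _ similar_mat_sym[OF that]] not_rank_le_2_nilp_321 by blast
  moreover have "rank_le 6 2 X" if "similar_mat X nilp_3111"
    using rank_le_similar[OF rank_le_2_nilp_3111 that] .
  ultimately show "similar_mat X nilp_321 \<longleftrightarrow> \<not> rank_le 6 2 X" "similar_mat X nilp_3111 \<longleftrightarrow> rank_le 6 2 X"
    by blast+
qed

lemma orbit_321_eq: "orbit_321 = {X. cube_zero X \<and> \<not> rank_le 6 2 X}"
  unfolding orbit_321_def using cube_zero_similar_iff(1) cube_zero_similar[OF _ cube_zero_nilp(1)] by blast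

lemma orbit_3111_eq: "orbit_3111 = {X. cube_zero X \<and> rank_le 6 2 X}"
  unfolding orbit_3111_def using cube_zero_similar_iff(2) cube_zero_similar[OF _ cube_zero_nilp(2)] by blast

lemma nilpotent_orbit_321: "nilpotent_orbit 6 orbit_321"
  and nilpotent_orbit_3111: "nilpotent_orbit 6 orbit_3111"
  using nilp_block_nilradical block_nilradical_sl block_nilradical_cube
  by (auto simp: nilpotent_orbit_iff orbit_321_def orbit_3111_def)

text \<open>\<open>Y - X\<close> is the commutator of \<open>g * X\<close> and \<open>h\<close>,
  hence has trace zero.\<close>

lemma similar_mat_sl:
  assumes "similar_mat Y X" "X \<in> \<ss>\<ll> n"
  shows "Y \<in> \<ss>\<ll> n"
proof -
  have X: "X \<in> carrier_mat n n" using sl_carrier[OF assms(2)] .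
  obtain g h where wit: "similar_mat_wit Y X g h" using assms unfolding similar_mat_def by blast
  note w = similar_mat_witD2[OF X similar_mat_wit_sym[OF wit]]
  have Y: "Y = g * X * h" using similar_mat_witD2[OF w(5) wit] by simp
  have "h * (g * X) = h * g * X" by (rule assoc_mult_mat[OF w(6,7) X, symmetric])
  then have "h * (g * X) = X" using w(1) X by simp
  then have "lie_bracket (g * X) h = Y - X" unfolding lie_bracket_def Y by simp
  moreover have "lie_bracket (g * X) h \<in> \<ss>\<ll> n" by (rule lie_bracket_sl) (use w X in auto)
  ultimately show ?thesis
    using assms(2) w(5) X by (simp add: special_linear_algebra_def sum_subtractf)
qed

lemma nilpotent_orbit_sl: "n > 0 \<Longrightarrow> nilpotent_orbit n O' \<Longrightarrow> O' \<subseteq> \<ss>\<ll> n"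
  using similar_mat_sl by (auto simp: nilpotent_orbit_iff)

lemma orbit_sl: "orbit_321 \<subseteq> \<ss>\<ll> 6" "orbit_3111 \<subseteq> \<ss>\<ll> 6"
  using nilpotent_orbit_sl nilpotent_orbit_321 nilpotent_orbit_3111 by auto

section \<open>The two orbital varieties\<close>

text \<open>In a matrix with blocks \<open>a\<close> (3x1), \<open>b\<close> (3x2) and \<open>c\<close> (1x2), these minors are the
  coordinates of \<open>a \<times> b \<kappa>\<close>, where \<open>\<kappa>\<close> spans the kernel of \<open>c\<close>.\<close>

abbreviation wedge :: "complex mat \<Rightarrow> nat \<Rightarrow> nat \<Rightarrow> complex" where
  "wedge X i j \<equiv> minor3 X i j 3 3 4 5"

lemma wedge_polyfuns: "i < 6 \<Longrightarrow> j < 6 \<Longrightarrow> (\<lambda>X. wedge X i j) \<in> polyfuns 6"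
  unfolding minor3_def by (intro polyfuns_intros) auto

section \<open>The two loci in the nilradical and their parametrization\<close>

definition variety_321 :: "complex mat set" where
  "variety_321 = orbit_321 \<inter> block_nilradical"

definition variety_3111 :: "complex mat set" where
  "variety_3111 = orbit_3111 \<inter> block_nilradical"

definition factored_mat ::
  "(nat \<Rightarrow> complex) \<Rightarrow> (nat \<Rightarrow> complex) \<Rightarrow> (nat \<Rightarrow> complex) \<Rightarrow> (nat \<Rightarrow> complex) \<Rightarrow> complex mat" where
  "factored_mat a u c v = mat 6 6 (\<lambda>(i, j).
     if i < 3 \<and> j = 3 then a i
     else if i < 3 \<and> j > 3 then u i * c j + a i * v j
     else if i = 3 \<and> j > 3 then c j else 0)"

lemma factored_mat_block_nilradical: "factored_mat a u c v \<in> block_nilradical"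
  by (auto simp: factored_mat_def block_nilradical_def block_def)

text \<open>The matrix is the product of the column \<open>(a, 0)\<close> with the row
  \<open>(1, v)\<close> plus that of \<open>(u, 1)\<close> with \<open>(0, c)\<close>.\<close>

lemma rank_le_2_factored_mat: "rank_le 6 2 (factored_mat a u c v)"
proof -
  have c: "factored_mat a u c v \<in> carrier_mat 6 6" by (simp add: factored_mat_def)
  show ?thesis
    unfolding rank_le_entries[OF c]
    by (rule exI[of _ "\<lambda>i l. if l = 0 then (if i < 3 then a i else 0) else (if i < 3 then u i else if i = 3 then 1 else 0)"],
        rule exI[of _ "\<lambda>l j. if l = 0 then (if j = 3 then 1 else if j > 3 then v j else 0) else (if j > 3 then c j else 0)"])
       (auto simp: factored_mat_def numeral_2_eq_2)
qed

text \<open>With \<kappa> equal to \<open>(c 5, - c 4)\<close>, the hypothesis says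
  \<open>b \<kappa> = \<mu> a\<close>. Choose \<open>v\<close> with
  \<open>v \<kappa> = \<mu>\<close>; then \<open>b - a v\<close> annihilates \<kappa>, so its rows
  are multiples of \<open>c\<close>, and \<open>u\<close> is found by dividing by a nonzero entry of
  \<open>c\<close>.\<close>

lemma factored_mat_if_wedge_0:
  assumes X: "X \<in> block_nilradical" and a: "k < 3" "X $$ (k, 3) \<noteq> 0" and c: "\<exists>j\<in>{4, 5}. X $$ (3, j) \<noteq> 0"
    and wedge: "\<And>i j. i < 3 \<Longrightarrow> j < 3 \<Longrightarrow> wedge X i j = 0"
  obtains u v where "X = factored_mat (\<lambda>i. X $$ (i, 3)) u (\<lambda>j. X $$ (3, j)) v"
proof -
  define \<mu> where "\<mu> = (X $$ (k, 4) * X $$ (3, 5) - X $$ (k, 5) * X $$ (3, 4)) / X $$ (k, 3)"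
  have X33: "X $$ (3, 3) = 0" using block_nilradical_entry_0[OF X, of 3 3] by simp
  have \<mu>: "X $$ (i, 4) * X $$ (3, 5) - X $$ (i, 5) * X $$ (3, 4) = \<mu> * X $$ (i, 3)" if "i < 3" for i
    using wedge[OF that a(1)] a X33 by (simp add: \<mu>_def minor3_def field_simps)
  have *: "X = factored_mat (\<lambda>i. X $$ (i, 3)) u (\<lambda>j. X $$ (3, j)) v"
    if "\<And>i j. i < 3 \<Longrightarrow> j = 4 \<or> j = 5 \<Longrightarrow> X $$ (i, j) = u i * X $$ (3, j) + X $$ (i, 3) * v j" for u v
  proof (rule eq_matI)
    fix i j
    assume "i < dim_row (factored_mat (\<lambda>i. X $$ (i, 3)) u (\<lambda>j. X $$ (3, j)) v)"
      "j < dim_col (factored_mat (\<lambda>i. X $$ (i, 3)) u (\<lambda>j. X $$ (3, j)) v)"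
    then have ij: "i < 6" "j < 6" by (auto simp: factored_mat_def)
    then have "j = 4 \<or> j = 5" if "3 < j" using that by linarith
    then show "X $$ (i, j) = factored_mat (\<lambda>i. X $$ (i, 3)) u (\<lambda>j. X $$ (3, j)) v $$ (i, j)"
      using ij that block_nilradical_entry_0[OF X ij] by (auto simp: factored_mat_def block_def)
  qed (use X block_nilradical_carrier in \<open>auto simp: factored_mat_def\<close>)
  show thesis
  proof (cases "X $$ (3, 4) = 0")
    case False
    show thesis
      by (rule that[OF *[of "\<lambda>i. X $$ (i, 4) / X $$ (3, 4)" "\<lambda>j. if j = 4 then 0 else - \<mu> / X $$ (3, 4)"]])
         (use \<mu> False in \<open>auto simp: field_simps\<close>)
  next
    case True
    then have "X $$ (3, 5) \<noteq> 0" using c by auto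
    then show thesis
      by (intro that[OF *[of "\<lambda>i. X $$ (i, 5) / X $$ (3, 5)" "\<lambda>j. if j = 5 then 0 else \<mu> / X $$ (3, 5)"]])
         (use \<mu> in \<open>auto simp: field_simps\<close>)
  qed
qed

lemma variety_3111_factored:
  "X \<in> variety_3111 \<longleftrightarrow>
    (\<exists>a u c v. X = factored_mat a u c v \<and> (\<exists>i<3. a i \<noteq> 0) \<and> (\<exists>j\<in>{4, 5}. c j \<noteq> 0))"
proof
  assume X: "X \<in> variety_3111"
  then have Xb: "X \<in> block_nilradical" and Xz: "cube_zero X" "rank_le 6 2 X"
    by (auto simp: variety_3111_def orbit_3111_eq)
  then have ne: "\<exists>i<3. X $$ (i, 3) \<noteq> 0" "\<exists>j\<in>{4, 5}. X $$ (3, j) \<noteq> 0"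
    using block_nilradical_cube_zero_iff by auto
  have "wedge X i j = 0" if "i < 3" "j < 3" for i j
    using Xz that by (intro rank_le_2_minor3[of 6]) (auto simp: cube_zero_def)
  note wedge = this
  obtain k where k: "k < 3" "X $$ (k, 3) \<noteq> 0" using ne(1) by blast
  obtain u v where "X = factored_mat (\<lambda>i. X $$ (i, 3)) u (\<lambda>j. X $$ (3, j)) v"
    by (rule factored_mat_if_wedge_0[OF Xb k ne(2) wedge])
  then show "\<exists>a u c v. X = factored_mat a u c v \<and> (\<exists>i<3. a i \<noteq> 0) \<and> (\<exists>j\<in>{4, 5}. c j \<noteq> 0)"
    using ne by blast
next
  assume "\<exists>a u c v. X = factored_mat a u c v \<and> (\<exists>i<3. a i \<noteq> 0) \<and> (\<exists>j\<in>{4, 5}. c j \<noteq> 0)"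
  then obtain a u c v where *: "X = factored_mat a u c v" "\<exists>i<3. a i \<noteq> 0" "\<exists>j\<in>{4, 5}. c j \<noteq> 0" by blast
  have "cube_zero X"
    using * block_nilradical_cube_zero_iff[OF factored_mat_block_nilradical] by (auto simp: factored_mat_def)
  then show "X \<in> variety_3111"
    using * rank_le_2_factored_mat factored_mat_block_nilradical by (auto simp: variety_3111_def orbit_3111_eq)
qed

lemma variety_3111_wedge: "X \<in> variety_3111 \<Longrightarrow> i < 6 \<Longrightarrow> j < 6 \<Longrightarrow> wedge X i j = 0"
  by (intro rank_le_2_minor3[of 6]) (auto simp: variety_3111_def orbit_3111_eq cube_zero_def)

lemma variety_321_iff:
  "X \<in> variety_321 \<longleftrightarrow> X \<in> block_nilradical \<and> (\<exists>i<3. X $$ (i, 3) \<noteq> 0) \<and>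
    (\<exists>j\<in>{4, 5}. X $$ (3, j) \<noteq> 0) \<and> (\<exists>i<3. \<exists>j<3. wedge X i j \<noteq> 0)"
proof (cases "X \<in> block_nilradical \<and> (\<exists>i<3. X $$ (i, 3) \<noteq> 0) \<and> (\<exists>j\<in>{4, 5}. X $$ (3, j) \<noteq> 0)")
  case True
  then have Xb: "X \<in> block_nilradical" and ne: "\<exists>i<3. X $$ (i, 3) \<noteq> 0" "\<exists>j\<in>{4, 5}. X $$ (3, j) \<noteq> 0"
    by auto
  have "rank_le 6 2 X \<longleftrightarrow> (\<forall>i<3. \<forall>j<3. wedge X i j = 0)"
  proof
    show "rank_le 6 2 X \<Longrightarrow> \<forall>i<3. \<forall>j<3. wedge X i j = 0"
      using Xb block_nilradical_carrier by (auto intro!: rank_le_2_minor3[of 6])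
    assume "\<forall>i<3. \<forall>j<3. wedge X i j = 0"
    then have wedge: "wedge X i j = 0" if "i < 3" "j < 3" for i j using that by blast
    obtain k where k: "k < 3" "X $$ (k, 3) \<noteq> 0" using ne(1) by blast
    obtain u v where "X = factored_mat (\<lambda>i. X $$ (i, 3)) u (\<lambda>j. X $$ (3, j)) v"
      by (rule factored_mat_if_wedge_0[OF Xb k ne(2) wedge])
    then show "rank_le 6 2 X" by (rule ssubst) (rule rank_le_2_factored_mat)
  qed
  moreover have "cube_zero X" using True block_nilradical_cube_zero_iff by blast
  ultimately show ?thesis using True by (auto simp: variety_321_def orbit_321_eq)
next
  case False
  then show ?thesis using block_nilradical_cube_zero_iff by (auto simp: variety_321_def orbit_321_eq)
qed

lemma nilp_variety: "nilp_321 \<in> variety_321" "nilp_3111 \<in> variety_3111"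
  using nilp_block_nilradical similar_mat_refl[OF nilp_carrier(1)] similar_mat_refl[OF nilp_carrier(2)]
  by (auto simp: variety_321_def variety_3111_def orbit_321_def orbit_3111_def)

lemma variety_sl: "variety_321 \<subseteq> \<ss>\<ll> 6" "variety_3111 \<subseteq> \<ss>\<ll> 6"
  using orbit_sl by (auto simp: variety_321_def variety_3111_def)

lemma closedin_block_nilradical: "closedin (zariski 6) block_nilradical"
  unfolding closedin_zariski
proof (intro exI conjI)
  let ?F = "(\<lambda>(i, j) X. X $$ (i, j)) ` {(i, j). i < 6 \<and> j < 6 \<and> block j \<le> block i}"
  show "?F \<subseteq> polyfuns 6" by (auto intro: polyfuns.entry)
  have *: "(\<forall>f\<in>?F. f X = 0) \<longleftrightarrow> (\<forall>i<6. \<forall>j<6. block j \<le> block i \<longrightarrow> X $$ (i, j) = 0)"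
    for X :: "complex mat"
    by (auto simp: split_beta)
  show "block_nilradical = zero_locus 6 ?F"
    unfolding zero_locus_def * using block_nilradical_sl sl_carrier
    by (auto simp: block_nilradical_def)
qed

lemma irreducible_variety_3111: "irreducible_in (zariski 6) variety_3111"
proof (rule irreducible_in_curves[OF variety_sl(2)])
  show "variety_3111 \<noteq> {}" using nilp_variety by blast
  fix X Y assume "X \<in> variety_3111" "Y \<in> variety_3111"
  then obtain a u c v a' u' c' v' where X: "X = factored_mat a u c v" "\<exists>i<3. a i \<noteq> 0" "\<exists>j\<in>{4, 5}. c j \<noteq> 0"
    and Y: "Y = factored_mat a' u' c' v'"
    unfolding variety_3111_factored by blast
  \<comment> \<open>The locus is not linear, so the interpolation takes place between the factors
    and not between the matrices.\<close>
  define L where "L = (\<lambda>f g t (i :: nat). f i + t * (g i - f i) :: complex)"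
  have L: "polynomial_fun (\<lambda>t. L f g t i)" for f g i unfolding L_def by (intro polynomial_fun_add polynomial_fun_mult) auto
  have L01: "L f g 0 = f" "L f g 1 = g" for f g by (auto simp: L_def)
  define \<gamma> where "\<gamma> = (\<lambda>t. factored_mat (L a a' t) (L u u' t) (L c c' t) (L v v' t))"
  have "poly_curve 6 \<gamma>"
    unfolding poly_curve_def by (auto simp: \<gamma>_def factored_mat_def intro!: L polynomial_fun_if polynomial_fun_add polynomial_fun_mult)
  moreover have "\<gamma> 0 = X" "\<gamma> 1 = Y" by (simp_all add: \<gamma>_def L01 X Y)
  moreover have "finite {t. \<gamma> t \<notin> variety_3111}"
  proof -
    obtain i j where ij: "i < 3" "a i \<noteq> 0" "j \<in> {4, 5}" "c j \<noteq> 0" using X by blast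
    have "finite {t. L a a' t i = 0}" "finite {t. L c c' t j = 0}"
      using ij L01 by (auto intro!: polynomial_fun_finite_zeros[OF L, where s = 0])
    moreover have "{t. \<gamma> t \<notin> variety_3111} \<subseteq> {t. L a a' t i = 0} \<union> {t. L c c' t j = 0}"
      using ij unfolding \<gamma>_def variety_3111_factored by blast
    ultimately show ?thesis by (meson finite_UnI finite_subset)
  qed
  ultimately show "\<exists>\<gamma>. poly_curve 6 \<gamma> \<and> \<gamma> 0 = X \<and> \<gamma> 1 = Y \<and> finite {t. \<gamma> t \<notin> variety_3111}" by blast
qed

text \<open>A straight line works because the conditions that define the locus inside the nilradical
  are open. As the endpoint may be any point of the nilradical, the lemma gives both irreducibility
  and density.\<close>

lemma variety_321_curve:
  assumes X: "X \<in> variety_321" and Y: "Y \<in> block_nilradical"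
  shows "\<exists>\<gamma>. poly_curve 6 \<gamma> \<and> \<gamma> 0 = X \<and> \<gamma> 1 = Y \<and> finite {t. \<gamma> t \<notin> variety_321}"
proof -
  define \<gamma> where "\<gamma> = (\<lambda>t. mat 6 6 (\<lambda>ij. X $$ ij + t * (Y $$ ij - X $$ ij)))"
  have Xb: "X \<in> block_nilradical" using X by (simp add: variety_321_iff)
  have c: "X \<in> carrier_mat 6 6" "Y \<in> carrier_mat 6 6" using Xb Y block_nilradical_carrier by auto
  have curve: "poly_curve 6 \<gamma>"
    unfolding poly_curve_def by (auto simp: \<gamma>_def intro!: polynomial_fun_add polynomial_fun_mult)
  have \<gamma>01: "\<gamma> 0 = X" "\<gamma> 1 = Y" unfolding \<gamma>_def by (rule eq_matI; use c in auto)+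
  have \<gamma>b: "\<gamma> t \<in> block_nilradical" for t using Xb Y by (auto simp: \<gamma>_def block_nilradical_def)
  obtain i j k l where ij: "i < 3" "X $$ (i, 3) \<noteq> 0" "j \<in> {4, 5}" "X $$ (3, j) \<noteq> 0"
    and kl: "k < 3" "l < 3" "wedge X k l \<noteq> 0"
    using X unfolding variety_321_iff by blast
  have fin: "finite {t. f (\<gamma> t) = 0}" if "f \<in> polyfuns 6" "f X \<noteq> 0" for f
    by (rule polynomial_fun_finite_zeros[OF polyfuns_poly_curve[OF that(1) curve], of 0])
       (use that(2) \<gamma>01 in simp)
  have "finite {t. \<gamma> t $$ (i, 3) = 0}" "finite {t. \<gamma> t $$ (3, j) = 0}" "finite {t. wedge (\<gamma> t) k l = 0}"
    using ij kl by (auto intro!: fin[of "\<lambda>X. X $$ (i, 3)"] fin[of "\<lambda>X. X $$ (3, j)"]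
        fin[of "\<lambda>X. wedge X k l"] polyfuns.entry wedge_polyfuns)
  moreover have "{t. \<gamma> t \<notin> variety_321} \<subseteq>
      {t. \<gamma> t $$ (i, 3) = 0} \<union> {t. \<gamma> t $$ (3, j) = 0} \<union> {t. wedge (\<gamma> t) k l = 0}"
    using \<gamma>b ij kl unfolding variety_321_iff by blast
  ultimately have "finite {t. \<gamma> t \<notin> variety_321}" by (meson finite_UnI finite_subset)
  then show ?thesis using curve \<gamma>01 by blast
qed

lemma irreducible_variety_321: "irreducible_in (zariski 6) variety_321"
proof (rule irreducible_in_curves[OF variety_sl(1)])
  show "variety_321 \<noteq> {}" using nilp_variety(1) by blast
  fix X Y assume "X \<in> variety_321" "Y \<in> variety_321"
  then have "X \<in> variety_321" "Y \<in> block_nilradical" by (simp_all add: variety_321_def)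
  then show "\<exists>\<gamma>. poly_curve 6 \<gamma> \<and> \<gamma> 0 = X \<and> \<gamma> 1 = Y \<and> finite {t. \<gamma> t \<notin> variety_321}"
    by (rule variety_321_curve)
qed

lemma closure_variety_321: "zariski_closure 6 variety_321 = block_nilradical"
proof
  show "zariski_closure 6 variety_321 \<subseteq> block_nilradical"
    by (rule closure_of_minimal[OF _ closedin_block_nilradical]) (auto simp: variety_321_def)
  show "block_nilradical \<subseteq> zariski_closure 6 variety_321"
  proof
    fix Y assume Y: "Y \<in> block_nilradical"
    obtain \<gamma> where \<gamma>: "poly_curve 6 \<gamma>" "\<gamma> 1 = Y" "finite {t. \<gamma> t \<notin> variety_321}"
      using variety_321_curve[OF nilp_variety(1) Y] by blast
    have "\<gamma> 1 \<in> \<ss>\<ll> 6" using \<gamma>(2) Y block_nilradical_sl by blast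
    from zariski_closure_curve[OF variety_sl(1) \<gamma>(1,3) this]
    show "Y \<in> zariski_closure 6 variety_321" using \<gamma>(2) by simp
  qed
qed


subsection \<open>They are irreducible components\<close>

lemma block_nilradical_strictly_upper: "block_nilradical \<subseteq> strictly_upper 6"
proof
  fix X assume X: "X \<in> block_nilradical"
  have "block j \<le> block i" if "j \<le> i" for i j using that by (auto simp: block_def)
  then show "X \<in> strictly_upper 6" using X by (auto simp: strictly_upper_def block_nilradical_def)
qed

lemma strictly_upper_block_nilradical_iff:
  assumes "X \<in> strictly_upper 6"
  shows "X \<in> block_nilradical \<longleftrightarrow> X $$ (0, 1) = 0 \<and> X $$ (0, 2) = 0 \<and> X $$ (1, 2) = 0 \<and> X $$ (4, 5) = 0"
proof
  assume *: "X $$ (0, 1) = 0 \<and> X $$ (0, 2) = 0 \<and> X $$ (1, 2) = 0 \<and> X $$ (4, 5) = 0"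
  have "X $$ (i, j) = 0" if ij: "i < 6" "j < 6" "block j \<le> block i" for i j
  proof (cases "j \<le> i")
    case True then show ?thesis using assms ij by (simp add: strictly_upper_def)
  next
    case False
    then have "(i, j) \<in> {(0, 1), (0, 2), (1, 2), (4, 5)}" using ij by (auto simp: block_def split: if_splits)
    then show ?thesis using * by auto
  qed
  then show "X \<in> block_nilradical" using assms by (simp add: block_nilradical_def strictly_upper_def)
qed (auto simp: block_nilradical_def block_def)

lemma strictly_upper_entry_0: "X \<in> strictly_upper 6 \<Longrightarrow> i < 6 \<Longrightarrow> j \<le> i \<Longrightarrow> X $$ (i, j) = 0"
  by (simp add: strictly_upper_def)

text \<open>The square of a strictly upper triangular matrix vanishes next to the diagonal. Hence
  its minors with rows 1, 2 and columns 3, 4, and with rows 2, 3 and columns 4, 5, are monomials in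
  the superdiagonal entries of \<open>X\<close>.\<close>

lemma cube_zero_strictly_upper_near:
  assumes X: "X \<in> strictly_upper 6" and z: "cube_zero X" and ne: "X $$ (2, 3) \<noteq> 0" "X $$ (3, 4) \<noteq> 0"
  shows "X $$ (1, 2) = 0" "X $$ (4, 5) = 0"
proof -
  have Xc: "X \<in> carrier_mat 6 6" and r: "rank_le 6 1 (X ^\<^sub>m 2)" using z by (auto simp: cube_zero_def)
  note sq = sq_entry_6[OF Xc] sum_less_6 strictly_upper_entry_0[OF X]
  have minor: "(X ^\<^sub>m 2) $$ (i, j) * (X ^\<^sub>m 2) $$ (k, l) = (X ^\<^sub>m 2) $$ (i, l) * (X ^\<^sub>m 2) $$ (k, j)"
    if "i < 6" "j < 6" "k < 6" "l < 6" for i j k l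
    by (rule rank_le_1_minor[OF r]) (use that Xc in auto)
  show "X $$ (1, 2) = 0" using minor[of 1 3 2 4] ne by (simp add: sq)
  show "X $$ (4, 5) = 0" using minor[of 2 4 3 5] ne by (simp add: sq)
qed

text \<open>The minors with rows 0, 2, 3 and columns 1, 3, 4 or 2, 3, 4 are triangular: they equal
  the entry at \<open>(0, 1)\<close> or \<open>(0, 2)\<close> times the two nonzero entries.\<close>

lemma orbit_3111_strictly_upper_near:
  assumes X: "X \<in> strictly_upper 6" "X \<in> orbit_3111" and ne: "X $$ (2, 3) \<noteq> 0" "X $$ (3, 4) \<noteq> 0"
  shows "X \<in> block_nilradical"
proof -
  have z: "cube_zero X" "rank_le 6 2 X" using X(2) by (auto simp: orbit_3111_eq)
  have Xc: "X \<in> carrier_mat 6 6" using z by (auto simp: cube_zero_def)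
  note minor = rank_le_2_minor3[OF z(2) Xc]
  have "X $$ (0, 1) = 0" "X $$ (0, 2) = 0"
    using minor[of 0 2 3 1 3 4] minor[of 0 2 3 2 3 4] ne
    by (simp_all add: minor3_def strictly_upper_entry_0[OF X(1)])
  then show ?thesis
    using cube_zero_strictly_upper_near[OF X(1) z(1) ne] strictly_upper_block_nilradical_iff[OF X(1)] by blast
qed

text \<open>The 3x3 minor of the rows 2, 3, 4 and the columns 4, 5, 6 of a strictly upper triangular
  matrix.\<close>

definition corner_minor :: "complex mat \<Rightarrow> complex" where
  "corner_minor X = X $$ (2, 3) * (X $$ (1, 4) * X $$ (3, 5) - X $$ (1, 5) * X $$ (3, 4))
     - X $$ (1, 3) * (X $$ (2, 4) * X $$ (3, 5) - X $$ (2, 5) * X $$ (3, 4))"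

text \<open>The vanishing cube and the rank of the square give two homogeneous linear equations,
  \<open>e1\<close> and \<open>e2\<close>, for the entries at \<open>(0, 1)\<close> and
  \<open>(0, 2)\<close>. Up to sign the determinant of this system is
  \<open>corner_minor X\<close>.\<close>

lemma orbit_321_strictly_upper_near:
  assumes X: "X \<in> strictly_upper 6" "X \<in> orbit_321"
    and ne: "X $$ (2, 3) \<noteq> 0" "X $$ (3, 4) \<noteq> 0" "corner_minor X \<noteq> 0"
  shows "X \<in> block_nilradical"
proof -
  have z: "cube_zero X" using X(2) by (auto simp: orbit_321_eq)
  have Xc: "X \<in> carrier_mat 6 6" and r: "rank_le 6 1 (X ^\<^sub>m 2)" and cube: "X ^\<^sub>m 3 = 0\<^sub>m 6 6"
    using z by (auto simp: cube_zero_def)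
  note near = cube_zero_strictly_upper_near[OF X(1) z ne(1,2)]
  note sq = sum_less_6 strictly_upper_entry_0[OF X(1)] near near[unfolded One_nat_def]
  have "(X ^\<^sub>m 3) $$ (0, 4) = 0" using cube by simp
  then have e1: "X $$ (0, 2) * X $$ (2, 3) = - X $$ (0, 1) * X $$ (1, 3)"
    using ne by (simp add: cube_entry_6[OF Xc] sq add_eq_0_iff)
  have "(X ^\<^sub>m 2) $$ (0, 4) * (X ^\<^sub>m 2) $$ (2, 5) = (X ^\<^sub>m 2) $$ (0, 5) * (X ^\<^sub>m 2) $$ (2, 4)"
    by (rule rank_le_1_minor[OF r]) (use Xc in auto)
  then have "X $$ (2, 3) * ((X $$ (0, 1) * X $$ (1, 4) + X $$ (0, 2) * X $$ (2, 4) + X $$ (0, 3) * X $$ (3, 4)) * X $$ (3, 5))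
      = X $$ (2, 3) * ((X $$ (0, 1) * X $$ (1, 5) + X $$ (0, 2) * X $$ (2, 5) + X $$ (0, 3) * X $$ (3, 5)) * X $$ (3, 4))"
    by (simp add: sq_entry_6[OF Xc] sq ac_simps)
  then have "(X $$ (0, 1) * X $$ (1, 4) + X $$ (0, 2) * X $$ (2, 4) + X $$ (0, 3) * X $$ (3, 4)) * X $$ (3, 5)
      = (X $$ (0, 1) * X $$ (1, 5) + X $$ (0, 2) * X $$ (2, 5) + X $$ (0, 3) * X $$ (3, 5)) * X $$ (3, 4)"
    using ne(1) by (simp only: mult_cancel_left) simp
  then have e2: "X $$ (0, 1) * (X $$ (1, 4) * X $$ (3, 5) - X $$ (1, 5) * X $$ (3, 4))
      + X $$ (0, 2) * (X $$ (2, 4) * X $$ (3, 5) - X $$ (2, 5) * X $$ (3, 4)) = 0" (is "?e = 0")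
    by (simp add: algebra_simps)
  have "X $$ (0, 1) * corner_minor X = X $$ (2, 3) * ?e
      - (X $$ (0, 2) * X $$ (2, 3) + X $$ (0, 1) * X $$ (1, 3)) * (X $$ (2, 4) * X $$ (3, 5) - X $$ (2, 5) * X $$ (3, 4))"
    by (simp add: corner_minor_def algebra_simps)
  also have "\<dots> = 0" unfolding e2 e1 by simp
  finally have "X $$ (0, 1) * corner_minor X = 0" .
  then have "X $$ (0, 1) = 0" using ne by simp
  then have "X $$ (0, 2) = 0" using e1 ne by simp
  then show ?thesis
    using near \<open>X $$ (0, 1) = 0\<close> strictly_upper_block_nilradical_iff[OF X(1)] by blast
qed

text \<open>An irreducible set between \<open>S \<inter> C\<close> and \<open>S\<close> contains
  \<open>X\<close>, and its points with \<open>f\<close> nonzero are dense in it and lie in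
  \<open>C\<close>. Maximality thus follows without any knowledge of the other components.\<close>

lemma irreducible_component_near:
  assumes irr: "irreducible_in (zariski n) (S \<inter> C)" and C: "closedin (zariski n) C"
    and f: "f \<in> polyfuns n" and near: "\<And>X. X \<in> S \<Longrightarrow> f X \<noteq> 0 \<Longrightarrow> X \<in> C"
    and X: "X \<in> S \<inter> C" "f X \<noteq> 0"
  shows "irreducible_component (zariski n) S (S \<inter> C)"
  unfolding irreducible_component_def
proof (intro conjI allI impI irr)
  fix V' assume V': "S \<inter> C \<subseteq> V' \<and> V' \<subseteq> S \<and> irreducible_in (zariski n) V'"
  have "V' \<subseteq> C" by (rule irreducible_in_subset_closed[OF _ f C, of _ X]) (use V' near X in auto)
  then show "V' = S \<inter> C" using V' by blast
qed auto

lemma orbital_variety_of_3111: "orbital_variety_of 6 orbit_3111 variety_3111"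
proof -
  have eq: "orbit_3111 \<inter> strictly_upper 6 \<inter> block_nilradical = variety_3111"
    using block_nilradical_strictly_upper by (auto simp: variety_3111_def)
  have "irreducible_component (zariski 6) (orbit_3111 \<inter> strictly_upper 6) (orbit_3111 \<inter> strictly_upper 6 \<inter> block_nilradical)"
  proof (rule irreducible_component_near[OF _ closedin_block_nilradical])
    show "(\<lambda>X. X $$ (2, 3) * X $$ (3, 4)) \<in> polyfuns 6" by (intro polyfuns_intros) auto
    show "nilp_3111 \<in> orbit_3111 \<inter> strictly_upper 6 \<inter> block_nilradical"
      using nilp_variety(2) unfolding eq .
  qed (use irreducible_variety_3111 orbit_3111_strictly_upper_near in \<open>auto simp: eq nilp_3111_def\<close>)
  then show ?thesis unfolding orbital_variety_of_def eq using nilpotent_orbit_3111 by blast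
qed

lemma orbital_variety_of_321: "orbital_variety_of 6 orbit_321 variety_321"
proof -
  have eq: "orbit_321 \<inter> strictly_upper 6 \<inter> block_nilradical = variety_321"
    using block_nilradical_strictly_upper by (auto simp: variety_321_def)
  have "irreducible_component (zariski 6) (orbit_321 \<inter> strictly_upper 6) (orbit_321 \<inter> strictly_upper 6 \<inter> block_nilradical)"
  proof (rule irreducible_component_near[OF _ closedin_block_nilradical])
    show "(\<lambda>X. X $$ (2, 3) * X $$ (3, 4) * corner_minor X) \<in> polyfuns 6"
      unfolding corner_minor_def by (intro polyfuns_intros) auto
    show "nilp_321 \<in> orbit_321 \<inter> strictly_upper 6 \<inter> block_nilradical"
      using nilp_variety(1) unfolding eq .
  qed (use irreducible_variety_321 orbit_321_strictly_upper_near in \<open>auto simp: eq nilp_321_def corner_minor_def\<close>)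
  then show ?thesis unfolding orbital_variety_of_def eq using nilpotent_orbit_321 by blast
qed

text \<open>A component is nonempty, and a nilpotent orbit is determined by any one of its
  points.\<close>

lemma assoc_orbit_eq:
  assumes "n > 0" "orbital_variety_of n O' V"
  shows "assoc_orbit n V = O'"
  unfolding assoc_orbit_def
proof (rule the_equality)
  show "orbital_variety_of n O' V" by (rule assms(2))
  fix P assume P: "orbital_variety_of n P V"
  have "V \<noteq> {}" "V \<subseteq> O'" "V \<subseteq> P"
    using assms P by (auto simp: orbital_variety_of_def irreducible_component_def irreducible_in_def)
  then obtain X where X: "X \<in> O'" "X \<in> P" by blast
  have "P = {Z. similar_mat Z X}" "O' = {Z. similar_mat Z X}"
    using nilpotent_orbit_eq[OF assms(1)] X P assms(2) by (auto simp: orbital_variety_of_def)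
  then show "P = O'" by simp
qed

section \<open>Descendants\<close>

lemma nilpotent_orbit_cube_zero:
  assumes P: "nilpotent_orbit 6 P" and X: "X \<in> P" "cube_zero X"
  shows "P = orbit_321 \<or> P = orbit_3111"
proof -
  have "X \<in> orbit_321 \<or> X \<in> orbit_3111" using X by (auto simp: orbit_321_eq orbit_3111_eq)
  then show ?thesis
    using nilpotent_orbit_eq[OF _ P X(1)] nilpotent_orbit_eq[OF _ nilpotent_orbit_321, of X]
      nilpotent_orbit_eq[OF _ nilpotent_orbit_3111, of X] by auto
qed

lemma zariski_closure_polyfun:
  assumes "S \<subseteq> \<ss>\<ll> n" "f \<in> polyfuns n" "\<And>Y. Y \<in> S \<Longrightarrow> f Y = 0" "X \<in> zariski_closure n S"
  shows "f X = 0"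
  using assms(2-4) unfolding zariski_closure_iff[OF assms(1)] by blast

lemma subset_zariski_closure: "S \<subseteq> \<ss>\<ll> n \<Longrightarrow> S \<subseteq> zariski_closure n S"
  by (simp add: closure_of_subset topspace_zariski)

lemma closure_variety_3111_wedge:
  "X \<in> zariski_closure 6 variety_3111 \<Longrightarrow> i < 6 \<Longrightarrow> j < 6 \<Longrightarrow> wedge X i j = 0"
  by (rule zariski_closure_polyfun[OF variety_sl(2) wedge_polyfuns]) (auto simp: variety_3111_wedge)

lemma closure_variety_3111_subset: "zariski_closure 6 variety_3111 \<subseteq> block_nilradical"
  by (rule closure_of_minimal[OF _ closedin_block_nilradical]) (auto simp: variety_3111_def)

lemma wedge_nilp_321: "wedge nilp_321 1 2 \<noteq> 0"
  by (simp add: minor3_def nilp_321_def)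

lemma closure_variety_psubset: "zariski_closure 6 variety_3111 \<subset> zariski_closure 6 variety_321"
  using closure_variety_3111_subset closure_variety_3111_wedge[of nilp_321 1 2] wedge_nilp_321
    nilp_block_nilradical(1) by (auto simp: closure_variety_321)

text \<open>The closure of an intermediate variety contains \<open>nilp_3111\<close>, so some point
  of the variety has nonzero entries at \<open>(2, 3)\<close> and \<open>(3, 4)\<close> and
  satisfies \<open>cube_zero\<close>. Its orbit is then one of the two. Maximality of the component
  excludes the larger orbit, monotonicity of closures the smaller one.\<close>

lemma geometric_descendant_3111: "geometric_descendant 6 variety_3111 variety_321"
  unfolding geometric_descendant_def
proof (intro conjI notI closure_variety_psubset)
  show "orbital_variety 6 variety_3111" "orbital_variety 6 variety_321"
    using orbital_variety_of_3111 orbital_variety_of_321 unfolding orbital_variety_def by blast+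
  assume "\<exists>Y. orbital_variety 6 Y \<and> zariski_closure 6 variety_3111 \<subset> zariski_closure 6 Y \<and>
    zariski_closure 6 Y \<subset> zariski_closure 6 variety_321"
  then obtain Y P where Y: "orbital_variety_of 6 P Y"
    "zariski_closure 6 variety_3111 \<subset> zariski_closure 6 Y"
    "zariski_closure 6 Y \<subset> zariski_closure 6 variety_321"
    unfolding orbital_variety_def by blast
  have P: "nilpotent_orbit 6 P" "irreducible_component (zariski 6) (P \<inter> strictly_upper 6) Y"
    using Y(1) by (auto simp: orbital_variety_of_def)
  then have sub: "Y \<subseteq> P \<inter> strictly_upper 6"
    and max: "\<And>V'. Y \<subseteq> V' \<Longrightarrow> V' \<subseteq> P \<inter> strictly_upper 6 \<Longrightarrow> irreducible_in (zariski 6) V' \<Longrightarrow> V' = Y"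
    unfolding irreducible_component_def by auto
  have sl: "Y \<subseteq> \<ss>\<ll> 6" using sub nilpotent_orbit_sl[OF _ P(1)] by auto
  have Yb: "Y \<subseteq> block_nilradical" using subset_zariski_closure[OF sl] Y(3) by (auto simp: closure_variety_321)
  have "\<exists>X\<in>Y. X $$ (2, 3) * X $$ (3, 4) \<noteq> 0"
  proof (rule ccontr)
    assume "\<not> ?thesis"
    then have *: "\<And>X. X \<in> Y \<Longrightarrow> X $$ (2, 3) * X $$ (3, 4) = 0" by blast
    have "nilp_3111 \<in> zariski_closure 6 Y"
      using nilp_variety(2) subset_zariski_closure[OF variety_sl(2)] Y(2) by blast
    moreover have "(\<lambda>X. X $$ (2, 3) * X $$ (3, 4)) \<in> polyfuns 6" by (intro polyfuns_intros) auto
    ultimately have "nilp_3111 $$ (2, 3) * nilp_3111 $$ (3, 4) = 0"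
      using zariski_closure_polyfun[where f = "\<lambda>X. X $$ (2, 3) * X $$ (3, 4)", OF sl _ *] by blast
    then show False by (simp add: nilp_3111_def)
  qed
  then obtain X where X: "X \<in> Y" "X $$ (2, 3) * X $$ (3, 4) \<noteq> 0" by blast
  then have "\<exists>i<3. X $$ (i, 3) \<noteq> 0" "\<exists>j\<in>{4, 5}. X $$ (3, j) \<noteq> 0" by (auto intro!: exI[of _ 2])
  then have "cube_zero X" using block_nilradical_cube_zero_iff X Yb by blast
  then consider "P = orbit_321" | "P = orbit_3111" using nilpotent_orbit_cube_zero[OF P(1)] X sub by blast
  then show False
  proof cases
    case 1
    then have "Y \<subseteq> variety_321" using sub Yb by (auto simp: variety_321_def)
    moreover have "variety_321 \<subseteq> P \<inter> strictly_upper 6"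
      using 1 block_nilradical_strictly_upper by (auto simp: variety_321_def)
    ultimately have "variety_321 = Y" using max irreducible_variety_321 by blast
    then show False using Y(3) by blast
  next
    case 2
    then have "Y \<subseteq> variety_3111" using sub Yb by (auto simp: variety_3111_def)
    then have "zariski_closure 6 Y \<subseteq> zariski_closure 6 variety_3111" by (rule closure_of_mono)
    then show False using Y(2) by blast
  qed
qed

section \<open>The closure order of the two orbits\<close>

lemma poly_curve_conj:
  assumes \<gamma>: "poly_curve n \<gamma>" "\<And>t. \<gamma> t \<in> carrier_mat n n" and g: "g \<in> carrier_mat n n" "h \<in> carrier_mat n n"
  shows "poly_curve n (\<lambda>t. g * \<gamma> t * h)"
  unfolding poly_curve_def
proof (intro allI impI)
  fix i j assume ij: "i < n" "j < n"
  have "(g * \<gamma> t * h) $$ (i, j) = (\<Sum>l<n. (\<Sum>k<n. g $$ (i, k) * \<gamma> t $$ (k, l)) * h $$ (l, j))" for t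
  proof -
    have "(g * \<gamma> t * h) $$ (i, j) = (\<Sum>l<n. (g * \<gamma> t) $$ (i, l) * h $$ (l, j))"
      by (rule mult_mat_entry) (use \<gamma>(2)[of t] g ij in auto)
    also have "\<dots> = (\<Sum>l<n. (\<Sum>k<n. g $$ (i, k) * \<gamma> t $$ (k, l)) * h $$ (l, j))"
      by (intro sum.cong refl arg_cong2[of _ _ _ _ "(*)"] mult_mat_entry) (use \<gamma>(2)[of t] g ij in auto)
    finally show ?thesis .
  qed
  moreover have "polynomial_fun (\<lambda>t. \<gamma> t $$ (k, l))" if "k < n" "l < n" for k l
    using \<gamma>(1) that by (simp add: poly_curve_def)
  ultimately show "polynomial_fun (\<lambda>t. (g * \<gamma> t * h) $$ (i, j))"
    by (simp only:) (intro polynomial_fun_sum polynomial_fun_mult polynomial_fun_const; simp)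
qed

lemma orbit_3111_subset_closure: "orbit_3111 \<subseteq> zariski_closure 6 orbit_321"
proof
  fix Z assume Z: "Z \<in> orbit_3111"
  then obtain g h where wit: "similar_mat_wit Z nilp_3111 g h"
    unfolding orbit_3111_def similar_mat_def by blast
  note w = similar_mat_witD2[OF nilp_carrier(2) similar_mat_wit_sym[OF wit]]
  \<comment> \<open>The chain of length 2 in \<open>nilp_321\<close> is scaled by \<open>t\<close>
    and disappears at \<open>t = 0\<close>.\<close>
  define N :: "complex \<Rightarrow> complex mat" where
    "N = (\<lambda>t. mat 6 6 (\<lambda>ij. if ij \<in> {(2, 3), (3, 4)} then 1 else if ij = (1, 5) then t else 0))"
  have Nc: "N t \<in> carrier_mat 6 6" for t by (simp add: N_def)
  have "N t \<in> orbit_321" if "t \<noteq> 0" for t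
  proof -
    have "N t \<in> variety_321"
      unfolding variety_321_iff
      by (intro conjI exI[of _ "1::nat"] exI[of _ "2::nat"])
         (use that in \<open>auto simp: N_def block_nilradical_def block_def minor3_def intro!: exI[of _ 2]\<close>)
    then show ?thesis by (simp add: variety_321_def)
  qed
  moreover have "similar_mat (g * N t * h) (N t)" for t
  proof -
    have "similar_mat_wit (g * N t * h) (N t) g h"
      by (rule similar_mat_witI[of g h 6]) (use w(1,2,6,7) Nc[of t] in auto)
    then show ?thesis unfolding similar_mat_def by blast
  qed
  ultimately have *: "g * N t * h \<in> orbit_321" if "t \<noteq> 0" for t
    using that similar_mat_trans unfolding orbit_321_def by blast
  have "poly_curve 6 N" by (auto simp: poly_curve_def N_def)
  then have curve: "poly_curve 6 (\<lambda>t. g * N t * h)" by (rule poly_curve_conj[OF _ Nc]) (use w in auto)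
  have "N 0 = nilp_3111" by (rule eq_matI) (auto simp: N_def nilp_3111_def)
  then have Z0: "g * N 0 * h = Z" using similar_mat_witD2(3)[OF w(5) wit] by simp
  have "{t. g * N t * h \<notin> orbit_321} \<subseteq> {0}" using * by blast
  then have "finite {t. g * N t * h \<notin> orbit_321}" by (rule finite_subset) simp
  from zariski_closure_curve[OF orbit_sl(1) curve this, of 0]
  show "Z \<in> zariski_closure 6 orbit_321" using Z0 Z orbit_sl(2) by auto
qed

text \<open>The vanishing cube and the rank of the square are polynomial equations and pass from
  \<open>orbit_321\<close> to its closure. An intermediate \<open>P\<close> also has a point with
  nonzero square, because its closure contains \<open>nilp_3111\<close>. Hence \<open>P\<close> is
  one of the two orbits.\<close>

lemma orbit_descendant_3111: "orbit_descendant 6 orbit_3111 orbit_321"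
  unfolding orbit_descendant_def
proof (intro conjI notI nilpotent_orbit_321 nilpotent_orbit_3111)
  have "zariski_closure 6 orbit_3111 \<subseteq> zariski_closure 6 orbit_321"
    using orbit_3111_subset_closure by (rule closure_of_minimal) (rule closedin_closure_of)
  moreover have "nilp_321 \<in> zariski_closure 6 orbit_321"
    using nilp_variety(1) subset_zariski_closure[OF orbit_sl(1)] by (auto simp: variety_321_def)
  moreover have "nilp_321 \<notin> zariski_closure 6 orbit_3111"
  proof
    assume *: "nilp_321 \<in> zariski_closure 6 orbit_3111"
    have "wedge Y 1 2 = 0" if "Y \<in> orbit_3111" for Y
      by (rule rank_le_2_minor3[of 6]) (use that in \<open>auto simp: orbit_3111_eq cube_zero_def\<close>)
    from zariski_closure_polyfun[where f = "\<lambda>X. wedge X 1 2", OF orbit_sl(2) wedge_polyfuns this *]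
    show False using wedge_nilp_321 by simp
  qed
  ultimately show "zariski_closure 6 orbit_3111 \<subset> zariski_closure 6 orbit_321" by blast
  assume "\<exists>P. nilpotent_orbit 6 P \<and> zariski_closure 6 orbit_3111 \<subset> zariski_closure 6 P \<and>
    zariski_closure 6 P \<subset> zariski_closure 6 orbit_321"
  then obtain P where P: "nilpotent_orbit 6 P" "zariski_closure 6 orbit_3111 \<subset> zariski_closure 6 P"
    "zariski_closure 6 P \<subset> zariski_closure 6 orbit_321" by blast
  have sl: "P \<subseteq> \<ss>\<ll> 6" using nilpotent_orbit_sl[OF _ P(1)] by simp
  let ?sq = "\<lambda>i j X. \<Sum>k<6. X $$ (i, k) * X $$ (k, j) :: complex"
  have sq: "?sq i j \<in> polyfuns 6" if "i < 6" "j < 6" for i j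
    using that by (intro polyfuns_intros) auto
  have "\<exists>X\<in>P. ?sq 2 4 X \<noteq> 0"
  proof (rule ccontr)
    assume "\<not> ?thesis"
    then have *: "\<And>X. X \<in> P \<Longrightarrow> ?sq 2 4 X = 0" by blast
    have "nilp_3111 \<in> zariski_closure 6 P"
      using nilp_variety(2) subset_zariski_closure[OF orbit_sl(2)] P(2) by (auto simp: variety_3111_def)
    from zariski_closure_polyfun[where f = "?sq 2 4", OF sl sq * this]
    show False by (simp add: nilp_3111_def sum_less_6)
  qed
  then obtain X where X: "X \<in> P" "?sq 2 4 X \<noteq> 0" by blast
  have Xc: "X \<in> carrier_mat 6 6" using X sl sl_carrier by blast
  have X_cl: "X \<in> zariski_closure 6 orbit_321" using X subset_zariski_closure[OF sl] P(3) by blast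
  have O: "Y \<in> carrier_mat 6 6" "Y ^\<^sub>m 3 = 0\<^sub>m 6 6" "rank_le 6 1 (Y ^\<^sub>m 2)" if "Y \<in> orbit_321" for Y
    using that by (auto simp: orbit_321_eq cube_zero_def)
  have "(X ^\<^sub>m 3) $$ (i, j) = 0" if ij: "i < 6" "j < 6" for i j
  proof -
    let ?f = "\<lambda>X. \<Sum>l<6. (\<Sum>k<6. X $$ (i, k) * X $$ (k, l)) * X $$ (l, j) :: complex"
    have "?f \<in> polyfuns 6" using ij by (intro polyfuns_intros) auto
    moreover have "?f Y = 0" if "Y \<in> orbit_321" for Y
      using O[OF that] cube_entry_6[OF O(1)[OF that] ij] ij by simp
    ultimately have "?f X = 0" by (rule zariski_closure_polyfun[where f = ?f, OF orbit_sl(1) _ _ X_cl])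
    then show ?thesis using cube_entry_6[OF Xc ij] by simp
  qed
  then have cube: "X ^\<^sub>m 3 = 0\<^sub>m 6 6" using Xc by (auto intro!: eq_matI)
  have "rank_le 6 1 (X ^\<^sub>m 2)"
  proof (rule rank_le_1_if_minors)
    fix i j k l :: nat assume ijkl: "i < 6" "j < 6" "k < 6" "l < 6"
    let ?f = "\<lambda>X. ?sq i j X * ?sq k l X - ?sq i l X * ?sq k j X"
    have "?f \<in> polyfuns 6" using ijkl by (intro polyfuns_intros) auto
    moreover have "?f Y = 0" if "Y \<in> orbit_321" for Y
    proof -
      have "(Y ^\<^sub>m 2) $$ (i, j) * (Y ^\<^sub>m 2) $$ (k, l) = (Y ^\<^sub>m 2) $$ (i, l) * (Y ^\<^sub>m 2) $$ (k, j)"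
        by (rule rank_le_1_minor[OF O(3)[OF that] _ ijkl]) (use O(1)[OF that] in simp)
      then show ?thesis using ijkl by (simp add: sq_entry_6[OF O(1)[OF that]])
    qed
    ultimately have "?f X = 0" by (rule zariski_closure_polyfun[where f = ?f, OF orbit_sl(1) _ _ X_cl])
    then show "(X ^\<^sub>m 2) $$ (i, j) * (X ^\<^sub>m 2) $$ (k, l) = (X ^\<^sub>m 2) $$ (i, l) * (X ^\<^sub>m 2) $$ (k, j)"
      using ijkl by (simp add: sq_entry_6[OF Xc])
  qed (use Xc in simp)
  moreover have "X ^\<^sub>m 2 \<noteq> 0\<^sub>m 6 6"
  proof
    assume "X ^\<^sub>m 2 = 0\<^sub>m 6 6"
    then have "(X ^\<^sub>m 2) $$ (2, 4) = 0" by simp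
    then show False using X(2) sq_entry_6[OF Xc, of 2 4] by simp
  qed
  ultimately have "cube_zero X" using Xc cube by (simp add: cube_zero_def)
  then show False using nilpotent_orbit_cube_zero[OF P(1) X(1)] P by blast
qed


section \<open>The codimension\<close>

definition block_coords :: "(nat \<Rightarrow> complex) \<Rightarrow> complex mat" where
  "block_coords x = mat 6 6 (\<lambda>(i, j).
     if i < 3 \<and> j = 3 then x i
     else if i < 3 \<and> j = 4 then x (i + 3)
     else if i < 3 \<and> j = 5 then x (i + 6)
     else if i = 3 \<and> j = 4 then x 9
     else if i = 3 \<and> j = 5 then x 10 else 0)"

lemma range_block_coords: "range block_coords = block_nilradical"
proof (intro equalityI subsetI)
  fix X assume "X \<in> range block_coords"
  then show "X \<in> block_nilradical" by (auto simp: block_coords_def block_nilradical_def block_def)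
next
  fix X assume X: "X \<in> block_nilradical"
  define x where "x = (\<lambda>k. if k < 3 then X $$ (k, 3) else if k < 6 then X $$ (k - 3, 4)
    else if k < 9 then X $$ (k - 6, 5) else if k = 9 then X $$ (3, 4) else X $$ (3, 5))"
  have "X = block_coords x"
  proof (rule eq_matI)
    fix i j assume "i < dim_row (block_coords x)" "j < dim_col (block_coords x)"
    then have ij: "i < 6" "j < 6" by (auto simp: block_coords_def)
    show "X $$ (i, j) = block_coords x $$ (i, j)"
    proof (cases "block j \<le> block i")
      case True
      then show ?thesis using block_nilradical_entry_0[OF X ij] ij
        by (auto simp: block_coords_def block_def split: if_splits)
    next
      case False
      then have "i < 3 \<and> j \<in> {3, 4, 5} \<or> i = 3 \<and> j \<in> {4, 5}" using ij by (auto simp: block_def split: if_splits)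
      then show ?thesis using ij by (auto simp: block_coords_def x_def)
    qed
  qed (use X block_nilradical_carrier in \<open>auto simp: block_coords_def\<close>)
  then show "X \<in> range block_coords" by blast
qed

lemma multidegree_block_coords:
  assumes "i < 6" "j < 6"
  shows "multidegree_le 11 1 (\<lambda>x. block_coords x $$ (i, j))"
proof -
  have "multidegree_le 11 1 (\<lambda>x. if i < 3 \<and> j = 3 then x i else if i < 3 \<and> j = 4 then x (i + 3)
     else if i < 3 \<and> j = 5 then x (i + 6) else if i = 3 \<and> j = 4 then x 9
     else if i = 3 \<and> j = 5 then x 10 else 0)"
    by (intro multidegree_le_if multidegree_le_coord multidegree_le_const)
  then show ?thesis using assms by (simp add: block_coords_def)
qed

lemma block_coords_local: "(\<forall>i<11. x i = y i) \<Longrightarrow> block_coords x = block_coords y"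
  by (rule eq_matI) (auto simp: block_coords_def)

text \<open>All coordinates of the nilradical but \<open>(1, 4)\<close> and \<open>(2, 4)\<close>,
  which the vanishing of the wedges determines from the others wherever the entries at
  \<open>(0, 3)\<close> and \<open>(3, 5)\<close> are nonzero.\<close>

definition variety_3111_coords :: "(complex mat \<Rightarrow> complex) list" where
  "variety_3111_coords = map (\<lambda>ij X. X $$ ij)
     [(0, 3), (1, 3), (2, 3), (3, 4), (3, 5), (0, 5), (1, 5), (2, 5), (0, 4)]"

lemma alg_indep_variety_3111: "alg_indep_on variety_3111 variety_3111_coords"
  unfolding alg_indep_on_def
proof (intro allI impI ballI)
  fix D c e
  assume rel: "\<forall>X\<in>variety_3111. mpoly_eval D c (map (\<lambda>F. F X) variety_3111_coords) = 0"
    and e: "e \<in> exponents D (length variety_3111_coords)"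
  have "mpoly_eval D c xs = 0" if xs: "length xs = 9" "0 \<notin> set xs" for xs
  proof -
    have nz: "xs ! i \<noteq> 0" if "i < 9" for i using xs that by (metis nth_mem)
    \<comment> \<open>A point with prescribed coordinates: with \<open>v 5 = 0\<close> the vector
      \<open>u\<close> alone produces column 5, and \<open>v 4\<close> then corrects the entry at
      \<open>(0, 4)\<close>.\<close>
    define u where "u = (\<lambda>i. xs ! (i + 5) / xs ! 4)"
    define v where "v = (\<lambda>j :: nat. if j = 4 then (xs ! 8 - u 0 * xs ! 3) / xs ! 0 else 0)"
    define X where "X = factored_mat ((!) xs) u (\<lambda>j. xs ! (j - 1)) v"
    have "\<exists>i<3. xs ! i \<noteq> 0" using nz[of 0] by (intro exI[of _ 0]) simp
    moreover have "\<exists>j\<in>{4, 5}. xs ! (j - 1) \<noteq> 0" using nz[of 3] by simp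
    ultimately have X: "X \<in> variety_3111" unfolding variety_3111_factored X_def by blast
    have upt: "[0..<9] = [0, 1, 2, 3, 4, 5, 6, 7, 8 :: nat]" by code_simp
    have "map (\<lambda>F. F X) variety_3111_coords = map ((!) xs) [0..<9]"
      unfolding upt using nz[of 0] nz[of 4]
      by (simp add: variety_3111_coords_def X_def factored_mat_def u_def v_def)
    then have "map (\<lambda>F. F X) variety_3111_coords = xs" using xs(1) map_nth[of xs] by simp
    then show ?thesis using rel X by metis
  qed
  then show "c e = 0"
    by (rule mpoly_eval_unique) (use e in \<open>simp_all add: variety_3111_coords_def\<close>)
qed

text \<open>A \<open>factored_mat\<close> whose row 0 is perturbed by \<open>w\<close>, so that only
  the wedge of the rows 1 and 2 is forced to vanish. With unrestricted parameters irreducibility is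
  immediate, and the closure of this family is the middle link of the chain.\<close>

definition wedge_12_mat ::
  "(nat \<Rightarrow> complex) \<Rightarrow> (nat \<Rightarrow> complex) \<Rightarrow> (nat \<Rightarrow> complex) \<Rightarrow> (nat \<Rightarrow> complex) \<Rightarrow> (nat \<Rightarrow> complex) \<Rightarrow> complex mat"
  where "wedge_12_mat a u c v w = mat 6 6 (\<lambda>(i, j).
     if i < 3 \<and> j = 3 then a i
     else if i < 3 \<and> j > 3 then u i * c j + a i * v j + (if i = 0 then w j else 0)
     else if i = 3 \<and> j > 3 then c j else 0)"

definition wedge_12_family :: "complex mat set" where
  "wedge_12_family = {wedge_12_mat a u c v w |a u c v w. True}"

lemma wedge_12_family_subset: "wedge_12_family \<subseteq> block_nilradical"
  by (auto simp: wedge_12_family_def wedge_12_mat_def block_nilradical_def block_def)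

lemma irreducible_wedge_12_family: "irreducible_in (zariski 6) wedge_12_family"
proof (rule irreducible_in_curves)
  show "wedge_12_family \<subseteq> \<ss>\<ll> 6" using wedge_12_family_subset block_nilradical_sl by blast
  show "wedge_12_family \<noteq> {}" unfolding wedge_12_family_def by blast
  fix X Y assume "X \<in> wedge_12_family" "Y \<in> wedge_12_family"
  then obtain a u c v w a' u' c' v' w' where X: "X = wedge_12_mat a u c v w" and Y: "Y = wedge_12_mat a' u' c' v' w'"
    unfolding wedge_12_family_def by blast
  define L where "L = (\<lambda>f g t (i :: nat). f i + t * (g i - f i) :: complex)"
  have L: "polynomial_fun (\<lambda>t. L f g t i)" for f g i unfolding L_def by (intro polynomial_fun_add polynomial_fun_mult) auto
  have L01: "L f g 0 = f" "L f g 1 = g" for f g by (auto simp: L_def)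
  define \<gamma> where "\<gamma> = (\<lambda>t. wedge_12_mat (L a a' t) (L u u' t) (L c c' t) (L v v' t) (L w w' t))"
  have "poly_curve 6 \<gamma>"
    unfolding poly_curve_def
    by (auto simp: \<gamma>_def wedge_12_mat_def intro!: L polynomial_fun_if polynomial_fun_add polynomial_fun_mult)
  moreover have "\<gamma> 0 = X" "\<gamma> 1 = Y" by (simp_all add: \<gamma>_def L01 X Y)
  moreover have "{t. \<gamma> t \<notin> wedge_12_family} = {}" unfolding wedge_12_family_def \<gamma>_def by blast
  ultimately show "\<exists>\<gamma>. poly_curve 6 \<gamma> \<and> \<gamma> 0 = X \<and> \<gamma> 1 = Y \<and> finite {t. \<gamma> t \<notin> wedge_12_family}"
    by (metis finite.emptyI)
qed

lemma closure_wedge_12_family: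
  shows "zariski_closure 6 variety_3111 \<subset> zariski_closure 6 wedge_12_family"
    and "zariski_closure 6 wedge_12_family \<subset> block_nilradical"
proof -
  have sl: "wedge_12_family \<subseteq> \<ss>\<ll> 6" using wedge_12_family_subset block_nilradical_sl by blast
  have "variety_3111 \<subseteq> wedge_12_family"
  proof
    fix X assume "X \<in> variety_3111"
    then obtain a u c v where X: "X = factored_mat a u c v" unfolding variety_3111_factored by blast
    show "X \<in> wedge_12_family"
      unfolding wedge_12_family_def mem_Collect_eq
      by (rule exI[of _ a], rule exI[of _ u], rule exI[of _ c], rule exI[of _ v], rule exI[of _ "\<lambda>_. 0"])
         (auto simp: X factored_mat_def wedge_12_mat_def intro!: eq_matI)
  qed
  then have sub: "zariski_closure 6 variety_3111 \<subseteq> zariski_closure 6 wedge_12_family" by (rule closure_of_mono)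
  \<comment> \<open>A member of the family whose wedge of the rows 0 and 2 is nonzero; it separates
    the family from the smaller locus.\<close>
  define N where "N = mat 6 6 (\<lambda>ij. if ij \<in> {(2, 3), (3, 4), (0, 5)} then 1 else 0 :: complex)"
  have "N \<in> wedge_12_family"
    unfolding wedge_12_family_def mem_Collect_eq
    by (rule exI[of _ "\<lambda>i. if i = 2 then 1 else 0"], rule exI[of _ "\<lambda>_. 0"],
        rule exI[of _ "\<lambda>j. if j = 4 then 1 else 0"], rule exI[of _ "\<lambda>_. 0"],
        rule exI[of _ "\<lambda>j. if j = 5 then 1 else 0"])
       (auto simp: N_def wedge_12_mat_def intro!: eq_matI)
  then have "N \<in> zariski_closure 6 wedge_12_family" using subset_zariski_closure[OF sl] by blast
  moreover have "wedge N 0 2 \<noteq> 0" by (simp add: minor3_def N_def)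
  ultimately show "zariski_closure 6 variety_3111 \<subset> zariski_closure 6 wedge_12_family"
    using sub closure_variety_3111_wedge[of N 0 2] by auto
  have "zariski_closure 6 wedge_12_family \<subseteq> block_nilradical"
    by (rule closure_of_minimal[OF wedge_12_family_subset closedin_block_nilradical])
  moreover have "wedge Y 1 2 = 0" if "Y \<in> wedge_12_family" for Y
    using that by (auto simp: wedge_12_family_def wedge_12_mat_def minor3_def algebra_simps)
  then have "nilp_321 \<notin> zariski_closure 6 wedge_12_family"
    using zariski_closure_polyfun[where f = "\<lambda>X. wedge X 1 2", OF sl wedge_polyfuns] wedge_nilp_321 by auto
  ultimately show "zariski_closure 6 wedge_12_family \<subset> block_nilradical"
    using nilp_block_nilradical(1) by blast
qed

lemma irreducible_block_nilradical: "irreducible_in (zariski 6) block_nilradical"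
  using irreducible_in_closure[OF irreducible_variety_321] by (simp add: closure_variety_321)

lemma codim_variety_3111:
  "codim_in (subtopology (zariski 6) block_nilradical) (zariski_closure 6 variety_3111) = enat 2"
proof -
  define Z where "Z = (\<lambda>i :: nat. if i = 0 then zariski_closure 6 variety_3111
    else if i = 1 then zariski_closure 6 wedge_12_family else block_nilradical)"
  have Z: "closedin (zariski 6) (Z i) \<and> irreducible_in (zariski 6) (Z i)" for i
    using closedin_block_nilradical irreducible_block_nilradical
      irreducible_in_closure[OF irreducible_variety_3111] irreducible_in_closure[OF irreducible_wedge_12_family]
    by (simp add: Z_def)
  have chain: "Z i \<subset> Z (Suc i)" if "i < 2" for i
  proof -
    have "i = 0 \<or> i = 1" using that by linarith
    then show ?thesis using closure_wedge_12_family by (auto simp: Z_def)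
  qed
  have sub: "Z i \<subseteq> block_nilradical" for i
    using closure_wedge_12_family by (auto simp: Z_def)
  have "alg_indep_on (zariski_closure 6 variety_3111) variety_3111_coords"
    using alg_indep_on_mono[OF alg_indep_variety_3111 subset_zariski_closure[OF variety_sl(2)]] .
  moreover have "set variety_3111_coords \<subseteq> polyfuns 6"
    by (auto simp: variety_3111_coords_def intro!: polyfuns.entry)
  moreover have "length variety_3111_coords + 2 = 11" by (simp add: variety_3111_coords_def)
  moreover have "Z 0 = zariski_closure 6 variety_3111" by (simp add: Z_def)
  ultimately show ?thesis
    using codim_in_eq[OF multidegree_block_coords block_coords_local, unfolded range_block_coords,
        of 6 variety_3111_coords "zariski_closure 6 variety_3111" 2 Z]
      closedin_block_nilradical Z chain sub by blast
qed


section \<open>The vanishing ideal needs more than two generators\<close>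

lemma (in cring) genideal_two:
  assumes ab: "a \<in> carrier R" "b \<in> carrier R" and f: "f \<in> Idl {a, b}"
  obtains x y where "x \<in> carrier R" "y \<in> carrier R" "f = x \<otimes> a \<oplus> y \<otimes> b"
proof -
  let ?I = "PIdl a <+>\<^bsub>R\<^esub> PIdl b"
  have I: "ideal ?I R" using add_ideals cgenideal_ideal ab by blast
  have zero: "\<zero> \<in> PIdl a" "\<zero> \<in> PIdl b"
    using ab cgenideal_ideal additive_subgroup.zero_closed ideal.axioms(1) by blast+
  have "a \<oplus> \<zero> \<in> ?I" "\<zero> \<oplus> b \<in> ?I"
    unfolding set_add_def' using zero cgenideal_self ab by blast+
  then have "{a, b} \<subseteq> ?I" using ab by simp
  then have "f \<in> ?I" using genideal_minimal[OF I] f by blast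
  then obtain p q where "p \<in> PIdl a" "q \<in> PIdl b" "f = p \<oplus> q" unfolding set_add_def' by blast
  then show thesis using that unfolding cgenideal_def by blast
qed

section \<open>Division of polynomial functions by matrix entries\<close>

definition clear_entry :: "nat \<Rightarrow> nat \<times> nat \<Rightarrow> complex mat \<Rightarrow> complex mat" where
  "clear_entry n ij X = mat n n (\<lambda>kl. if kl = ij then 0 else X $$ kl)"

text \<open>The factor theorem in a single matrix entry. With \<open>f0\<close> and
  \<open>g0\<close> the values after clearing, products are handled by
  \<open>f g - f0 g0 = (f - f0) g + f0 (g - g0)\<close>.\<close>

lemma polyfuns_clear_entry:
  assumes "f \<in> polyfuns n"
  shows "\<exists>f'\<in>polyfuns n. \<forall>X\<in>carrier_mat n n. f X - f (clear_entry n ij X) = X $$ ij * f' X"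
  using assms
proof (induction rule: polyfuns.induct)
  case (const c)
  show ?case by (rule bexI[of _ "\<lambda>X. 0"]) (auto intro: polyfuns.const)
next
  case (entry k l)
  show ?case
    by (rule bexI[of _ "\<lambda>X. if (k, l) = ij then 1 else 0"])
       (use entry in \<open>auto simp: clear_entry_def intro: polyfuns.const\<close>)
next
  case (add f g)
  then obtain f' g' where *: "f' \<in> polyfuns n" "g' \<in> polyfuns n"
    "\<forall>X\<in>carrier_mat n n. f X - f (clear_entry n ij X) = X $$ ij * f' X"
    "\<forall>X\<in>carrier_mat n n. g X - g (clear_entry n ij X) = X $$ ij * g' X" by blast
  show ?case
  proof (rule bexI[of _ "\<lambda>X. f' X + g' X"])
    show "\<forall>X\<in>carrier_mat n n. f X + g X - (f (clear_entry n ij X) + g (clear_entry n ij X)) = X $$ ij * (f' X + g' X)"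
      using *(3,4) by (simp add: algebra_simps)
  qed (use * in \<open>auto intro: polyfuns.add\<close>)
next
  case (mult f g)
  then obtain f' g' where *: "f' \<in> polyfuns n" "g' \<in> polyfuns n"
    "\<forall>X\<in>carrier_mat n n. f X - f (clear_entry n ij X) = X $$ ij * f' X"
    "\<forall>X\<in>carrier_mat n n. g X - g (clear_entry n ij X) = X $$ ij * g' X" by blast
  \<comment> \<open>The quotient of a product involves the entry itself, which is a polynomial
    function only for indices in range; outside the range clearing changes nothing.\<close>
  show ?case
  proof (cases "ij \<in> {..<n} \<times> {..<n}")
    case True
    then have e: "(\<lambda>X. X $$ ij) \<in> polyfuns n" by (auto intro: polyfuns.entry)
    show ?thesis
    proof (rule bexI[of _ "\<lambda>X. f' X * g X + (f X - X $$ ij * f' X) * g' X"])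
      show "\<forall>X\<in>carrier_mat n n. f X * g X - f (clear_entry n ij X) * g (clear_entry n ij X)
          = X $$ ij * (f' X * g X + (f X - X $$ ij * f' X) * g' X)"
      proof
        fix X :: "complex mat" assume X: "X \<in> carrier_mat n n"
        have **: "f (clear_entry n ij X) = f X - X $$ ij * f' X" "g (clear_entry n ij X) = g X - X $$ ij * g' X"
          using *(3,4)[rule_format, OF X] by (simp_all add: algebra_simps)
        show "f X * g X - f (clear_entry n ij X) * g (clear_entry n ij X)
          = X $$ ij * (f' X * g X + (f X - X $$ ij * f' X) * g' X)"
          unfolding ** by (simp add: algebra_simps)
      qed
      show "(\<lambda>X. f' X * g X + (f X - X $$ ij * f' X) * g' X) \<in> polyfuns n"
        by (intro polyfuns_intros * mult.hyps e)
    qed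
  next
    case False
    have "clear_entry n ij X = X" if "X \<in> carrier_mat n n" for X
      by (rule eq_matI) (use that False in \<open>auto simp: clear_entry_def\<close>)
    then show ?thesis by (intro bexI[of _ "\<lambda>X. 0"]) (auto intro: polyfuns.const)
  qed
qed

text \<open>For distinct \<open>i\<close> and \<open>j\<close> below 3, the minor
  \<open>wedge X i j\<close> restricts to \<open>x y z\<close> on this coordinate 3-space.\<close>

definition test_mat :: "nat \<Rightarrow> nat \<Rightarrow> complex \<Rightarrow> complex \<Rightarrow> complex \<Rightarrow> complex mat" where
  "test_mat i j x y z = mat 6 6 (\<lambda>kl. if kl = (i, 3) then x else if kl = (j, 4) then y
     else if kl = (3, 5) then z else 0)"

lemma test_mat_carrier [simp]: "test_mat i j x y z \<in> carrier_mat 6 6"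
  by (simp add: test_mat_def)

lemma test_mat_poly_curve:
  "polynomial_fun f \<Longrightarrow> polynomial_fun g \<Longrightarrow> polynomial_fun h \<Longrightarrow>
    poly_curve 6 (\<lambda>t. test_mat i j (f t) (g t) (h t))"
  unfolding poly_curve_def by (auto simp: test_mat_def intro!: polynomial_fun_if)

lemma polynomial_fun_eq_0_off_0:
  assumes "polynomial_fun f" "\<And>t. t \<noteq> 0 \<Longrightarrow> f t = 0"
  shows "f t = 0"
proof (rule polynomial_fun_eq_0[OF assms(1)])
  have "{t. f t \<noteq> 0} \<subseteq> {0}" using assms(2) by blast
  then show "finite {t. f t \<noteq> 0}" by (rule finite_subset) simp
qed

text \<open>Divide by the three coordinates in turn. The quotient is known to vanish on the next
  plane only where the earlier coordinates are nonzero, and this extends to the whole plane by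
  continuity of polynomials. The result is stated on the diagonal, the only place where it is
  evaluated.\<close>

lemma polyfuns_vanishing_on_coordinate_planes:
  assumes f: "f \<in> polyfuns 6" and i: "i < 3" "j < 3"
    and vanish: "\<And>x y z. x = 0 \<or> y = 0 \<or> z = 0 \<Longrightarrow> f (test_mat i j x y z) = 0"
  shows "\<exists>q\<in>polyfuns 6. \<forall>t. f (test_mat i j t t t) = t ^ 3 * q (test_mat i j t t t)"
proof -
  let ?T = "test_mat i j"
  have clear: "clear_entry 6 (i, 3) (?T x y z) = ?T 0 y z" "clear_entry 6 (j, 4) (?T x y z) = ?T x 0 z"
    "clear_entry 6 (3, 5) (?T x y z) = ?T x y 0" for x y z
    unfolding clear_entry_def test_mat_def by (rule eq_matI; auto)+
  have entry: "?T x y z $$ (i, 3) = x" "?T x y z $$ (j, 4) = y" "?T x y z $$ (3, 5) = z" for x y z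
    using i by (simp_all add: test_mat_def)
  obtain f1 where f1: "f1 \<in> polyfuns 6"
    "\<forall>X\<in>carrier_mat 6 6. f X - f (clear_entry 6 (i, 3) X) = X $$ (i, 3) * f1 X"
    using polyfuns_clear_entry[OF f] by blast
  have f1': "f (?T x y z) = x * f1 (?T x y z)" for x y z
    using f1(2)[rule_format, OF test_mat_carrier[of i j x y z]] vanish[of 0 y z] by (simp add: clear entry)
  have "f1 (?T x 0 z) = 0" for x z
  proof (rule polynomial_fun_eq_0_off_0[of "\<lambda>x. f1 (?T x 0 z)"])
    show "polynomial_fun (\<lambda>x. f1 (?T x 0 z))"
      by (rule polyfuns_poly_curve[OF f1(1)]) (intro test_mat_poly_curve; simp)
    show "f1 (?T x 0 z) = 0" if "x \<noteq> 0" for x using f1'[of x 0 z] vanish[of x 0 z] that by simp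
  qed
  note f1_0 = this
  obtain f2 where f2: "f2 \<in> polyfuns 6"
    "\<forall>X\<in>carrier_mat 6 6. f1 X - f1 (clear_entry 6 (j, 4) X) = X $$ (j, 4) * f2 X"
    using polyfuns_clear_entry[OF f1(1)] by blast
  have f2': "f1 (?T x y z) = y * f2 (?T x y z)" for x y z
    using f2(2)[rule_format, OF test_mat_carrier[of i j x y z]] f1_0[of x z] by (simp add: clear entry)
  \<comment> \<open>Two coordinates have been divided out, so the zero values of \<open>x\<close>
    and of \<open>y\<close> are recovered one after the other.\<close>
  have "f2 (?T x y 0) = 0" if "y \<noteq> 0" for x y
  proof (rule polynomial_fun_eq_0_off_0[of "\<lambda>x. f2 (?T x y 0)"])
    show "polynomial_fun (\<lambda>x. f2 (?T x y 0))"
      by (rule polyfuns_poly_curve[OF f2(1)]) (intro test_mat_poly_curve; simp)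
    show "f2 (?T x y 0) = 0" if "x \<noteq> 0" for x
      using f1'[of x y 0] f2'[of x y 0] vanish[of x y 0] that \<open>y \<noteq> 0\<close> by simp
  qed
  note f2_ne = this
  have "f2 (?T x y 0) = 0" for x y
  proof (rule polynomial_fun_eq_0_off_0[of "\<lambda>y. f2 (?T x y 0)"])
    show "polynomial_fun (\<lambda>y. f2 (?T x y 0))"
      by (rule polyfuns_poly_curve[OF f2(1)]) (intro test_mat_poly_curve; simp)
  qed (rule f2_ne)
  note f2_0 = this
  obtain f3 where f3: "f3 \<in> polyfuns 6"
    "\<forall>X\<in>carrier_mat 6 6. f2 X - f2 (clear_entry 6 (3, 5) X) = X $$ (3, 5) * f3 X"
    using polyfuns_clear_entry[OF f2(1)] by blast
  have f3': "f2 (?T x y z) = z * f3 (?T x y z)" for x y z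
    using f3(2)[rule_format, OF test_mat_carrier[of i j x y z]] f2_0[of x y] by (simp add: clear entry)
  have "f (?T t t t) = t ^ 3 * f3 (?T t t t)" for t
    using f1'[of t t t] f2'[of t t t] f3'[of t t t] by (simp add: power3_eq_cube mult.assoc)
  then show ?thesis using f3(1) by blast
qed

text \<open>Each case deforms to a \<open>factored_mat\<close>. For \<open>z = 0\<close> the entry
  \<open>y\<close> arises as \<open>u j * c 4\<close>, with \<open>c\<close> concentrated in column
  4; for \<open>x = 0\<close> it arises as \<open>a j * v 4\<close>; for \<open>y = 0\<close>
  nothing has to be produced. The parameter \<open>t\<close> makes \<open>a\<close> and
  \<open>c\<close> nonzero.\<close>

lemma test_mat_in_closure:
  assumes ij: "i < 3" "j < 3" "i \<noteq> j" and xyz: "x = 0 \<or> y = 0 \<or> z = 0"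
  shows "test_mat i j x y z \<in> zariski_closure 6 variety_3111"
proof -
  have sl: "test_mat i j x y z \<in> \<ss>\<ll> 6"
  proof -
    have "test_mat i j x y z \<in> block_nilradical" using ij by (auto simp: test_mat_def block_nilradical_def block_def)
    then show ?thesis using block_nilradical_sl by blast
  qed
  have *: ?thesis if \<gamma>: "poly_curve 6 \<gamma>" "\<gamma> 0 = test_mat i j x y z" "finite A"
    "\<And>t. t \<notin> A \<Longrightarrow> \<gamma> t \<in> variety_3111" for \<gamma> A
  proof -
    have "{t. \<gamma> t \<notin> variety_3111} \<subseteq> A" using \<gamma>(4) by blast
    then have "finite {t. \<gamma> t \<notin> variety_3111}" by (rule finite_subset) (rule \<gamma>(3))
    from zariski_closure_curve[OF variety_sl(2) \<gamma>(1) this, of 0] show ?thesis using \<gamma>(2) sl by simp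
  qed
  have in_variety: "X \<in> variety_3111" if "X = factored_mat a u c v" "k < 3" "a k \<noteq> 0" "l \<in> {4, 5}" "c l \<noteq> 0"
    for X a u c v k l using that unfolding variety_3111_factored by blast
  consider "z = 0" | "y = 0" | "x = 0" using xyz by blast
  then show ?thesis
  proof cases
    case 1
    let ?\<gamma> = "\<lambda>t. mat 6 6 (\<lambda>kl. if kl = (i, 3) then x + t else if kl = (j, 4) then y else if kl = (3, 4) then t else 0)"
    show ?thesis
    proof (rule *[of ?\<gamma> "{0, - x}"])
      show "poly_curve 6 ?\<gamma>" by (auto simp: poly_curve_def)
      show "?\<gamma> 0 = test_mat i j x y z" using 1 ij by (auto simp: test_mat_def intro!: eq_matI)
      fix t assume t: "t \<notin> {0, - x}"
      show "?\<gamma> t \<in> variety_3111"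
      proof (rule in_variety[of _ "\<lambda>k. if k = i then x + t else 0" "\<lambda>k. if k = j then y / t else 0"
            "\<lambda>l. if l = 4 then t else 0" "\<lambda>_. 0" i 4])
        show "?\<gamma> t = factored_mat (\<lambda>k. if k = i then x + t else 0) (\<lambda>k. if k = j then y / t else 0)
            (\<lambda>l. if l = 4 then t else 0) (\<lambda>_. 0)"
          by (rule eq_matI) (use t ij in \<open>auto simp: factored_mat_def\<close>)
        show "(if i = i then x + t else 0) \<noteq> 0" using t by (auto simp: add_eq_0_iff)
      qed (use t ij in auto)
    qed simp
  next
    case 2
    let ?\<gamma> = "\<lambda>t. mat 6 6 (\<lambda>kl. if kl = (i, 3) then x + t else if kl = (3, 5) then z + t else 0)"
    show ?thesis
    proof (rule *[of ?\<gamma> "{- x, - z}"])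
      show "poly_curve 6 ?\<gamma>" by (auto simp: poly_curve_def)
      show "?\<gamma> 0 = test_mat i j x y z" using 2 ij by (auto simp: test_mat_def intro!: eq_matI)
      fix t assume t: "t \<notin> {- x, - z}"
      show "?\<gamma> t \<in> variety_3111"
      proof (rule in_variety[of _ "\<lambda>k. if k = i then x + t else 0" "\<lambda>_. 0"
            "\<lambda>l. if l = 5 then z + t else 0" "\<lambda>_. 0" i 5])
        show "?\<gamma> t = factored_mat (\<lambda>k. if k = i then x + t else 0) (\<lambda>_. 0)
            (\<lambda>l. if l = 5 then z + t else 0) (\<lambda>_. 0)"
          by (rule eq_matI) (use t ij in \<open>auto simp: factored_mat_def\<close>)
        show "(if i = i then x + t else 0) \<noteq> 0" using t by (auto simp: add_eq_0_iff)
        show "(if (5 :: nat) = 5 then z + t else 0) \<noteq> 0" using t by (auto simp: add_eq_0_iff)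
      qed (use t ij in auto)
    qed simp
  next
    case 3
    let ?\<gamma> = "\<lambda>t. mat 6 6 (\<lambda>kl. if kl = (j, 3) then t else if kl = (j, 4) then y else if kl = (3, 5) then z + t else 0)"
    show ?thesis
    proof (rule *[of ?\<gamma> "{0, - z}"])
      show "poly_curve 6 ?\<gamma>" by (auto simp: poly_curve_def)
      show "?\<gamma> 0 = test_mat i j x y z" using 3 ij by (auto simp: test_mat_def intro!: eq_matI)
      fix t assume t: "t \<notin> {0, - z}"
      show "?\<gamma> t \<in> variety_3111"
      proof (rule in_variety[of _ "\<lambda>k. if k = j then t else 0" "\<lambda>_. 0"
            "\<lambda>l. if l = 5 then z + t else 0" "\<lambda>l. if l = 4 then y / t else 0" j 5])
        show "?\<gamma> t = factored_mat (\<lambda>k. if k = j then t else 0) (\<lambda>_. 0)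
            (\<lambda>l. if l = 5 then z + t else 0) (\<lambda>l. if l = 4 then y / t else 0)"
          by (rule eq_matI) (use t ij in \<open>auto simp: factored_mat_def\<close>)
        show "(if (5 :: nat) = 5 then z + t else 0) \<noteq> 0" using t by (auto simp: add_eq_0_iff)
      qed (use t ij in auto)
    qed simp
  qed
qed

text \<open>The 3x3 identity matrix cannot factor through a space of dimension two, since the
  determinant of such a product expands to zero.\<close>

lemma det3_of_rank_2_product_neq_1:
  fixes x y p q :: "nat \<Rightarrow> complex"
  assumes "\<And>l m. l < 3 \<Longrightarrow> m < 3 \<Longrightarrow> x l * p m + y l * q m = (if l = m then 1 else 0)"
  shows False
proof -
  have e: "x 0 * p 0 + y 0 * q 0 = 1" "x 1 * p 1 + y 1 * q 1 = 1" "x 2 * p 2 + y 2 * q 2 = 1"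
    "x 0 * p 1 + y 0 * q 1 = 0" "x 0 * p 2 + y 0 * q 2 = 0" "x 1 * p 0 + y 1 * q 0 = 0"
    "x 1 * p 2 + y 1 * q 2 = 0" "x 2 * p 0 + y 2 * q 0 = 0" "x 2 * p 1 + y 2 * q 1 = 0"
    using assms[of 0 0] assms[of 1 1] assms[of 2 2] assms[of 0 1] assms[of 0 2] assms[of 1 0]
      assms[of 1 2] assms[of 2 0] assms[of 2 1] by simp_all
  have det: "M 0 0 * (M 1 1 * M 2 2 - M 1 2 * M 2 1) - M 0 1 * (M 1 0 * M 2 2 - M 1 2 * M 2 0)
      + M 0 2 * (M 1 0 * M 2 1 - M 1 1 * M 2 0) = 0"
    if "\<And>l m. M l m = x l * p m + y l * q m" for M :: "nat \<Rightarrow> nat \<Rightarrow> complex"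
    unfolding that by (simp add: algebra_simps)
  show False using det[of "\<lambda>l m. x l * p m + y l * q m"] unfolding e by simp
qed

lemma not_complete_intersection_3111: "\<not> complete_intersection 6 {1, 2, 5} variety_3111"
proof
  let ?M = block_nilradical and ?W = "zariski_closure 6 variety_3111"
  let ?R = "coordinate_ring 6 ?M"
  assume "complete_intersection 6 {1, 2, 5} variety_3111"
  then obtain k g where k: "codim_in (subtopology (zariski 6) ?M) ?W = enat k"
    and g: "g ` {..<k} \<subseteq> carrier ?R" and gen: "vanishing_ideal 6 ?M ?W = Idl\<^bsub>?R\<^esub> (g ` {..<k})"
    unfolding complete_intersection_def parabolic_nilradical_eq by blast
  interpret R: cring ?R by (rule cring_coordinate_ring)
  have "k = 2" using k codim_variety_3111 by simp
  then have img: "g ` {..<k} = {g 0, g 1}" by (auto simp: numeral_2_eq_2 lessThan_Suc)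
  then have g01: "g 0 \<in> carrier ?R" "g 1 \<in> carrier ?R" using g by auto
  have gen_in: "g 0 \<in> vanishing_ideal 6 ?M ?W" "g 1 \<in> vanishing_ideal 6 ?M ?W"
    unfolding gen img using R.genideal_self[of "{g 0, g 1}"] g01 by auto
  \<comment> \<open>For \<open>l = 0, 1, 2\<close> the pairs \<open>(r l, s l)\<close> are the row
    pairs \<open>(0, 1)\<close>, \<open>(0, 2)\<close> and \<open>(1, 2)\<close>; the default values
    keep the lemmas on \<open>rs\<close> valid for every \<open>l\<close>.\<close>
  define r where "r = (\<lambda>l :: nat. if l = 2 then 1 else 0 :: nat)"
  define s where "s = (\<lambda>l :: nat. if l = 0 then 1 else 2 :: nat)"
  have rs: "r l < 3" "s l < 3" "r l \<noteq> s l" "r l < 6" "s l < 6" for l by (auto simp: r_def s_def)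
  define T where "T = (\<lambda>l t. test_mat (r l) (s l) t t t)"
  have T_bn: "test_mat (r l) (s l) x y z \<in> ?M" for l x y z
    using rs[of l] by (auto simp: test_mat_def block_nilradical_def block_def)
  have carr: "\<exists>p\<in>polyfuns 6. \<forall>X\<in>?M. f X = p X" if "f \<in> carrier ?R" for f
    using that by (auto simp: coordinate_ring_def)
  have wedge_in: "(\<lambda>X\<in>?M. wedge X (r l) (s l)) \<in> vanishing_ideal 6 ?M ?W" for l
    unfolding vanishing_ideal_def
  proof (intro CollectI conjI ballI)
    show "(\<lambda>X\<in>?M. wedge X (r l) (s l)) \<in> carrier ?R"
      using wedge_polyfuns[OF rs(4,5)] by (simp add: coordinate_ring_def)
    show "(\<lambda>X\<in>?M. wedge X (r l) (s l)) X = 0" if "X \<in> ?W" for X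
      using closure_variety_3111_wedge[OF that rs(4,5)] closure_variety_3111_subset that by auto
  qed
  have "\<exists>a b. a \<in> polyfuns 6 \<and> b \<in> polyfuns 6 \<and> (\<forall>X\<in>?M. wedge X (r l) (s l) = a X * g 0 X + b X * g 1 X)" for l
  proof -
    have "(\<lambda>X\<in>?M. wedge X (r l) (s l)) \<in> Idl\<^bsub>?R\<^esub> {g 0, g 1}" using wedge_in gen img by auto
    then obtain a b where ab: "a \<in> carrier ?R" "b \<in> carrier ?R"
      "(\<lambda>X\<in>?M. wedge X (r l) (s l)) = a \<otimes>\<^bsub>?R\<^esub> g 0 \<oplus>\<^bsub>?R\<^esub> b \<otimes>\<^bsub>?R\<^esub> g 1"
      by (rule R.genideal_two[OF g01])
    obtain a' b' where ab': "a' \<in> polyfuns 6" "b' \<in> polyfuns 6" "\<forall>X\<in>?M. a X = a' X" "\<forall>X\<in>?M. b X = b' X"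
      using carr[OF ab(1)] carr[OF ab(2)] by blast
    have "wedge X (r l) (s l) = a' X * g 0 X + b' X * g 1 X" if "X \<in> ?M" for X
      using fun_cong[OF ab(3), of X] that ab' by (simp add: coordinate_ring_def)
    then show ?thesis using ab' by blast
  qed
  then obtain a b where ab: "\<And>l. a l \<in> polyfuns 6" "\<And>l. b l \<in> polyfuns 6"
    "\<And>l X. X \<in> ?M \<Longrightarrow> wedge X (r l) (s l) = a l X * g 0 X + b l X * g 1 X" by metis
  have "\<exists>q\<in>polyfuns 6. \<forall>t. f (T l t) = t ^ 3 * q (T l t)" if f: "f \<in> vanishing_ideal 6 ?M ?W" for f l
  proof -
    have "f \<in> carrier ?R" using f by (simp add: vanishing_ideal_def)
    from carr[OF this] obtain p where p: "p \<in> polyfuns 6" "\<forall>X\<in>?M. f X = p X" by blast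
    have "p (test_mat (r l) (s l) x y z) = 0" if "x = 0 \<or> y = 0 \<or> z = 0" for x y z
    proof -
      have "f (test_mat (r l) (s l) x y z) = 0"
        using test_mat_in_closure[OF rs(1,2,3) that] f unfolding vanishing_ideal_def by blast
      then show ?thesis using p(2) T_bn by simp
    qed
    from polyfuns_vanishing_on_coordinate_planes[OF p(1) rs(1,2) this]
    show ?thesis using p(2) T_bn unfolding T_def by simp
  qed
  then obtain q0 q1 where q: "\<And>l. q0 l \<in> polyfuns 6" "\<And>l t. g 0 (T l t) = t ^ 3 * q0 l (T l t)"
    "\<And>l. q1 l \<in> polyfuns 6" "\<And>l t. g 1 (T l t) = t ^ 3 * q1 l (T l t)"
    using gen_in by metis
  \<comment> \<open>On \<open>T m t\<close> the vector \<open>a\<close> is concentrated in row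
    \<open>r m\<close> and \<open>b \<kappa>\<close> in row \<open>s m\<close>; as the rows of a
    pair are ordered, only the minor of the same pair survives.\<close>
  have wedge_T: "wedge (T m t) (r l) (s l) = (if l = m then t ^ 3 else 0)" if "l < 3" "m < 3" for l m t
  proof -
    have "l = 0 \<or> l = 1 \<or> l = 2" "m = 0 \<or> m = 1 \<or> m = 2" using that by linarith+
    then show ?thesis
      by (elim disjE) (simp_all add: T_def test_mat_def minor3_def r_def s_def power3_eq_cube)
  qed
  have T0: "T l 0 = 0\<^sub>m 6 6" for l by (rule eq_matI) (auto simp: T_def test_mat_def)
  \<comment> \<open>Cancel \<open>t ^ 3\<close> and let \<open>t\<close> tend to 0. All three
    diagonals meet in the zero matrix, so the coefficient values do not depend on \<open>m\<close>,
    and the identity matrix becomes a product of a 3x2 and a 2x3 matrix.\<close>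
  have "a l (0\<^sub>m 6 6) * q0 m (0\<^sub>m 6 6) + b l (0\<^sub>m 6 6) * q1 m (0\<^sub>m 6 6) = (if l = m then 1 else 0)"
    if lm: "l < 3" "m < 3" for l m
  proof -
    define F where "F = (\<lambda>t. a l (T m t) * q0 m (T m t) + b l (T m t) * q1 m (T m t) - (if l = m then 1 else 0))"
    have curve: "poly_curve 6 (T m)" unfolding T_def by (intro test_mat_poly_curve; simp)
    have "polynomial_fun F"
      unfolding F_def using polyfuns_poly_curve[OF _ curve] ab(1,2) q(1,3) by auto
    moreover have "F t = 0" if "t \<noteq> 0" for t
    proof -
      have "T m t \<in> ?M" unfolding T_def by (rule T_bn)
      from ab(3)[OF this, of l] have "t ^ 3 * F t = 0"
        unfolding wedge_T[OF lm] q(2,4) F_def by (auto simp: algebra_simps)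
      then show ?thesis using that by simp
    qed
    ultimately have "F 0 = 0" by (rule polynomial_fun_eq_0_off_0)
    then show ?thesis unfolding F_def T0 by simp
  qed
  then show False by (rule det3_of_rank_2_product_neq_1)
qed


section \<open>The tableau of the smaller variety\<close>

text \<open>The word 6 3 2 1 4 5 reads the columns of the tableau from bottom to top, starting on
  the left; its row insertion rebuilds the tableau.\<close>

definition column_word :: "nat \<Rightarrow> nat" where
  "column_word k = (if k = 1 then 6 else if k = 2 then 3 else if k = 3 then 2 else if k = 4 then 1
     else if k = 5 then 4 else if k = 6 then 5 else k)"

lemma atLeastAtMost_1_6: "{1..6 :: nat} = {1, 2, 3, 4, 5, 6}"
  by auto

lemma column_word_permutes: "column_word permutes {1..6}"
proof (rule bij_imp_permutes)
  show "bij_betw column_word {1..6} {1..6}"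
    unfolding atLeastAtMost_1_6 by (auto simp: bij_betw_def inj_on_def column_word_def)
qed (auto simp: column_word_def)

lemma insertion_tableau_column_word: "insertion_tableau 6 column_word = [[1, 4, 5], [2], [3], [6]]"
proof -
  have "[1..<6 + 1] = [1, 2, 3, 4, 5, 6 :: nat]" by code_simp
  then show ?thesis by (simp add: insertion_tableau_def column_word_def)
qed

definition last_col_zero :: "complex mat set" where
  "last_col_zero = {X \<in> block_nilradical. \<forall>i<6. X $$ (i, 5) = 0}"

text \<open>A pair occurs when its smaller number stands before the larger one in the word. Since 6
  comes first and 3, 2, 1 decrease, only pairs ending in 4 or 5 remain.\<close>

lemma column_word_roots:
  "pos_roots 6 \<inter> map_prod column_word column_word ` pos_roots 6 =
    {(1, 4), (2, 4), (3, 4), (1, 5), (2, 5), (3, 5), (4, 5)}"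
proof (intro equalityI subsetI)
  fix pq assume pq: "pq \<in> pos_roots 6 \<inter> map_prod column_word column_word ` pos_roots 6"
  then obtain i j where ij: "pq = (column_word i, column_word j)" "1 \<le> i" "i < j" "j \<le> 6" "column_word i < column_word j"
    by (auto simp: pos_roots_def)
  then have "i \<in> {1, 2, 3, 4, 5, 6}" "j \<in> {1, 2, 3, 4, 5, 6}" by auto
  then show "pq \<in> {(1, 4), (2, 4), (3, 4), (1, 5), (2, 5), (3, 5), (4, 5)}"
    using ij(3,5) unfolding ij(1) by (elim insertE emptyE) (simp_all add: column_word_def)
next
  fix pq :: "nat \<times> nat" assume "pq \<in> {(1, 4), (2, 4), (3, 4), (1, 5), (2, 5), (3, 5), (4, 5)}"
  then have "pq \<in> map_prod column_word column_word ` {(4, 5), (3, 5), (2, 5), (4, 6), (3, 6), (2, 6), (5, 6)}"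
    "pq \<in> pos_roots 6"
    by (auto simp: column_word_def pos_roots_def)
  moreover have "{(4, 5), (3, 5), (2, 5), (4, 6), (3, 6), (2, 6), (5, 6)} \<subseteq> pos_roots 6"
    by (auto simp: pos_roots_def)
  ultimately show "pq \<in> pos_roots 6 \<inter> map_prod column_word column_word ` pos_roots 6" by blast
qed

lemma steinberg_space_column_word: "steinberg_space 6 column_word = last_col_zero"
proof
  let ?S = "(\<lambda>(i, j). mat_unit 6 i j) ` {(1, 4), (2, 4), (3, 4), (1, 5), (2, 5), (3, 5), (4, 5)}"
  have sub: "mat_subspace 6 last_col_zero"
    by (auto simp: mat_subspace_def last_col_zero_def block_nilradical_def)
  have "?S \<subseteq> last_col_zero"
    by (auto simp: last_col_zero_def block_nilradical_def block_def)
  then show "steinberg_space 6 column_word \<subseteq> last_col_zero"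
    unfolding steinberg_space_def column_word_roots by (rule mat_span_minimal[OF sub])
  show "last_col_zero \<subseteq> steinberg_space 6 column_word"
    unfolding steinberg_space_def column_word_roots mat_span_def
  proof (intro Inter_greatest subsetI)
    fix V X assume V: "V \<in> {V. mat_subspace 6 V \<and> ?S \<subseteq> V}" and X: "X \<in> last_col_zero"
    have add: "A + B \<in> V" if "A \<in> V" "B \<in> V" for A B using V that by (simp add: mat_subspace_def)
    have smult: "c \<cdot>\<^sub>m A \<in> V" if "A \<in> V" for c A using V that by (simp add: mat_subspace_def)
    have unit: "mat_unit 6 1 4 \<in> V" "mat_unit 6 2 4 \<in> V" "mat_unit 6 3 4 \<in> V" "mat_unit 6 1 5 \<in> V"
      "mat_unit 6 2 5 \<in> V" "mat_unit 6 3 5 \<in> V" "mat_unit 6 4 5 \<in> V" using V by auto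
    let ?Y = "X $$ (0, 3) \<cdot>\<^sub>m mat_unit 6 1 4 + X $$ (1, 3) \<cdot>\<^sub>m mat_unit 6 2 4 + X $$ (2, 3) \<cdot>\<^sub>m mat_unit 6 3 4
      + X $$ (0, 4) \<cdot>\<^sub>m mat_unit 6 1 5 + X $$ (1, 4) \<cdot>\<^sub>m mat_unit 6 2 5 + X $$ (2, 4) \<cdot>\<^sub>m mat_unit 6 3 5
      + X $$ (3, 4) \<cdot>\<^sub>m mat_unit 6 4 5"
    have "X = ?Y"
    proof (rule eq_matI)
      fix i j assume "i < dim_row ?Y" "j < dim_col ?Y"
      then have ij: "i < 6" "j < 6" by auto
      have X0: "X $$ (i, j) = 0" if "block j \<le> block i \<or> j = 5"
        using X that ij by (auto simp: last_col_zero_def block_nilradical_def)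
      show "X $$ (i, j) = ?Y $$ (i, j)"
        using ij X0 by (elim less_6_cases; simp add: block_def)
    qed (use X in \<open>auto simp: last_col_zero_def block_nilradical_def\<close>)
    moreover have "?Y \<in> V" by (intro add smult unit)
    ultimately show "X \<in> V" by simp
  qed
qed

text \<open>Once the earlier columns of \<open>h\<close> are cleared below the diagonal, the entry
  \<open>(i, j)\<close> of \<open>h * g\<close> with \<open>j \<le> i\<close> is
  \<open>h $$ (i, j) * g $$ (j, j)\<close>. The case \<open>i = j\<close> shows that the last factor
  is nonzero.\<close>

lemma upper_triangular_inverse:
  fixes g h :: "'a :: field mat"
  assumes g: "g \<in> carrier_mat n n" "upper_triangular g" and h: "h \<in> carrier_mat n n" and hg: "h * g = 1\<^sub>m n"
  shows "upper_triangular h"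
proof -
  have "\<forall>i<n. j < i \<longrightarrow> h $$ (i, j) = 0" if "j < n" for j
    using that
  proof (induction j rule: less_induct)
    case (less j)
    have g0: "g $$ (k, j) = 0" if "k < n" "j < k" for k using g that by auto
    have entry: "(h * g) $$ (i, j) = h $$ (i, j) * g $$ (j, j)" if i: "i < n" "j \<le> i" for i
    proof -
      have "(\<Sum>k<n. h $$ (i, k) * g $$ (k, j)) = (\<Sum>k\<in>{j}. h $$ (i, k) * g $$ (k, j))"
      proof (rule sum.mono_neutral_right)
        show "\<forall>k\<in>{..<n} - {j}. h $$ (i, k) * g $$ (k, j) = 0"
        proof
          fix k assume k: "k \<in> {..<n} - {j}"
          show "h $$ (i, k) * g $$ (k, j) = 0"
          proof (cases "k < j")
            case True
            then have "h $$ (i, k) = 0" using less.IH[OF True] k i by auto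
            then show ?thesis by simp
          next
            case False
            then show ?thesis using g0[of k] k by simp
          qed
        qed
      qed (use less.prems in auto)
      moreover have "(h * g) $$ (i, j) = (\<Sum>k<n. h $$ (i, k) * g $$ (k, j))"
        using g h i less.prems by (auto simp: scalar_prod_def lessThan_atLeast0)
      ultimately show ?thesis by simp
    qed
    have "h $$ (j, j) * g $$ (j, j) = 1" using entry[of j] less.prems by (simp add: hg)
    then have "g $$ (j, j) \<noteq> 0" by auto
    moreover have "h $$ (i, j) * g $$ (j, j) = 0" if "i < n" "j < i" for i
      using entry[of i] that less.prems by (simp add: hg)
    ultimately show ?case by auto
  qed
  then show ?thesis using h by (auto simp: upper_triangular_def)
qed

section \<open>The closure of the Borel conjugates of the Steinberg space\<close>

lemma block_mono: "i \<le> j \<Longrightarrow> block i \<le> block j"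
  by (auto simp: block_def)

lemma block_nilradical_Borel_conj:
  assumes X: "X \<in> block_nilradical" and g: "g \<in> Borel 6" and wit: "similar_mat_wit Y X g h"
  shows "Y \<in> block_nilradical"
proof -
  have Xc: "X \<in> carrier_mat 6 6" using X block_nilradical_carrier by blast
  note w = similar_mat_witD2[OF Xc similar_mat_wit_sym[OF wit]]
  have Y: "Y = g * X * h" using similar_mat_witD2[OF w(5) wit] by simp
  have gu: "upper_triangular g" using g by (simp add: Borel_def)
  have hu: "upper_triangular h" by (rule upper_triangular_inverse[OF w(7) gu w(6) w(1)])
  have "Y $$ (i, j) = 0" if ij: "i < 6" "j < 6" "block j \<le> block i" for i j
  proof -
    have "(g * X) $$ (i, l) * h $$ (l, j) = 0" if l: "l < 6" for l
    proof (cases "l \<le> j")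
      case True
      have "g $$ (i, k) * X $$ (k, l) = 0" if k: "k < 6" for k
      proof (cases "i \<le> k")
        case True
        have "block l \<le> block k" using block_mono[OF True] block_mono[OF \<open>l \<le> j\<close>] ij(3) by simp
        then show ?thesis using block_nilradical_entry_0[OF X k l] by simp
      next
        case False
        then have "g $$ (i, k) = 0" using upper_triangularD[OF gu, of k i] w(7) ij(1) by simp
        then show ?thesis by simp
      qed
      then have "(g * X) $$ (i, l) = 0" using mult_mat_entry[OF w(7) Xc ij(1) l] by (simp add: sum.neutral)
      then show ?thesis by simp
    next
      case False
      then have "h $$ (l, j) = 0" using upper_triangularD[OF hu, of j l] w(6) l by simp
      then show ?thesis by simp
    qed
    then have "(\<Sum>l<6. (g * X) $$ (i, l) * h $$ (l, j)) = 0" by (intro sum.neutral) auto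
    then show ?thesis using mult_mat_entry[of "g * X" 6 h i j] w Xc ij unfolding Y by simp
  qed
  then show ?thesis using w(5) by (simp add: block_nilradical_def)
qed

text \<open>Moving the entries at \<open>(2, 3)\<close> and \<open>(3, 4)\<close> off zero puts
  \<open>X\<close> into the smaller locus. Conjugation by the fixed \<open>g\<close> preserves the
  locus and carries the curve over to \<open>Y\<close>.\<close>

lemma Borel_conj_last_col_zero_subset:
  "conj_set (Borel 6) last_col_zero \<subseteq> zariski_closure 6 variety_3111"
proof
  fix Y assume "Y \<in> conj_set (Borel 6) last_col_zero"
  then obtain X g h where X: "X \<in> last_col_zero" and g: "g \<in> Borel 6" and wit: "similar_mat_wit Y X g h"
    unfolding conj_set_def by blast
  have Xb: "X \<in> block_nilradical" using X by (simp add: last_col_zero_def)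
  have Xc: "X \<in> carrier_mat 6 6" using Xb block_nilradical_carrier by blast
  note w = similar_mat_witD2[OF Xc similar_mat_wit_sym[OF wit]]
  have Y: "Y = g * X * h" using similar_mat_witD2[OF w(5) wit] by simp
  have Y_sl: "Y \<in> \<ss>\<ll> 6" using block_nilradical_Borel_conj[OF Xb g wit] block_nilradical_sl by blast
  define N where "N = (\<lambda>t. mat 6 6 (\<lambda>ij. X $$ ij + (if ij \<in> {(2, 3), (3, 4)} then t else 0)))"
  have Nc: "N t \<in> carrier_mat 6 6" for t by (simp add: N_def)
  have Nb: "N t \<in> block_nilradical" for t
    using Xb by (auto simp: N_def block_nilradical_def block_def)
  have N0: "N 0 = X" by (rule eq_matI) (use Xc in \<open>auto simp: N_def\<close>)
  have N_variety: "N t \<in> variety_3111" if t: "t \<notin> {- X $$ (2, 3), - X $$ (3, 4)}" for t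
  proof -
    have nz: "X $$ (2, 3) + t \<noteq> 0" "X $$ (3, 4) + t \<noteq> 0" using t by (auto simp: add_eq_0_iff)
    \<comment> \<open>As column 5 vanishes, \<open>v = 0\<close> works, and \<open>u\<close> is
      column 4 divided by its nonzero entry in row 3.\<close>
    have "N t = factored_mat (\<lambda>i. X $$ (i, 3) + (if i = 2 then t else 0)) (\<lambda>i. X $$ (i, 4) / (X $$ (3, 4) + t))
        (\<lambda>j. if j = 4 then X $$ (3, 4) + t else 0) (\<lambda>_. 0)" (is "_ = ?F")
    proof (rule eq_matI)
      fix i j assume "i < dim_row ?F" "j < dim_col ?F"
      then have ij: "i < 6" "j < 6" by (auto simp: factored_mat_def)
      have X0: "X $$ (i, j) = 0" if "block j \<le> block i \<or> j = 5"
        using X that ij by (auto simp: last_col_zero_def block_nilradical_def)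
      show "N t $$ (i, j) = ?F $$ (i, j)"
        using ij X0 nz by (elim less_6_cases; simp add: block_def N_def factored_mat_def)
    qed (auto simp: N_def factored_mat_def)
    moreover have "\<exists>i<3. X $$ (i, 3) + (if i = 2 then t else 0) \<noteq> 0" using nz by (intro exI[of _ 2]) simp
    moreover have "\<exists>j\<in>{4, 5}. (if j = 4 then X $$ (3, 4) + t else 0) \<noteq> 0" using nz by auto
    ultimately show ?thesis unfolding variety_3111_factored using nz by blast
  qed
  have "g * N t * h \<in> variety_3111" if "N t \<in> variety_3111" for t
  proof -
    have wit': "similar_mat_wit (g * N t * h) (N t) g h"
      by (rule similar_mat_witI[of g h 6]) (use w(1,2,6,7) Nc[of t] in auto)
    then have "similar_mat (g * N t * h) (N t)" unfolding similar_mat_def by blast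
    moreover have "similar_mat (N t) nilp_3111" using that by (simp add: variety_3111_def orbit_3111_def)
    ultimately have "g * N t * h \<in> orbit_3111" unfolding orbit_3111_def using similar_mat_trans by blast
    then show ?thesis
      using block_nilradical_Borel_conj[OF Nb g wit'] by (simp add: variety_3111_def)
  qed
  then have "{t. g * N t * h \<notin> variety_3111} \<subseteq> {- X $$ (2, 3), - X $$ (3, 4)}" using N_variety by blast
  then have fin: "finite {t. g * N t * h \<notin> variety_3111}" by (rule finite_subset) simp
  have "poly_curve 6 N" unfolding poly_curve_def by (auto simp: N_def)
  then have "poly_curve 6 (\<lambda>t. g * N t * h)" by (rule poly_curve_conj[OF _ Nc]) (use w in auto)
  from zariski_closure_curve[OF variety_sl(2) this fin, of 0]
  show "Y \<in> zariski_closure 6 variety_3111" using Y_sl by (simp add: N0 Y)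
qed

definition last_col_unipotent :: "complex \<Rightarrow> complex \<Rightarrow> complex mat" where
  "last_col_unipotent s r = mat 6 6 (\<lambda>(i, j). if i = j then 1 else if (i, j) = (3, 5) then s
     else if (i, j) = (4, 5) then r else 0)"

lemma last_col_unipotent_carrier [simp]: "last_col_unipotent s r \<in> carrier_mat 6 6"
  by (simp add: last_col_unipotent_def)

lemma mult_last_col_unipotent:
  assumes "X \<in> carrier_mat 6 6" "i < 6" "j < 6"
  shows "(X * last_col_unipotent s r) $$ (i, j) =
    X $$ (i, j) + (if j = 5 then X $$ (i, 3) * s + X $$ (i, 4) * r else 0)"
  using assms(3)
  by (subst mult_mat_entry[OF assms(1) last_col_unipotent_carrier assms(2,3)], elim less_6_cases)
     (simp_all add: sum_less_6 last_col_unipotent_def)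

lemma last_col_unipotent_inverse: "last_col_unipotent s r * last_col_unipotent (- s) (- r) = 1\<^sub>m 6"
proof (rule eq_matI)
  fix i j assume "i < dim_row (1\<^sub>m 6 :: complex mat)" "j < dim_col (1\<^sub>m 6 :: complex mat)"
  then have "i < 6" "j < 6" by auto
  then show "(last_col_unipotent s r * last_col_unipotent (- s) (- r)) $$ (i, j) = 1\<^sub>m 6 $$ (i, j)"
    by (subst mult_last_col_unipotent) (auto simp: last_col_unipotent_def)
qed (auto simp: last_col_unipotent_def)

lemma last_col_unipotent_Borel: "last_col_unipotent s r \<in> Borel 6"
proof -
  have ut: "upper_triangular (last_col_unipotent s r)" by (auto simp: last_col_unipotent_def)
  have "diag_mat (last_col_unipotent s r) = replicate 6 1"
    by (rule nth_equalityI) (auto simp: diag_mat_def last_col_unipotent_def)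
  then have "det (last_col_unipotent s r) = 1"
    using det_upper_triangular[OF ut last_col_unipotent_carrier] by simp
  then show ?thesis using ut by (simp add: Borel_def SL_group_def)
qed

text \<open>Column operations clear the last column: \<open>r\<close> cancels \<open>c 5\<close>
  against \<open>c 4\<close>, and \<open>s\<close> removes the multiple of \<open>a\<close> that
  remains above. The accompanying row operations add multiples of the last row, which is
  zero.\<close>

lemma variety_3111_Borel_conj:
  assumes X: "X \<in> variety_3111" and ne: "X $$ (3, 4) \<noteq> 0"
  shows "X \<in> conj_set (Borel 6) last_col_zero"
proof -
  obtain a u c v where Xf: "X = factored_mat a u c v" using X unfolding variety_3111_factored by blast
  have Xb: "X \<in> block_nilradical" using X by (simp add: variety_3111_def)
  have Xc: "X \<in> carrier_mat 6 6" using Xb block_nilradical_carrier by blast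
  have c4: "c 4 \<noteq> 0" using ne by (simp add: Xf factored_mat_def)
  define r where "r = - c 5 / c 4"
  define s where "s = - (v 5 + v 4 * r)"
  let ?g = "last_col_unipotent s r" and ?h = "last_col_unipotent (- s) (- r)"
  define Y where "Y = X * ?g"
  have Yc: "Y \<in> carrier_mat 6 6" using Xc by (simp add: Y_def)
  have Ye: "Y $$ (i, j) = X $$ (i, j) + (if j = 5 then X $$ (i, 3) * s + X $$ (i, 4) * r else 0)"
    if "i < 6" "j < 6" for i j unfolding Y_def by (rule mult_last_col_unipotent[OF Xc that])
  have Y0: "Y $$ (i, j) = 0" if ij: "i < 6" "j < 6" "block j \<le> block i \<or> j = 5" for i j
  proof (cases "j = 5")
    case True
    have "X $$ (i, 5) + (X $$ (i, 3) * s + X $$ (i, 4) * r) = 0"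
      using ij(1) c4 by (auto simp: Xf factored_mat_def s_def r_def field_simps)
    then show ?thesis using Ye[of i 5] True ij by simp
  next
    case False
    then show ?thesis using Ye[OF ij(1,2)] block_nilradical_entry_0[OF Xb ij(1,2)] ij(3) by simp
  qed
  have "?g * Y = Y"
  proof (rule eq_matI)
    fix i j assume "i < dim_row Y" "j < dim_col Y"
    then have ij: "i < 6" "j < 6" using Yc by auto
    have "Y $$ (4, j) = 0" "Y $$ (5, j) = 0" using Y0[of 4 j] Y0[of 5 j] ij by (auto simp: block_def)
    then show "(?g * Y) $$ (i, j) = Y $$ (i, j)"
      using ij by (subst mult_mat_entry[OF last_col_unipotent_carrier Yc ij], elim less_6_cases)
        (simp_all add: sum_less_6 last_col_unipotent_def)
  qed (use Yc in \<open>auto simp: last_col_unipotent_def\<close>)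
  moreover have "Y * ?h = X"
  proof -
    have "Y * ?h = X * (?g * ?h)" unfolding Y_def
      by (rule assoc_mult_mat[OF Xc last_col_unipotent_carrier last_col_unipotent_carrier])
    then show ?thesis using Xc by (simp add: last_col_unipotent_inverse)
  qed
  ultimately have "X = ?g * Y * ?h" by simp
  moreover have "?h * ?g = 1\<^sub>m 6" using last_col_unipotent_inverse[of "- s" "- r"] by simp
  ultimately have "similar_mat_wit X Y ?g ?h"
    using last_col_unipotent_inverse Xc Yc last_col_unipotent_carrier
    by (intro similar_mat_witI[of ?g ?h 6])
  moreover have "Y \<in> last_col_zero" using Yc Y0 by (auto simp: last_col_zero_def block_nilradical_def)
  ultimately show ?thesis unfolding conj_set_def using last_col_unipotent_Borel by blast
qed

text \<open>Points of the locus with nonzero entry at \<open>(3, 4)\<close> are Borel conjugates of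
  \<open>last_col_zero\<close>, and they are dense by irreducibility.\<close>

lemma closure_variety_3111_Borel:
  "zariski_closure 6 variety_3111 = zariski_closure 6 (conj_set (Borel 6) last_col_zero)"
proof
  let ?S = "conj_set (Borel 6) last_col_zero"
  show "zariski_closure 6 ?S \<subseteq> zariski_closure 6 variety_3111"
    using Borel_conj_last_col_zero_subset by (rule closure_of_minimal) (rule closedin_closure_of)
  have sl: "?S \<subseteq> \<ss>\<ll> 6"
    using Borel_conj_last_col_zero_subset closure_variety_3111_subset block_nilradical_sl by blast
  have "variety_3111 \<subseteq> zariski_closure 6 ?S"
  proof (rule irreducible_in_subset_closed[OF irreducible_variety_3111])
    show "(\<lambda>X. X $$ (3, 4)) \<in> polyfuns 6" by (intro polyfuns.entry) auto
    show "closedin (zariski 6) (zariski_closure 6 ?S)" by (rule closedin_closure_of)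
    show "nilp_3111 \<in> variety_3111" by (rule nilp_variety)
    show "nilp_3111 $$ (3, 4) \<noteq> 0" by (simp add: nilp_3111_def)
    show "X \<in> zariski_closure 6 ?S" if "X \<in> variety_3111" "X $$ (3, 4) \<noteq> 0" for X
      using variety_3111_Borel_conj[OF that] subset_zariski_closure[OF sl] by blast
  qed
  then show "zariski_closure 6 variety_3111 \<subseteq> zariski_closure 6 ?S"
    by (rule closure_of_minimal) (rule closedin_closure_of)
qed

lemma tableau_variety_3111: "tableau_variety 6 [[1, 4, 5], [2], [3], [6]] variety_3111"
  unfolding tableau_variety_def perm_variety_def orbital_variety_def
  using column_word_permutes insertion_tableau_column_word orbital_variety_of_3111
    closure_variety_3111_Borel[folded steinberg_space_column_word] by blast

theorem mainTheorem4:
  shows "\<exists>I V W. I \<subseteq> {1..<6} \<and> richardson_variety 6 I V \<and> geometric_descendant 6 W V \<and>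
    codim_in (subtopology (zariski 6) (\<mm> 6 I)) (zariski_closure 6 W) = 2 \<and>
    orbit_descendant 6 (assoc_orbit 6 W) (assoc_orbit 6 V) \<and>
    \<not> complete_intersection 6 I W \<and>
    I = {1, 2, 5} \<and> tableau_variety 6 [[1, 4, 5], [2], [3], [6]] W"
proof (intro exI conjI)
  show "richardson_variety 6 {1, 2, 5} variety_321"
    using orbital_variety_of_321 closure_variety_321
    unfolding richardson_variety_def orbital_variety_def parabolic_nilradical_eq by blast
  show "geometric_descendant 6 variety_3111 variety_321" by (rule geometric_descendant_3111)
  show "codim_in (subtopology (zariski 6) (\<mm> 6 {1, 2, 5})) (zariski_closure 6 variety_3111) = 2"
    unfolding parabolic_nilradical_eq codim_variety_3111 by (simp add: numeral_eq_enat)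
  show "orbit_descendant 6 (assoc_orbit 6 variety_3111) (assoc_orbit 6 variety_321)"
    using orbit_descendant_3111 assoc_orbit_eq[OF _ orbital_variety_of_3111]
      assoc_orbit_eq[OF _ orbital_variety_of_321] by simp
  show "\<not> complete_intersection 6 {1, 2, 5} variety_3111" by (rule not_complete_intersection_3111)
  show "tableau_variety 6 [[1, 4, 5], [2], [3], [6]] variety_3111" by (rule tableau_variety_3111)
qed auto


end
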